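(* Let $(\mathfrak{g},\omega)$ be a non abelian real symplectic Poisson algebra and $G$ a connected Lie group having $\mathfrak{g}$ as its Lie algebra. Let $\Omega$ be the left invariant symplectic form on $G$ with value $\omega$ at $e$, and let $\nabla^{\mathrm{a}}$ be the left invariant flat torsion free linear connection on $G$ defined by $$\Omega(\nabla^{\mathrm{a}}_{u^+}v^+,w^+)=-\Omega(v^+,[u^+,w^+]),\qquad u,v,w\in\mathfrak{g}.$$ Then $(\nabla^{\mathrm{a}})^3\Omega=0$. In particular, $\Omega$ is polynomial of degree at least one and at most $2$ in any affine coordinates chart associated to $\nabla^{\mathrm{a}}$. Moreover, if the restriction of $\omega$ to $[\mathfrak{g},\mathfrak{g}]$ does not vanish then the degree is $2$.
   Context: A symplectic Lie algebra $(\mathfrak{g},\omega)$ is a finite dimensional Lie algebra with a nondegenerate skew-symmetric bilinear form $\omega$ such that $\omega([u,v],w)+\omega([v,w],u)+\omega([w,u],v)=0$ for all $u,v,w$. A symplectic Poisson algebra is a symplectic Lie algebra $(\mathfrak{g},\omega)$ which is 2-nilpotent ($[[u,v],w]=0$ for all $u,v,w$) and satisfies $[\mathrm{ad}_u,\mathrm{ad}_v^*]=0$ for all $u,v\in\mathfrak{g}$, where $\mathrm{ad}_v^*$ is the adjoint of $\mathrm{ad}_v$ with respect to $\omega$, i.e. $\omega(\mathrm{ad}_vx,y)=\omega(x,\mathrm{ad}_v^*y)$. For $u\in\mathfrak{g}=T_eG$, $u^+$ is the left invariant vector field on $G$ with $u^+(e)=u$. $(\nabla^{\mathrm{a}})^3\Omega$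 is the third iterated covariant derivative of the tensor field $\Omega$. An affine coordinates chart associated to the flat torsion free connection $\nabla^{\mathrm{a}}$ is a local chart $(x_1,\dots,x_n)$ with $\nabla^{\mathrm{a}}_{\partial_{x_i}}\partial_{x_j}=0$ for all $i,j$; $\Omega$ is polynomial of degree $k$ in such a chart if its components $\Omega(\partial_{x_i},\partial_{x_j})$ are polynomials in the coordinates with maximal degree $k$.
   Formalization: Affine coordinates charts are required to have connected domain; on a disconnected domain the affine coordinates on different components are unrelated, so the components of Ω need not be given by a single polynomial. *)

theory Defs
  imports "HOL-Analysis.Analysis" "HOL-Algebra.Group"
begin

section \<open>Symplectic Lie algebras and symplectic Poisson algebras\<close>

definition Lie_algebra :: "('a::real_vector \<Rightarrow> 'a \<Rightarrow> 'a) \<Rightarrow> bool" where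
  "Lie_algebra br \<longleftrightarrow>
     bilinear br \<and> (\<forall>u. br u u = 0) \<and>
     (\<forall>u v w. br (br u v) w + br (br v w) u + br (br w u) v = 0)"

definition symplectic_Lie_algebra ::
  "('a::real_vector \<Rightarrow> 'a \<Rightarrow> 'a) \<Rightarrow> ('a \<Rightarrow> 'a \<Rightarrow> real) \<Rightarrow> bool" where
  "symplectic_Lie_algebra br om \<longleftrightarrow>
     (\<exists>B::'a set. finite B \<and> span B = UNIV) \<and>
     Lie_algebra br \<and>
     bilinear om \<and> (\<forall>u v. om u v = - om v u) \<and>
     (\<forall>u. (\<forall>v. om u v = 0) \<longrightarrow> u = 0) \<and>
     (\<forall>u v w. om (br u v) w + om (br v w) u + om (br w u) v = 0)"

text \<open>The adjoint is unique (and exists) for linear \<open>f\<close> when \<open>om\<close> is nondegenerate and the space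
  is finite dimensional.\<close>

definition om_adjoint :: "('a \<Rightarrow> 'a \<Rightarrow> real) \<Rightarrow> ('a \<Rightarrow> 'a) \<Rightarrow> 'a \<Rightarrow> 'a" where
  "om_adjoint om f = (THE g. \<forall>x y. om (f x) y = om x (g y))"

definition symplectic_Poisson_algebra ::
  "('a::real_vector \<Rightarrow> 'a \<Rightarrow> 'a) \<Rightarrow> ('a \<Rightarrow> 'a \<Rightarrow> real) \<Rightarrow> bool" where
  "symplectic_Poisson_algebra br om \<longleftrightarrow>
     symplectic_Lie_algebra br om \<and>
     (\<forall>u v w. br (br u v) w = 0) \<and>
     (\<forall>u v. br u \<circ> om_adjoint om (br v) = om_adjoint om (br v) \<circ> br u)"


section \<open>Smooth manifolds\<close>

primrec Ck_on :: "nat \<Rightarrow> 'a::real_normed_vector set \<Rightarrow> ('a \<Rightarrow> 'b::real_normed_vector) \<Rightarrow> bool" where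
  "Ck_on 0 S f \<longleftrightarrow> continuous_on S f"
| "Ck_on (Suc k) S f \<longleftrightarrow>
     (\<exists>f'. (\<forall>x\<in>S. (f has_derivative f' x) (at x)) \<and> (\<forall>v. Ck_on k S (\<lambda>x. f' x v)))"

text \<open>Used for open \<open>S\<close> in finite dimensional spaces only.\<close>

definition smooth_on :: "'a::real_normed_vector set \<Rightarrow> ('a \<Rightarrow> 'b::real_normed_vector) \<Rightarrow> bool" where
  "smooth_on S f \<longleftrightarrow> (\<forall>k. Ck_on k S f)"

type_synonym ('p, 'n) chart = "'p set \<times> ('p \<Rightarrow> real ^ 'n)"

record ('p, 'n) smooth_structure =
  mtop :: "'p topology"
  atlas :: "('p, 'n) chart set"

abbreviation points :: "('p, 'n::finite) smooth_structure \<Rightarrow> 'p set" where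
  "points M \<equiv> topspace (mtop M)"

definition topological_chart ::
  "('p, 'n::finite) smooth_structure \<Rightarrow> ('p, 'n) chart \<Rightarrow> bool" where
  "topological_chart M = (\<lambda>(U, \<phi>).
     openin (mtop M) U \<and> open (\<phi> ` U) \<and>
     homeomorphic_map (subtopology (mtop M) U) (top_of_set (\<phi> ` U)) \<phi>)"

definition smooth_transition :: "('p, 'n::finite) chart \<Rightarrow> ('p, 'n) chart \<Rightarrow> bool" where
  "smooth_transition = (\<lambda>(U, \<phi>) (V, \<psi>). smooth_on (\<phi> ` (U \<inter> V)) (\<psi> \<circ> inv_into U \<phi>))"

definition smooth_manifold :: "('p, 'n::finite) smooth_structure \<Rightarrow> bool" where
  "smooth_manifold M \<longleftrightarrow>
     Hausdorff_space (mtop M) \<and> second_countable (mtop M) \<and>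
     (\<forall>c\<in>atlas M. topological_chart M c) \<and>
     (\<Union>(U, \<phi>)\<in>atlas M. U) = points M \<and>
     (\<forall>c\<in>atlas M. \<forall>d\<in>atlas M. smooth_transition c d)"

text \<open>The charts of the maximal atlas.\<close>

definition smooth_chart ::
  "('p, 'n::finite) smooth_structure \<Rightarrow> ('p, 'n) chart \<Rightarrow> bool" where
  "smooth_chart M c \<longleftrightarrow>
     topological_chart M c \<and>
     (\<forall>d\<in>atlas M. smooth_transition c d \<and> smooth_transition d c)"

definition smooth_fun_on ::
  "('p, 'n::finite) smooth_structure \<Rightarrow> 'p set \<Rightarrow> ('p \<Rightarrow> real) \<Rightarrow> bool" where
  "smooth_fun_on M V f \<longleftrightarrow>
     (\<forall>(U, \<phi>)\<in>atlas M. smooth_on (\<phi> ` (U \<inter> V)) (f \<circ> inv_into U \<phi>))"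

definition smooth_near ::
  "('p, 'n::finite) smooth_structure \<Rightarrow> 'p \<Rightarrow> ('p \<Rightarrow> real) \<Rightarrow> bool" where
  "smooth_near M p f \<longleftrightarrow> (\<exists>V. openin (mtop M) V \<and> p \<in> V \<and> smooth_fun_on M V f)"

definition smooth_map ::
  "('p, 'n::finite) smooth_structure \<Rightarrow> ('q, 'm::finite) smooth_structure \<Rightarrow> ('p \<Rightarrow> 'q) \<Rightarrow> bool" where
  "smooth_map M N F \<longleftrightarrow>
     continuous_map (mtop M) (mtop N) F \<and>
     (\<forall>(U, \<phi>)\<in>atlas M. \<forall>(V, \<psi>)\<in>atlas N.
        smooth_on (\<phi> ` {x \<in> U. F x \<in> V}) (\<psi> \<circ> F \<circ> inv_into U \<phi>))"


section \<open>Tangent vectors, vector fields and the Lie bracket\<close>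

text \<open>A tangent vector at \<open>p\<close> is a derivation on the functions that are smooth near \<open>p\<close>.  It is
  extended by \<open>0\<close> to all other functions, so that it is determined by its values on the former.
  Such a derivation only depends on germs, by the Leibniz rule: if \<open>f\<close> vanishes on an open
  neighbourhood \<open>V\<close> of \<open>p\<close>, then \<open>f = f h\<close> for the indicator function \<open>h\<close> of the complement
  of \<open>V\<close>, which is smooth near \<open>p\<close>.\<close>

type_synonym 'p tvec = "('p \<Rightarrow> real) \<Rightarrow> real"
type_synonym 'p vfield = "'p \<Rightarrow> 'p tvec"

definition tangent_space :: "('p, 'n::finite) smooth_structure \<Rightarrow> 'p \<Rightarrow> 'p tvec set" where
  "tangent_space M p = {v.
     (\<forall>f. \<not> smooth_near M p f \<longrightarrow> v f = 0) \<and>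
     (\<forall>f g. smooth_near M p f \<longrightarrow> smooth_near M p g \<longrightarrow>
        (\<forall>a b. v (\<lambda>x. a * f x + b * g x) = a * v f + b * v g) \<and>
        v (\<lambda>x. f x * g x) = f p * v g + g p * v f)}"

text \<open>Smooth vector fields on the open set \<open>U\<close>; the values outside \<open>U\<close> are irrelevant.\<close>

definition vfields_on :: "('p, 'n::finite) smooth_structure \<Rightarrow> 'p set \<Rightarrow> 'p vfield set" where
  "vfields_on M U = {X.
     (\<forall>p\<in>U. X p \<in> tangent_space M p) \<and>
     (\<forall>V f. openin (mtop M) V \<longrightarrow> V \<subseteq> U \<longrightarrow> smooth_fun_on M V f \<longrightarrow>
        smooth_fun_on M V (\<lambda>p. X p f))}"

definition lie_bracket ::
  "('p, 'n::finite) smooth_structure \<Rightarrow> 'p vfield \<Rightarrow> 'p vfield \<Rightarrow> 'p vfield" where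
  "lie_bracket M X Y = (\<lambda>p f.
     if smooth_near M p f then X p (\<lambda>q. Y q f) - Y p (\<lambda>q. X q f) else 0)"

text \<open>The field \<open>\<partial>/\<partial>x\<^sub>i\<close> of a chart.\<close>

definition coord_field ::
  "('p, 'n::finite) smooth_structure \<Rightarrow> ('p, 'n) chart \<Rightarrow> 'n \<Rightarrow> 'p vfield" where
  "coord_field M = (\<lambda>(U, \<phi>) i p f.
     if smooth_near M p f
     then frechet_derivative (f \<circ> inv_into U \<phi>) (at (\<phi> p)) (axis i 1) else 0)"

definition differential :: "('p \<Rightarrow> 'q) \<Rightarrow> 'p tvec \<Rightarrow> 'q tvec" where
  "differential F v = (\<lambda>f. v (f \<circ> F))"


section \<open>Differential forms of degree two\<close>

type_synonym 'p form2 = "'p \<Rightarrow> 'p tvec \<Rightarrow> 'p tvec \<Rightarrow> real"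

definition two_form :: "('p, 'n::finite) smooth_structure \<Rightarrow> 'p form2 \<Rightarrow> bool" where
  "two_form M Om \<longleftrightarrow>
     (\<forall>p\<in>points M. \<forall>u\<in>tangent_space M p. \<forall>v\<in>tangent_space M p. \<forall>w\<in>tangent_space M p.
        (\<forall>a b. Om p (\<lambda>f. a * u f + b * v f) w = a * Om p u w + b * Om p v w) \<and>
        Om p u v = - Om p v u) \<and>
     (\<forall>U X Y. openin (mtop M) U \<longrightarrow> X \<in> vfields_on M U \<longrightarrow> Y \<in> vfields_on M U \<longrightarrow>
        smooth_fun_on M U (\<lambda>p. Om p (X p) (Y p)))"

definition closed_two_form :: "('p, 'n::finite) smooth_structure \<Rightarrow> 'p form2 \<Rightarrow> bool" where
  "closed_two_form M Om \<longleftrightarrow>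
     (\<forall>U X Y Z. openin (mtop M) U \<longrightarrow>
        X \<in> vfields_on M U \<longrightarrow> Y \<in> vfields_on M U \<longrightarrow> Z \<in> vfields_on M U \<longrightarrow>
        (\<forall>p\<in>U. X p (\<lambda>q. Om q (Y q) (Z q)) + Y p (\<lambda>q. Om q (Z q) (X q))
             + Z p (\<lambda>q. Om q (X q) (Y q))
             - Om p (lie_bracket M X Y p) (Z p) - Om p (lie_bracket M Y Z p) (X p)
             - Om p (lie_bracket M Z X p) (Y p) = 0))"

definition symplectic_form :: "('p, 'n::finite) smooth_structure \<Rightarrow> 'p form2 \<Rightarrow> bool" where
  "symplectic_form M Om \<longleftrightarrow>
     two_form M Om \<and> closed_two_form M Om \<and>
     (\<forall>p\<in>points M. \<forall>u\<in>tangent_space M p.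
        (\<forall>v\<in>tangent_space M p. Om p u v = 0) \<longrightarrow> u = (\<lambda>f. 0))"


section \<open>Linear connections\<close>

text \<open>A linear connection is given as an operator on smooth vector fields over arbitrary open sets
  that is compatible with restriction (second conjunct); thus it can be evaluated directly on
  the coordinate fields of a chart.\<close>

type_synonym 'p connection = "'p vfield \<Rightarrow> 'p vfield \<Rightarrow> 'p vfield"

definition linear_connection :: "('p, 'n::finite) smooth_structure \<Rightarrow> 'p connection \<Rightarrow> bool" where
  "linear_connection M D \<longleftrightarrow>
     (\<forall>U. openin (mtop M) U \<longrightarrow>
       (\<forall>X\<in>vfields_on M U. \<forall>Y\<in>vfields_on M U. D X Y \<in> vfields_on M U) \<and>
       (\<forall>X\<in>vfields_on M U. \<forall>X'\<in>vfields_on M U. \<forall>Y\<in>vfields_on M U. \<forall>Y'\<in>vfields_on M U.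
          (\<forall>p\<in>U. X p = X' p \<and> Y p = Y' p) \<longrightarrow> (\<forall>p\<in>U. D X Y p = D X' Y' p)) \<and>
       (\<forall>X\<in>vfields_on M U. \<forall>X'\<in>vfields_on M U. \<forall>Y\<in>vfields_on M U. \<forall>p\<in>U. \<forall>f.
          D (\<lambda>q h. X q h + X' q h) Y p f = D X Y p f + D X' Y p f) \<and>
       (\<forall>X\<in>vfields_on M U. \<forall>Y\<in>vfields_on M U. \<forall>Y'\<in>vfields_on M U. \<forall>p\<in>U. \<forall>f.
          D X (\<lambda>q h. Y q h + Y' q h) p f = D X Y p f + D X Y' p f) \<and>
       (\<forall>X\<in>vfields_on M U. \<forall>Y\<in>vfields_on M U. \<forall>a. smooth_fun_on M U a \<longrightarrow> (\<forall>p\<in>U. \<forall>f.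
          D (\<lambda>q h. a q * X q h) Y p f = a p * D X Y p f \<and>
          D X (\<lambda>q h. a q * Y q h) p f = X p a * Y p f + a p * D X Y p f)))"

definition torsion_free :: "('p, 'n::finite) smooth_structure \<Rightarrow> 'p connection \<Rightarrow> bool" where
  "torsion_free M D \<longleftrightarrow>
     (\<forall>U. openin (mtop M) U \<longrightarrow>
       (\<forall>X\<in>vfields_on M U. \<forall>Y\<in>vfields_on M U. \<forall>p\<in>U. \<forall>f.
          D X Y p f - D Y X p f = lie_bracket M X Y p f))"

definition flat :: "('p, 'n::finite) smooth_structure \<Rightarrow> 'p connection \<Rightarrow> bool" where
  "flat M D \<longleftrightarrow>
     (\<forall>U. openin (mtop M) U \<longrightarrow>
       (\<forall>X\<in>vfields_on M U. \<forall>Y\<in>vfields_on M U. \<forall>Z\<in>vfields_on M U. \<forall>p\<in>U. \<forall>f.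
          D X (D Y Z) p f - D Y (D X Z) p f = D (lie_bracket M X Y) Z p f))"

text \<open>A tensor field of type \<open>(0,k)\<close> is viewed as a map from lists of \<open>k\<close> vector fields to functions.
  The first argument of the covariant derivative is the direction of differentiation:
  \[ (\nabla T)(X,Y_1,\dots,Y_k) = X(T(Y_1,\dots,Y_k))
       - \sum_i T(Y_1,\dots,\nabla_X Y_i,\dots,Y_k). \]\<close>

type_synonym 'p tensor_field = "'p vfield list \<Rightarrow> 'p \<Rightarrow> real"

primrec cov_deriv :: "'p connection \<Rightarrow> 'p tensor_field \<Rightarrow> 'p tensor_field" where
  "cov_deriv D T [] = (\<lambda>p. 0)"
| "cov_deriv D T (X # Ys) = (\<lambda>p.
     X p (T Ys) - (\<Sum>i<length Ys. T (Ys[i := D X (Ys ! i)]) p))"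

definition form_tensor :: "'p form2 \<Rightarrow> 'p tensor_field" where
  "form_tensor Om Xs = (\<lambda>p. Om p ((Xs ! 0) p) ((Xs ! 1) p))"

definition tensor_vanishes ::
  "('p, 'n::finite) smooth_structure \<Rightarrow> nat \<Rightarrow> 'p tensor_field \<Rightarrow> bool" where
  "tensor_vanishes M k T \<longleftrightarrow>
     (\<forall>U Xs. openin (mtop M) U \<longrightarrow> length Xs = k \<longrightarrow> set Xs \<subseteq> vfields_on M U \<longrightarrow>
        (\<forall>p\<in>U. T Xs p = 0))"

text \<open>Domains of charts are required to be connected here: otherwise the affine coordinates on the
  different components of the domain would be unrelated, and a function that is polynomial on
  each component need not be given by a single polynomial.\<close>

definition affine_chart ::
  "('p, 'n::finite) smooth_structure \<Rightarrow> 'p connection \<Rightarrow> ('p, 'n) chart \<Rightarrow> bool" where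
  "affine_chart M D c \<longleftrightarrow>
     smooth_chart M c \<and> connectedin (mtop M) (fst c) \<and>
     (\<forall>i j. \<forall>p\<in>fst c. D (coord_field M c i) (coord_field M c j) p = (\<lambda>f. 0))"

text \<open>A polynomial in the coordinates \<open>x $ i\<close> is given by its coefficients, indexed by
  the multi-indices \<open>\<alpha> :: 'n \<Rightarrow> nat\<close>; its degree is the total degree.\<close>

definition multi_degree :: "('n::finite \<Rightarrow> nat) \<Rightarrow> nat" where
  "multi_degree \<alpha> = (\<Sum>i\<in>UNIV. \<alpha> i)"

definition poly_value :: "nat \<Rightarrow> (('n::finite \<Rightarrow> nat) \<Rightarrow> real) \<Rightarrow> real ^ 'n \<Rightarrow> real" where
  "poly_value k P x = (\<Sum>\<alpha> | multi_degree \<alpha> \<le> k. P \<alpha> * (\<Prod>i\<in>UNIV. (x $ i) ^ \<alpha> i))"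

text \<open>The components of \<open>Om\<close> in the chart are polynomials of degree at most \<open>k\<close> in the coordinates,
  and one of them has degree exactly \<open>k\<close>.\<close>

definition polynomial_of_degree ::
  "('p, 'n::finite) smooth_structure \<Rightarrow> 'p form2 \<Rightarrow> ('p, 'n) chart \<Rightarrow> nat \<Rightarrow> bool" where
  "polynomial_of_degree M Om c k \<longleftrightarrow>
     (\<exists>P. (\<forall>i j. \<forall>p\<in>fst c.
             Om p (coord_field M c i p) (coord_field M c j p) = poly_value k (P i j) (snd c p)) \<and>
          (\<exists>i j \<alpha>. multi_degree \<alpha> = k \<and> P i j \<alpha> \<noteq> 0))"


section \<open>Lie groups\<close>

definition Lie_group :: "('p, 'r) monoid_scheme \<Rightarrow> ('p, 'n::finite) smooth_structure \<Rightarrow> bool" where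
  "Lie_group G M \<longleftrightarrow>
     group G \<and> smooth_manifold M \<and> carrier G = points M \<and>
     smooth_map M M (m_inv G) \<and>
     continuous_map (prod_topology (mtop M) (mtop M)) (mtop M) (\<lambda>(x, y). x \<otimes>\<^bsub>G\<^esub> y) \<and>
     (\<forall>(U, \<phi>)\<in>atlas M. \<forall>(V, \<psi>)\<in>atlas M. \<forall>(W, \<kappa>)\<in>atlas M.
        smooth_on {(\<phi> x, \<psi> y) |x y. x \<in> U \<and> y \<in> V \<and> x \<otimes>\<^bsub>G\<^esub> y \<in> W}
          (\<lambda>(s, t). \<kappa> (inv_into U \<phi> s \<otimes>\<^bsub>G\<^esub> inv_into V \<psi> t)))"

definition left_transl :: "('p, 'r) monoid_scheme \<Rightarrow> 'p \<Rightarrow> 'p \<Rightarrow> 'p" where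
  "left_transl G a = (\<lambda>x. a \<otimes>\<^bsub>G\<^esub> x)"

text \<open>The left invariant vector field whose value at the identity is the tangent vector \<open>u\<close>.\<close>

definition left_inv_field :: "('p, 'r) monoid_scheme \<Rightarrow> 'p tvec \<Rightarrow> 'p vfield" where
  "left_inv_field G u = (\<lambda>p. differential (left_transl G p) u)"

text \<open>The linear isomorphism \<open>\<iota>\<close> identifies the Lie algebra \<open>('a, br)\<close> with the tangent space at the
  identity, whose bracket is that of the left invariant vector fields.\<close>

definition Lie_algebra_of_group ::
  "('p, 'r) monoid_scheme \<Rightarrow> ('p, 'n::finite) smooth_structure \<Rightarrow>
   ('a::real_vector \<Rightarrow> 'a \<Rightarrow> 'a) \<Rightarrow> ('a \<Rightarrow> 'p tvec) \<Rightarrow> bool" where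
  "Lie_algebra_of_group G M br \<iota> \<longleftrightarrow>
     bij_betw \<iota> UNIV (tangent_space M \<one>\<^bsub>G\<^esub>) \<and>
     (\<forall>a b u v. \<iota> (a *\<^sub>R u + b *\<^sub>R v) = (\<lambda>f. a * \<iota> u f + b * \<iota> v f)) \<and>
     (\<forall>u v. \<iota> (br u v) =
        lie_bracket M (left_inv_field G (\<iota> u)) (left_inv_field G (\<iota> v)) \<one>\<^bsub>G\<^esub>)"

definition left_invariant_form ::
  "('p, 'r) monoid_scheme \<Rightarrow> ('p, 'n::finite) smooth_structure \<Rightarrow> 'p form2 \<Rightarrow> bool" where
  "left_invariant_form G M Om \<longleftrightarrow>
     (\<forall>a\<in>carrier G. \<forall>p\<in>carrier G. \<forall>u\<in>tangent_space M p. \<forall>v\<in>tangent_space M p.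
        Om (a \<otimes>\<^bsub>G\<^esub> p) (differential (left_transl G a) u) (differential (left_transl G a) v) = Om p u v)"

definition push_field :: "('p, 'r) monoid_scheme \<Rightarrow> 'p \<Rightarrow> 'p vfield \<Rightarrow> 'p vfield" where
  "push_field G a X = (\<lambda>p. differential (left_transl G a) (X (inv\<^bsub>G\<^esub> a \<otimes>\<^bsub>G\<^esub> p)))"

definition left_invariant_connection ::
  "('p, 'r) monoid_scheme \<Rightarrow> ('p, 'n::finite) smooth_structure \<Rightarrow> 'p connection \<Rightarrow> bool" where
  "left_invariant_connection G M D \<longleftrightarrow>
     (\<forall>a\<in>carrier G. \<forall>U. openin (mtop M) U \<longrightarrow>
       (\<forall>X\<in>vfields_on M U. \<forall>Y\<in>vfields_on M U. \<forall>p\<in>left_transl G a ` U.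
          D (push_field G a X) (push_field G a Y) p = push_field G a (D X Y) p))"

end

theory Submission
  imports Defs
begin

text \<open>In the frame of left invariant fields \<open>\<nabla> u\<^sup>+ v\<^sup>+ = (u \<cdot> v)\<^sup>+\<close> with \<open>u \<cdot> v = - ad\<^sub>u\<^sup>* v\<close>. As \<open>\<Omega>\<close> is constant in
  this frame, the cocycle identity, 2-nilpotency and \<open>[ad\<^sub>u, ad\<^sub>v\<^sup>*] = 0\<close> give
  \<open>\<nabla>\<Omega>(u, v, w) = \<omega>(u, [v, w])\<close>, \<open>\<nabla>\<^sup>2\<Omega>(z, u, v, w) = -2 \<omega>([v, w], [z, u])\<close> and \<open>\<nabla>\<^sup>3\<Omega> = 0\<close>.
  In affine coordinates \<open>\<nabla>\<^sup>k\<Omega>\<close> consists of the \<open>k\<close>-th partial derivatives of the components of \<open>\<Omega>\<close>,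
  so these are polynomials of degree at most 2 on the connected domain, and a lower degree would
  force \<open>\<nabla>\<^sup>2\<Omega>\<close> or \<open>\<nabla>\<Omega>\<close> to vanish.\<close>

section \<open>Smooth functions between Euclidean spaces\<close>

text \<open>Two frames have to be compared. The algebra takes place in left invariant fields, where
  \<open>\<Omega>\<close> is constant; polynomials appear only in the coordinate fields of an affine
  chart, where the connection is trivial. The bridge is that iterated covariant derivatives are
  multilinear over the smooth functions, so that vanishing on one frame means vanishing on the
  other. Tangent vectors are derivations, and even their expansion in a chart rests on Hadamard's
  lemma; hence the calculus of \<open>Ck_on\<close> and of integrals along segments.

  The product is forced by the relation that defines the connection, since \<open>\<omega>\<close>
  is nondegenerate. Commutation of \<open>ad\<close> with adjoints pulls left multiplication by
  \<open>y\<close> out of a bracket, and adjunction then turns it into \<open>ad_y\<close> acting on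
  the opposite entry of \<open>\<omega>\<close>. In \<open>\<nabla>^2 \<Omega>\<close> both entries
  are brackets, so one more derivative leaves only double brackets. Conversely
  \<open>\<nabla> \<Omega> = 0\<close> would make all brackets vanish by nondegeneracy, and
  \<open>\<nabla>^2 \<Omega> = 0\<close> would make \<open>\<omega>\<close> vanish on
  \<open>[g, g]\<close>.\<close>

lemma Ck_on_cong:
  assumes "open S" "\<And>x. x \<in> S \<Longrightarrow> f x = g x" "Ck_on k S f"
  shows "Ck_on k S g"
proof (cases k)
  case 0
  with assms show ?thesis by (simp cong: continuous_on_cong)
next
  case (Suc j)
  with assms(3) obtain f' where f': "\<And>x. x \<in> S \<Longrightarrow> (f has_derivative f' x) (at x)"
    and C: "\<And>v. Ck_on j S (\<lambda>x. f' x v)" by auto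
  have "(g has_derivative f' x) (at x)" if "x \<in> S" for x
    using has_derivative_transform_within_open[OF f'[OF that] assms(1) that] assms(2) by auto
  with C Suc show ?thesis by auto
qed

text \<open>Derivatives are unique, so the one chosen inside \<open>Ck_on\<close> may be replaced by
  the canonical \<open>frechet_derivative\<close>. The choice then no longer depends on the set,
  which is what makes gluing over open covers possible.\<close>

lemma Ck_on_Suc_iff:
  assumes "open S"
  shows "Ck_on (Suc k) S f \<longleftrightarrow>
     (\<forall>x\<in>S. f differentiable (at x)) \<and> (\<forall>v. Ck_on k S (\<lambda>x. frechet_derivative f (at x) v))"
    (is "?L \<longleftrightarrow> ?R")
proof
  assume ?L
  then obtain f' where f': "\<And>x. x \<in> S \<Longrightarrow> (f has_derivative f' x) (at x)"
    and C: "\<And>v. Ck_on k S (\<lambda>x. f' x v)" by auto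
  have "frechet_derivative f (at x) = f' x" if "x \<in> S" for x
    using frechet_derivative_at[OF f'[OF that]] by simp
  then have "Ck_on k S (\<lambda>x. frechet_derivative f (at x) v)" for v
    using Ck_on_cong[OF assms _ C[of v]] by auto
  with f' show ?R by (auto simp: differentiable_def)
next
  assume R: ?R
  then have "\<forall>x\<in>S. (f has_derivative frechet_derivative f (at x)) (at x)"
    by (simp add: frechet_derivative_works)
  with R show ?L by auto
qed

lemma Ck_on_SucD: "Ck_on (Suc k) S f \<Longrightarrow> Ck_on k S f"
proof (induction k arbitrary: f)
  case 0
  then show ?case
    by (auto intro!: continuous_at_imp_continuous_on dest: has_derivative_continuous)
next
  case (Suc k)
  from Suc.prems obtain f' where "\<And>x. x \<in> S \<Longrightarrow> (f has_derivative f' x) (at x)"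
    and "\<And>v. Ck_on (Suc k) S (\<lambda>x. f' x v)" unfolding Ck_on.simps(2)[of "Suc k"] by blast
  with Suc.IH show ?case unfolding Ck_on.simps(2)[of k] by blast
qed

lemma Ck_on_continuous: "Ck_on k S f \<Longrightarrow> continuous_on S f"
proof (induction k)
  case (Suc k)
  then show ?case by (blast dest: Ck_on_SucD)
qed simp

lemma Ck_on_subset: "Ck_on k S f \<Longrightarrow> T \<subseteq> S \<Longrightarrow> Ck_on k T f"
proof (induction k arbitrary: f)
  case 0
  then show ?case by (auto intro: continuous_on_subset)
next
  case (Suc k)
  from Suc.prems obtain f' where "\<And>x. x \<in> S \<Longrightarrow> (f has_derivative f' x) (at x)"
    and "\<And>v. Ck_on k S (\<lambda>x. f' x v)" by auto
  with Suc show ?case by (auto intro!: exI[of _ f'])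
qed

lemma Ck_on_local:
  assumes "open S" "\<And>x. x \<in> S \<Longrightarrow> \<exists>T. open T \<and> x \<in> T \<and> T \<subseteq> S \<and> Ck_on k T f"
  shows "Ck_on k S f"
  using assms(2)
proof (induction k arbitrary: f)
  case 0
  have "continuous (at x) f" if "x \<in> S" for x
    using 0[OF that] by (auto simp: continuous_on_eq_continuous_at)
  then show ?case by (auto intro: continuous_at_imp_continuous_on)
next
  case (Suc k)
  have "\<exists>T. open T \<and> x \<in> T \<and> T \<subseteq> S \<and> f differentiable (at x) \<and>
      (\<forall>v. Ck_on k T (\<lambda>x. frechet_derivative f (at x) v))" if "x \<in> S" for x
    using Suc.prems[OF that] by (metis Ck_on_Suc_iff)
  then show ?case
    unfolding Ck_on_Suc_iff[OF assms(1)] by (intro conjI ballI allI Suc.IH) blast+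
qed

lemma Ck_on_const: "Ck_on k S (\<lambda>x. c)"
  by (induction k arbitrary: c) (auto intro!: exI[of _ "\<lambda>x v. 0"])

lemma Ck_on_bounded_linear:
  assumes "bounded_linear h" "Ck_on k S f" shows "Ck_on k S (\<lambda>x. h (f x))"
  using assms(2)
proof (induction k arbitrary: f)
  case 0
  then show ?case by (auto intro: bounded_linear.continuous_on[OF assms(1)])
next
  case (Suc k)
  then obtain f' where "\<And>x. x \<in> S \<Longrightarrow> (f has_derivative f' x) (at x)"
    and "\<And>v. Ck_on k S (\<lambda>x. f' x v)" by auto
  with Suc.IH show ?case
    by (auto intro!: exI[of _ "\<lambda>x v. h (f' x v)"] bounded_linear.has_derivative[OF assms(1)])
qed

lemma Ck_on_ident: "Ck_on k S (\<lambda>x. x)"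
  by (cases k) (auto intro!: exI[of _ "\<lambda>x v. v"] Ck_on_const continuous_intros derivative_eq_intros)

lemma Ck_on_add:
  assumes "Ck_on k S f" "Ck_on k S g" shows "Ck_on k S (\<lambda>x. f x + g x)"
  using assms
proof (induction k arbitrary: f g)
  case 0
  then show ?case by (auto intro: continuous_intros)
next
  case (Suc k)
  obtain f' where f: "\<And>x. x \<in> S \<Longrightarrow> (f has_derivative f' x) (at x)"
    "\<And>v. Ck_on k S (\<lambda>x. f' x v)" using Suc.prems(1) by auto
  obtain g' where g: "\<And>x. x \<in> S \<Longrightarrow> (g has_derivative g' x) (at x)"
    "\<And>v. Ck_on k S (\<lambda>x. g' x v)" using Suc.prems(2) by auto
  show ?case
    using f g Suc.IH by (auto intro!: exI[of _ "\<lambda>x v. f' x v + g' x v"] derivative_intros)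
qed

lemma Ck_on_bilinear:
  assumes h: "bounded_bilinear h" and "Ck_on k S f" "Ck_on k S g"
  shows "Ck_on k S (\<lambda>x. h (f x) (g x))"
  using assms(2-)
proof (induction k arbitrary: f g)
  case 0
  then show ?case by (auto intro: bounded_bilinear.continuous_on[OF h])
next
  case (Suc k)
  obtain f' where f: "\<And>x. x \<in> S \<Longrightarrow> (f has_derivative f' x) (at x)"
    "\<And>v. Ck_on k S (\<lambda>x. f' x v)" using Suc.prems(1) by auto
  obtain g' where g: "\<And>x. x \<in> S \<Longrightarrow> (g has_derivative g' x) (at x)"
    "\<And>v. Ck_on k S (\<lambda>x. g' x v)" using Suc.prems(2) by auto
  show ?case
    using f g Suc.IH Suc.prems[THEN Ck_on_SucD]
    by (auto intro!: exI[of _ "\<lambda>x v. h (f x) (g' x v) + h (f' x v) (g x)"] Ck_on_add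
        bounded_bilinear.FDERIV[OF h])
qed

lemma Ck_on_sum:
  assumes "\<And>i. i \<in> I \<Longrightarrow> Ck_on k S (f i)"
  shows "Ck_on k S (\<lambda>x. \<Sum>i\<in>I. f i x)"
  using assms by (induction I rule: infinite_finite_induct) (auto intro: Ck_on_const Ck_on_add)

text \<open>In the chain rule \<open>g' (f x) (f' x v)\<close> the direction fed to
  \<open>g'\<close> depends on \<open>x\<close>, whereas the induction hypothesis covers fixed
  directions only. Expanding \<open>f' x v\<close> in a basis repairs this, which is why the
  intermediate space is Euclidean.\<close>

lemma Ck_on_compose:
  fixes f :: "'a::real_normed_vector \<Rightarrow> 'b::euclidean_space"
    and g :: "'b \<Rightarrow> 'c::real_normed_vector"
  assumes "open S" "Ck_on k S f" "Ck_on k T g" "f ` S \<subseteq> T"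
  shows "Ck_on k S (\<lambda>x. g (f x))"
  using assms(2,3)
proof (induction k arbitrary: g)
  case 0
  then show ?case using assms(4) by (auto intro: continuous_on_compose2)
next
  case (Suc k)
  obtain f' where f: "\<And>x. x \<in> S \<Longrightarrow> (f has_derivative f' x) (at x)"
    "\<And>v. Ck_on k S (\<lambda>x. f' x v)" using Suc.prems(1) by auto
  obtain g' where g: "\<And>x. x \<in> T \<Longrightarrow> (g has_derivative g' x) (at x)"
    "\<And>v. Ck_on k T (\<lambda>x. g' x v)" using Suc.prems(2) by auto
  have eq: "(\<Sum>b\<in>Basis. (f' x v \<bullet> b) *\<^sub>R g' (f x) b) = g' (f x) (f' x v)" if "x \<in> S" for x v
  proof -
    interpret bounded_linear "g' (f x)"
      using g that assms(4) by (blast intro: has_derivative_bounded_linear)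
    show ?thesis
      by (subst (2) euclidean_representation[symmetric, of "f' x v"]) (simp only: sum scaleR)
  qed
  have "Ck_on k S (\<lambda>x. g' (f x) (f' x v))" for v
    by (rule Ck_on_cong[OF assms(1) eq])
      (auto intro!: Ck_on_sum Ck_on_bilinear[OF bounded_bilinear_scaleR]
        Ck_on_bounded_linear[OF bounded_linear_inner_left] f(2) Suc.IH Ck_on_SucD[OF Suc.prems(1)] g(2))
  moreover have "((\<lambda>x. g (f x)) has_derivative (\<lambda>v. g' (f x) (f' x v))) (at x)" if "x \<in> S" for x
    by (rule has_derivative_compose[OF f(1)[OF that] g(1)]) (use that assms(4) in auto)
  ultimately show ?case unfolding Ck_on.simps by (intro exI[of _ "\<lambda>x v. g' (f x) (f' x v)"]) blast
qed

lemma smooth_on_cong: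
  "open S \<Longrightarrow> smooth_on S f \<Longrightarrow> (\<And>x. x \<in> S \<Longrightarrow> f x = g x) \<Longrightarrow> smooth_on S g"
  unfolding smooth_on_def using Ck_on_cong[of S f g] by simp

lemma smooth_on_subset: "smooth_on S f \<Longrightarrow> T \<subseteq> S \<Longrightarrow> smooth_on T f"
  unfolding smooth_on_def using Ck_on_subset[of _ S f T] by simp

lemma smooth_on_local:
  assumes "open S" "\<And>x. x \<in> S \<Longrightarrow> \<exists>T. open T \<and> x \<in> T \<and> T \<subseteq> S \<and> smooth_on T f"
  shows "smooth_on S f"
  using assms(2) unfolding smooth_on_def by (intro allI Ck_on_local[OF assms(1)]) blast

lemma smooth_on_const: "smooth_on S (\<lambda>x. c)"
  by (simp add: smooth_on_def Ck_on_const)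

lemma smooth_on_ident: "smooth_on S (\<lambda>x. x)"
  by (simp add: smooth_on_def Ck_on_ident)

lemma smooth_on_bounded_linear:
  "bounded_linear h \<Longrightarrow> smooth_on S f \<Longrightarrow> smooth_on S (\<lambda>x. h (f x))"
  by (simp add: smooth_on_def Ck_on_bounded_linear)

lemma smooth_on_add: "smooth_on S f \<Longrightarrow> smooth_on S g \<Longrightarrow> smooth_on S (\<lambda>x. f x + g x)"
  by (simp add: smooth_on_def Ck_on_add)

lemma smooth_on_sum:
  "(\<And>i. i \<in> I \<Longrightarrow> smooth_on S (f i)) \<Longrightarrow> smooth_on S (\<lambda>x. \<Sum>i\<in>I. f i x)"
  by (simp add: smooth_on_def Ck_on_sum)

lemma smooth_on_mult:
  fixes f g :: "'a::real_normed_vector \<Rightarrow> real"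
  shows "smooth_on S f \<Longrightarrow> smooth_on S g \<Longrightarrow> smooth_on S (\<lambda>x. f x * g x)"
  by (simp add: smooth_on_def Ck_on_bilinear[OF bounded_bilinear_mult])

lemma smooth_on_compose:
  fixes f :: "'a::real_normed_vector \<Rightarrow> 'b::euclidean_space"
  shows "open S \<Longrightarrow> smooth_on S f \<Longrightarrow> smooth_on T g \<Longrightarrow> f ` S \<subseteq> T \<Longrightarrow> smooth_on S (\<lambda>x. g (f x))"
  unfolding smooth_on_def using Ck_on_compose[of S _ f T g] by simp

lemma smooth_on_differentiable: "smooth_on S f \<Longrightarrow> x \<in> S \<Longrightarrow> f differentiable (at x)"
  unfolding smooth_on_def by (metis Ck_on.simps(2) differentiable_def)

lemma smooth_on_has_derivative:
  "smooth_on S f \<Longrightarrow> x \<in> S \<Longrightarrow> (f has_derivative frechet_derivative f (at x)) (at x)"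
  by (simp add: smooth_on_differentiable flip: frechet_derivative_works)

lemma smooth_on_continuous: "smooth_on S f \<Longrightarrow> continuous_on S f"
  unfolding smooth_on_def by (metis Ck_on.simps(1))

lemma smooth_on_frechet_derivative:
  "open S \<Longrightarrow> smooth_on S f \<Longrightarrow> smooth_on S (\<lambda>x. frechet_derivative f (at x) v)"
  unfolding smooth_on_def by (metis Ck_on_Suc_iff)

section \<open>Integrals along segments and Hadamard's lemma\<close>

lemma segment_point_mem:
  assumes "convex S" "x0 \<in> S" "x \<in> S" "t \<in> cbox (0::real) 1"
  shows "x0 + t *\<^sub>R (x - x0) \<in> S"
  using convexD_alt[OF assms(1-3), of t] assms(4) by (simp add: algebra_simps)

lemma continuous_on_segment_point:
  fixes f :: "'a::real_normed_vector \<Rightarrow> 'b::topological_space"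
  assumes "convex S" "x0 \<in> S" "continuous_on S f"
  shows "continuous_on (S \<times> cbox (0::real) 1) (\<lambda>p. f (x0 + snd p *\<^sub>R (fst p - x0)))"
proof (rule continuous_on_compose2[OF assms(3)])
  show "continuous_on (S \<times> cbox (0::real) 1) (\<lambda>p. x0 + snd p *\<^sub>R (fst p - x0))"
    by (intro continuous_on_add continuous_on_scaleR continuous_on_diff continuous_on_fst
        continuous_on_snd continuous_on_id continuous_on_const)
qed (use segment_point_mem[OF assms(1,2)] in auto)

lemma integrable_on_segment:
  fixes f :: "'a::real_normed_vector \<Rightarrow> real"
  assumes "convex S" "x0 \<in> S" "continuous_on S f" "x \<in> S"
  shows "(\<lambda>t. t ^ m * f (x0 + t *\<^sub>R (x - x0))) integrable_on cbox 0 1"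
proof (intro integrable_continuous continuous_on_mult)
  show "continuous_on (cbox 0 1) (\<lambda>t::real. f (x0 + t *\<^sub>R (x - x0)))"
    by (rule continuous_on_compose2[OF assms(3)])
      (auto intro!: continuous_intros segment_point_mem[OF assms(1,2,4), simplified])
qed (intro continuous_intros)

text \<open>Differentiation under the integral sign: each derivative of
  \<open>x0 + t (x - x0)\<close> contributes a factor \<open>t\<close>. The weight
  \<open>t ^ m\<close> with arbitrary \<open>m\<close> makes the class of integrals closed under
  this, so that the induction on \<open>k\<close> goes through.\<close>

lemma Ck_on_ray_integral:
  fixes f :: "'a::euclidean_space \<Rightarrow> real"
  assumes S: "open S" "convex S" "x0 \<in> S" and "Ck_on k S f"
  shows "Ck_on k S (\<lambda>x. integral (cbox 0 1) (\<lambda>t. t ^ m * f (x0 + t *\<^sub>R (x - x0))))"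
  using assms(4)
proof (induction k arbitrary: f m)
  case 0
  note ray = segment_point_mem[OF S(2,3)]
  have "continuous_on (S \<times> cbox 0 1) (\<lambda>(x, t::real). t ^ m * f (x0 + t *\<^sub>R (x - x0)))"
    using 0 unfolding split_beta
    by (intro continuous_on_mult continuous_on_power continuous_on_snd continuous_on_id
        continuous_on_segment_point[OF S(2,3)]) simp
  from integral_continuous_on_param[OF this] show ?case
    unfolding Ck_on.simps .
next
  case (Suc k)
  note ray = segment_point_mem[OF S(2,3)]
  obtain f' where f: "\<And>x. x \<in> S \<Longrightarrow> (f has_derivative f' x) (at x)"
    "\<And>v. Ck_on k S (\<lambda>x. f' x v)" using Suc.prems by auto
  have cf: "continuous_on S f"
    using f(1) has_derivative_continuous by (blast intro: continuous_at_imp_continuous_on)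
  have cf': "continuous_on S (\<lambda>x. f' x v)" for v
    by (rule Ck_on_continuous) (rule f(2))
  \<comment> \<open>The Leibniz rule asks for the derivative as a bounded linear map that is jointly
    continuous in \<open>x\<close> and \<open>t\<close>. Assembling it from the values on a basis
    reduces this to continuity of the partial derivatives.\<close>
  define fx where "fx x t = (\<Sum>b\<in>Basis. (t ^ Suc m * f' (x0 + t *\<^sub>R (x - x0)) b) *\<^sub>R blinfun_inner_left b)"
    for x and t :: real
  have fx_app: "blinfun_apply (fx x t) v = t ^ Suc m * f' (x0 + t *\<^sub>R (x - x0)) v"
    if "x \<in> S" "t \<in> cbox 0 1" for x t v
  proof -
    interpret bounded_linear "f' (x0 + t *\<^sub>R (x - x0))"
      using f(1)[OF ray[OF that]] by (rule has_derivative_bounded_linear)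
    have "f' (x0 + t *\<^sub>R (x - x0)) v = (\<Sum>b\<in>Basis. (v \<bullet> b) * f' (x0 + t *\<^sub>R (x - x0)) b)"
      by (subst euclidean_representation[symmetric, of v]) (simp only: sum scaleR real_scaleR_def)
    then show ?thesis
      by (simp add: fx_def blinfun.sum_left blinfun.scaleR_left sum_distrib_left inner_commute mult_ac)
  qed
  have cfx: "continuous_on (S \<times> cbox 0 1) (\<lambda>(x, t). fx x t)"
    unfolding split_beta fx_def
    by (intro continuous_on_sum continuous_on_scaleR continuous_on_mult continuous_on_power
        continuous_on_snd continuous_on_id continuous_on_const
        continuous_on_segment_point[OF S(2,3) cf'])
  have deriv: "((\<lambda>x. t ^ m * f (x0 + t *\<^sub>R (x - x0))) has_derivative blinfun_apply (fx x t))
      (at x within S)" if "x \<in> S" "t \<in> cbox 0 1" for x t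
  proof -
    have "((\<lambda>x. x0 + t *\<^sub>R (x - x0)) has_derivative (\<lambda>v. t *\<^sub>R v)) (at x within S)"
      by (auto intro!: derivative_eq_intros)
    from has_derivative_compose[OF this f(1)[OF ray[OF that]]]
    have *: "((\<lambda>x. t ^ m * f (x0 + t *\<^sub>R (x - x0))) has_derivative
       (\<lambda>v. t ^ m * f' (x0 + t *\<^sub>R (x - x0)) (t *\<^sub>R v))) (at x within S)"
      by (intro derivative_intros)
    interpret bounded_linear "f' (x0 + t *\<^sub>R (x - x0))"
      using f(1)[OF ray[OF that]] by (rule has_derivative_bounded_linear)
    show ?thesis
      by (rule has_derivative_eq_rhs[OF *]) (auto simp: fun_eq_iff fx_app[OF that] scaleR)
  qed
  have int: "(\<lambda>t. t ^ m * f (x0 + t *\<^sub>R (x - x0))) integrable_on cbox 0 1" if "x \<in> S" for x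
    by (rule integrable_on_segment[OF S(2,3) cf that])
  have cfx1: "continuous_on (cbox 0 1) (fx x)" if "x \<in> S" for x
  proof -
    have "continuous_on (cbox 0 1) (\<lambda>t. case (x, t) of (x, t) \<Rightarrow> fx x t)"
      by (rule continuous_on_compose2[OF cfx])
        (use that in \<open>auto intro!: continuous_on_Pair continuous_on_const continuous_on_id\<close>)
    then show ?thesis by simp
  qed
  have "((\<lambda>x. integral (cbox 0 1) (\<lambda>t. t ^ m * f (x0 + t *\<^sub>R (x - x0)))) has_derivative
      (\<lambda>v. integral (cbox 0 1) (\<lambda>t. t ^ Suc m * f' (x0 + t *\<^sub>R (x - x0)) v))) (at x)"
    if x: "x \<in> S" for x
  proof -
    have "blinfun_apply (integral (cbox 0 1) (fx x)) v
        = integral (cbox 0 1) (\<lambda>t. t ^ Suc m * f' (x0 + t *\<^sub>R (x - x0)) v)" for v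
    proof -
      have "blinfun_apply (integral (cbox 0 1) (fx x)) v = integral (cbox 0 1) (\<lambda>t. fx x t v)"
        using blinfun_apply_integral[OF integrable_continuous[OF cfx1[OF x]]] .
      also have "\<dots> = integral (cbox 0 1) (\<lambda>t. t ^ Suc m * f' (x0 + t *\<^sub>R (x - x0)) v)"
        by (rule integral_cong) (rule fx_app[OF x])
      finally show ?thesis .
    qed
    moreover have "((\<lambda>x. integral (cbox 0 1) (\<lambda>t. t ^ m * f (x0 + t *\<^sub>R (x - x0)))) has_derivative
        blinfun_apply (integral (cbox 0 1) (fx x))) (at x)"
      using leibniz_rule[OF deriv int cfx x S(2)] by (simp only: at_within_open[OF x S(1)])
    ultimately show ?thesis by (auto elim!: has_derivative_eq_rhs)
  qed
  moreover have "Ck_on k S (\<lambda>x. integral (cbox 0 1) (\<lambda>t. t ^ Suc m * f' (x0 + t *\<^sub>R (x - x0)) v))" for v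
    by (rule Suc.IH[OF f(2)])
  ultimately show ?case
    unfolding Ck_on.simps
    by (intro exI[of _ "\<lambda>x v. integral (cbox 0 1) (\<lambda>t. t ^ Suc m * f' (x0 + t *\<^sub>R (x - x0)) v)"]
        conjI ballI allI)
qed

text \<open>\<open>g b\<close> is the mean value of \<open>\<partial>f/\<partial>b\<close> along the segment from \<open>x0\<close> to \<open>x\<close>.\<close>

lemma Hadamard:
  fixes f :: "'a::euclidean_space \<Rightarrow> real"
  assumes S: "open S" "convex S" "x0 \<in> S" and f: "smooth_on S f"
  obtains g where "\<And>b. smooth_on S (g b)"
    "\<And>x. x \<in> S \<Longrightarrow> f x = f x0 + (\<Sum>b\<in>Basis. ((x - x0) \<bullet> b) * g b x)"
    "\<And>b. g b x0 = frechet_derivative f (at x0) b"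
proof
  let ?f' = "\<lambda>x. frechet_derivative f (at x)"
  \<comment> \<open>The factor \<open>t ^ 0\<close> keeps the integrand in the shape of
    \<open>Ck_on_ray_integral\<close> with \<open>m = 0\<close>.\<close>
  let ?g = "\<lambda>b x. integral (cbox 0 1) (\<lambda>t::real. t ^ 0 * ?f' (x0 + t *\<^sub>R (x - x0)) b)"
  note ray = segment_point_mem[OF S(2,3)]
  have sf': "smooth_on S (\<lambda>x. ?f' x b)" for b
    by (rule smooth_on_frechet_derivative[OF S(1) f])
  show "smooth_on S (?g b)" for b
    using sf'[of b] unfolding smooth_on_def by (intro allI Ck_on_ray_integral[OF S]) blast
  show "?g b x0 = ?f' x0 b" for b by simp
  show "f x = f x0 + (\<Sum>b\<in>Basis. ((x - x0) \<bullet> b) * ?g b x)" if x: "x \<in> S" for x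
  proof -
    have lin: "?f' y (x - x0) = (\<Sum>b\<in>Basis. ((x - x0) \<bullet> b) * ?f' y b)" if "y \<in> S" for y
    proof -
      interpret bounded_linear "?f' y"
        using smooth_on_has_derivative[OF f that] by (rule has_derivative_bounded_linear)
      show ?thesis
        by (subst euclidean_representation[symmetric, of "x - x0"])
          (simp only: sum scaleR real_scaleR_def)
    qed
    have "((\<lambda>t. f (x0 + t *\<^sub>R (x - x0))) has_vector_derivative ?f' (x0 + t *\<^sub>R (x - x0)) (x - x0))
        (at t within {0..1})" if t: "t \<in> {0..1}" for t
    proof -
      have y: "x0 + t *\<^sub>R (x - x0) \<in> S" using ray[OF x] t by auto
      interpret bounded_linear "?f' (x0 + t *\<^sub>R (x - x0))"
        using smooth_on_has_derivative[OF f y] by (rule has_derivative_bounded_linear)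
      have "((\<lambda>t. x0 + t *\<^sub>R (x - x0)) has_derivative (\<lambda>s. s *\<^sub>R (x - x0))) (at t within {0..1})"
        by (auto intro!: derivative_eq_intros)
      from has_derivative_compose[OF this smooth_on_has_derivative[OF f y]]
      show ?thesis by (simp add: has_vector_derivative_def scaleR)
    qed
    then have I: "((\<lambda>t. ?f' (x0 + t *\<^sub>R (x - x0)) (x - x0)) has_integral f x - f x0) {0..1}"
      using fundamental_theorem_of_calculus[of 0 1 "\<lambda>t. f (x0 + t *\<^sub>R (x - x0))"] by auto
    have int: "(\<lambda>t. t ^ 0 * ?f' (x0 + t *\<^sub>R (x - x0)) b) integrable_on cbox (0::real) 1" for b
      by (rule integrable_on_segment[OF S(2,3) smooth_on_continuous[OF sf'] x])
    have "f x - f x0 = integral (cbox 0 1) (\<lambda>t. ?f' (x0 + t *\<^sub>R (x - x0)) (x - x0))"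
      using I by (simp add: integral_unique)
    also have "\<dots> = integral (cbox 0 1)
        (\<lambda>t. \<Sum>b\<in>Basis. ((x - x0) \<bullet> b) * (t ^ 0 * ?f' (x0 + t *\<^sub>R (x - x0)) b))"
      by (rule integral_cong) (simp add: lin ray[OF x])
    also have "\<dots> = (\<Sum>b\<in>Basis. ((x - x0) \<bullet> b) * ?g b x)"
      by (subst integral_sum) (simp_all only: finite_Basis integrable_on_mult_right[OF int] integral_mult_right)
    finally show ?thesis by simp
  qed
qed

section \<open>Smooth functions and tangent vectors on a manifold\<close>

locale manifold =
  fixes M :: "('p, 'n::finite) smooth_structure"
  assumes mfd: "smooth_manifold M"
begin

lemma chart_open: "topological_chart M (U, \<phi>) \<Longrightarrow> openin (mtop M) U"
  by (simp add: topological_chart_def)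

lemma chart_inj: "topological_chart M (U, \<phi>) \<Longrightarrow> inj_on \<phi> U"
  using homeomorphic_imp_injective_map[of "subtopology (mtop M) U" _ \<phi>]
  by (auto simp: topological_chart_def topspace_subtopology Int_absorb1 dest!: openin_subset)

lemma chart_open_image:
  assumes c: "topological_chart M (U, \<phi>)" and W: "openin (mtop M) W" "W \<subseteq> U"
  shows "open (\<phi> ` W)"
proof -
  have "openin (subtopology (mtop M) U) W"
    using W by (auto simp: openin_subtopology)
  then have "openin (top_of_set (\<phi> ` U)) (\<phi> ` W)"
    using c homeomorphic_imp_open_map[of "subtopology (mtop M) U" _ \<phi>]
    by (auto simp: topological_chart_def open_map_def)
  then show ?thesis
    using c by (auto simp: topological_chart_def intro: openin_open_trans)
qed

lemma chart_open_preimage: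
  assumes c: "topological_chart M (U, \<phi>)" and S: "open S"
  shows "openin (mtop M) {p \<in> U. \<phi> p \<in> S}"
proof -
  have "continuous_map (subtopology (mtop M) U) (top_of_set (\<phi> ` U)) \<phi>"
    using c by (auto simp: topological_chart_def homeomorphic_imp_continuous_map)
  moreover have "openin (top_of_set (\<phi> ` U)) (\<phi> ` U \<inter> S)"
    using S by (auto simp: openin_open)
  ultimately have "openin (subtopology (mtop M) U)
      {p \<in> topspace (subtopology (mtop M) U). \<phi> p \<in> \<phi> ` U \<inter> S}"
    by (rule openin_continuous_map_preimage)
  moreover have "{p \<in> topspace (subtopology (mtop M) U). \<phi> p \<in> \<phi> ` U \<inter> S} = {p \<in> U. \<phi> p \<in> S}"
    using openin_subset[OF chart_open[OF c]] by (auto simp: topspace_subtopology)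
  ultimately show ?thesis
    using openin_trans_full[OF _ chart_open[OF c]] by simp
qed

lemma atlas_topological_chart: "c \<in> atlas M \<Longrightarrow> topological_chart M c"
  using mfd by (simp add: smooth_manifold_def)

lemma atlas_smooth_chart: "c \<in> atlas M \<Longrightarrow> smooth_chart M c"
  using mfd by (simp add: smooth_manifold_def smooth_chart_def)

lemma smooth_chart_topological: "smooth_chart M c \<Longrightarrow> topological_chart M c"
  by (simp add: smooth_chart_def)

lemma atlas_cover:
  assumes "p \<in> points M" obtains U \<phi> where "(U, \<phi>) \<in> atlas M" "p \<in> U"
  using assms mfd unfolding smooth_manifold_def by blast

lemma smooth_on_change_chart:
  assumes c: "topological_chart M (U, \<phi>)" and d: "topological_chart M (V, \<psi>)"
    and t: "smooth_transition (U, \<phi>) (V, \<psi>)"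
    and W: "openin (mtop M) W" "W \<subseteq> U" "W \<subseteq> V"
    and f: "smooth_on (\<psi> ` W) (f \<circ> inv_into V \<psi>)"
  shows "smooth_on (\<phi> ` W) (f \<circ> inv_into U \<phi>)"
proof -
  have o: "open (\<phi> ` W)" by (rule chart_open_image[OF c W(1,2)])
  have inv: "inv_into U \<phi> (\<phi> q) = q" "inv_into V \<psi> (\<psi> q) = q" if "q \<in> W" for q
    using that W chart_inj[OF c] chart_inj[OF d] by (auto intro!: inv_into_f_f)
  have "smooth_on (\<phi> ` (U \<inter> V)) (\<psi> \<circ> inv_into U \<phi>)"
    using t by (simp add: smooth_transition_def)
  then have "smooth_on (\<phi> ` W) (\<psi> \<circ> inv_into U \<phi>)"
    by (rule smooth_on_subset) (use W in auto)
  then have "smooth_on (\<phi> ` W) (\<lambda>x. (f \<circ> inv_into V \<psi>) ((\<psi> \<circ> inv_into U \<phi>) x))"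
    by (rule smooth_on_compose[OF o _ f]) (auto simp: inv)
  then show ?thesis
    by (rule smooth_on_cong[OF o]) (auto simp: inv)
qed

lemma smooth_fun_on_subset: "smooth_fun_on M V f \<Longrightarrow> W \<subseteq> V \<Longrightarrow> smooth_fun_on M W f"
  unfolding smooth_fun_on_def by (fastforce intro: smooth_on_subset)

text \<open>\<open>smooth_fun_on\<close> tests the charts of the atlas only, while affine charts
  belong to the maximal atlas. Around each point one passes through an atlas chart by a smooth
  transition and then glues.\<close>

lemma smooth_fun_on_chart:
  assumes V: "openin (mtop M) V" and f: "smooth_fun_on M V f"
    and c: "smooth_chart M (U, \<phi>)"
  shows "smooth_on (\<phi> ` (U \<inter> V)) (f \<circ> inv_into U \<phi>)"
proof (rule smooth_on_local)
  note ct = smooth_chart_topological[OF c]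
  show "open (\<phi> ` (U \<inter> V))"
    by (rule chart_open_image[OF ct]) (use V chart_open[OF ct] in auto)
  fix x assume "x \<in> \<phi> ` (U \<inter> V)"
  then obtain p where p: "p \<in> U" "p \<in> V" "x = \<phi> p" by auto
  then have "p \<in> points M" using openin_subset[OF V] by auto
  then obtain U' \<psi> where d: "(U', \<psi>) \<in> atlas M" "p \<in> U'" by (rule atlas_cover)
  note dt = atlas_topological_chart[OF d(1)]
  let ?W = "U \<inter> V \<inter> U'"
  have W: "openin (mtop M) ?W" using V chart_open[OF ct] chart_open[OF dt] by auto
  have "smooth_on (\<psi> ` (U' \<inter> V)) (f \<circ> inv_into U' \<psi>)"
    using f d(1) by (auto simp: smooth_fun_on_def)
  then have "smooth_on (\<psi> ` ?W) (f \<circ> inv_into U' \<psi>)"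
    by (rule smooth_on_subset) auto
  moreover have "smooth_transition (U, \<phi>) (U', \<psi>)" using c d(1) by (auto simp: smooth_chart_def)
  ultimately have "smooth_on (\<phi> ` ?W) (f \<circ> inv_into U \<phi>)"
    by (intro smooth_on_change_chart[OF ct dt _ W]) auto
  moreover have "open (\<phi> ` ?W)" by (rule chart_open_image[OF ct W]) auto
  ultimately show "\<exists>T. open T \<and> x \<in> T \<and> T \<subseteq> \<phi> ` (U \<inter> V) \<and> smooth_on T (f \<circ> inv_into U \<phi>)"
    using p d(2) by (intro exI[of _ "\<phi> ` ?W"]) auto
qed

lemma smooth_fun_on_chartI:
  assumes W: "openin (mtop M) W" "W \<subseteq> U" and c: "smooth_chart M (U, \<phi>)"
    and f: "smooth_on (\<phi> ` W) (f \<circ> inv_into U \<phi>)"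
  shows "smooth_fun_on M W f"
  unfolding smooth_fun_on_def
proof clarify
  fix V \<psi> assume d: "(V, \<psi>) \<in> atlas M"
  note ct = smooth_chart_topological[OF c] and dt = atlas_topological_chart[OF d]
  show "smooth_on (\<psi> ` (V \<inter> W)) (f \<circ> inv_into V \<psi>)"
  proof (rule smooth_on_change_chart[OF dt ct])
    show "smooth_transition (V, \<psi>) (U, \<phi>)" using c d by (auto simp: smooth_chart_def)
    show "smooth_on (\<phi> ` (V \<inter> W)) (f \<circ> inv_into U \<phi>)" by (rule smooth_on_subset[OF f]) auto
  qed (use W chart_open[OF dt] in auto)
qed

section \<open>Functions that are smooth near a point\<close>

lemma smooth_near_point: "smooth_near M p f \<Longrightarrow> p \<in> points M"
  unfolding smooth_near_def by (auto dest: openin_subset)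

text \<open>Smoothness is local. This links \<open>smooth_near\<close>, on which tangent vectors are
  defined, with \<open>smooth_fun_on\<close>, in terms of which vector fields and connections are
  defined.\<close>

lemma smooth_fun_on_iff_near:
  assumes V: "openin (mtop M) V"
  shows "smooth_fun_on M V f \<longleftrightarrow> (\<forall>p\<in>V. smooth_near M p f)"
proof
  assume "smooth_fun_on M V f"
  with V show "\<forall>p\<in>V. smooth_near M p f" unfolding smooth_near_def by blast
next
  assume near: "\<forall>p\<in>V. smooth_near M p f"
  show "smooth_fun_on M V f"
    unfolding smooth_fun_on_def
  proof clarify
    fix U \<phi> assume c: "(U, \<phi>) \<in> atlas M"
    note ct = atlas_topological_chart[OF c]
    show "smooth_on (\<phi> ` (U \<inter> V)) (f \<circ> inv_into U \<phi>)"
    proof (rule smooth_on_local)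
      show "open (\<phi> ` (U \<inter> V))"
        by (rule chart_open_image[OF ct]) (use V chart_open[OF ct] in auto)
      fix x assume "x \<in> \<phi> ` (U \<inter> V)"
      then obtain p where p: "p \<in> U" "p \<in> V" "x = \<phi> p" by auto
      with near obtain W where W: "openin (mtop M) W" "p \<in> W" "smooth_fun_on M W f"
        by (auto simp: smooth_near_def)
      have "smooth_on (\<phi> ` (U \<inter> W)) (f \<circ> inv_into U \<phi>)"
        using W(3) c by (auto simp: smooth_fun_on_def)
      then have "smooth_on (\<phi> ` (U \<inter> W \<inter> V)) (f \<circ> inv_into U \<phi>)"
        by (rule smooth_on_subset) auto
      moreover have "open (\<phi> ` (U \<inter> W \<inter> V))"
        by (rule chart_open_image[OF ct]) (use V W chart_open[OF ct] in auto)
      ultimately show "\<exists>T. open T \<and> x \<in> T \<and> T \<subseteq> \<phi> ` (U \<inter> V) \<and> smooth_on T (f \<circ> inv_into U \<phi>)"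
        using p W by (intro exI[of _ "\<phi> ` (U \<inter> W \<inter> V)"]) auto
    qed
  qed
qed

lemma smooth_nearI:
  "openin (mtop M) V \<Longrightarrow> p \<in> V \<Longrightarrow> smooth_fun_on M V f \<Longrightarrow> smooth_near M p f"
  unfolding smooth_near_def by blast

lemma smooth_near_cong:
  assumes V: "openin (mtop M) V" "p \<in> V" "\<And>q. q \<in> V \<Longrightarrow> f q = g q" and f: "smooth_near M p f"
  shows "smooth_near M p g"
proof -
  obtain W where W: "openin (mtop M) W" "p \<in> W" "smooth_fun_on M W f"
    using f by (auto simp: smooth_near_def)
  have "smooth_fun_on M (V \<inter> W) g"
    unfolding smooth_fun_on_def
  proof clarify
    fix U \<phi> assume c: "(U, \<phi>) \<in> atlas M"
    note ct = atlas_topological_chart[OF c]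
    have o: "open (\<phi> ` (U \<inter> (V \<inter> W)))"
      by (rule chart_open_image[OF ct]) (use V W chart_open[OF ct] in auto)
    have "smooth_on (\<phi> ` (U \<inter> W)) (f \<circ> inv_into U \<phi>)"
      using W(3) c by (auto simp: smooth_fun_on_def)
    then have "smooth_on (\<phi> ` (U \<inter> (V \<inter> W))) (f \<circ> inv_into U \<phi>)"
      by (rule smooth_on_subset) auto
    then show "smooth_on (\<phi> ` (U \<inter> (V \<inter> W))) (g \<circ> inv_into U \<phi>)"
      by (rule smooth_on_cong[OF o]) (auto simp: V(3) inv_into_f_f[OF chart_inj[OF ct]])
  qed
  then show ?thesis using V W by (intro smooth_nearI[of "V \<inter> W"]) auto
qed

lemma smooth_near_cong_iff:
  assumes "openin (mtop M) V" "p \<in> V" "\<And>q. q \<in> V \<Longrightarrow> f q = g q"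
  shows "smooth_near M p f \<longleftrightarrow> smooth_near M p g"
proof
  assume "smooth_near M p f"
  then show "smooth_near M p g" using smooth_near_cong[OF assms(1,2), of f g] assms(3) by simp
next
  assume "smooth_near M p g"
  then show "smooth_near M p f" using smooth_near_cong[OF assms(1,2), of g f] assms(3) by simp
qed

lemma smooth_near_const: "p \<in> points M \<Longrightarrow> smooth_near M p (\<lambda>x. c)"
  by (intro smooth_nearI[of "points M"])
    (auto simp: smooth_fun_on_def comp_def smooth_on_const)

lemma smooth_near_binop:
  assumes f: "smooth_near M p f" and g: "smooth_near M p g"
    and h: "\<And>S (f' :: real ^ 'n \<Rightarrow> real) g'. smooth_on S f' \<Longrightarrow> smooth_on S g' \<Longrightarrow> smooth_on S (\<lambda>x. h (f' x) (g' x))"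
  shows "smooth_near M p (\<lambda>x. h (f x) (g x))"
proof -
  obtain V where V: "openin (mtop M) V" "p \<in> V" "smooth_fun_on M V f"
    using f by (auto simp: smooth_near_def)
  obtain W where W: "openin (mtop M) W" "p \<in> W" "smooth_fun_on M W g"
    using g by (auto simp: smooth_near_def)
  have "smooth_fun_on M (V \<inter> W) f" "smooth_fun_on M (V \<inter> W) g"
    using smooth_fun_on_subset V W by auto
  then have "smooth_fun_on M (V \<inter> W) (\<lambda>x. h (f x) (g x))"
    by (auto simp: smooth_fun_on_def comp_def intro!: h)
  then show ?thesis using V W by (intro smooth_nearI[of "V \<inter> W"]) auto
qed

lemma smooth_near_add:
  assumes "smooth_near M p f" "smooth_near M p g" shows "smooth_near M p (\<lambda>x. f x + g x)"
  using assms by (rule smooth_near_binop) (rule smooth_on_add)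

lemma smooth_near_mult:
  assumes "smooth_near M p f" "smooth_near M p g" shows "smooth_near M p (\<lambda>x. f x * g x)"
  using assms by (rule smooth_near_binop) (rule smooth_on_mult)

lemma smooth_near_sum:
  assumes "p \<in> points M" "\<And>i. i \<in> I \<Longrightarrow> smooth_near M p (f i)"
  shows "smooth_near M p (\<lambda>x. \<Sum>i\<in>I. f i x)"
  using assms(2)
  by (induction I rule: infinite_finite_induct)
    (auto intro: smooth_near_const[OF assms(1)] smooth_near_add)

lemma smooth_near_chartI:
  assumes c: "smooth_chart M (U, \<phi>)" and p: "p \<in> U" and S: "open S" "\<phi> p \<in> S" "smooth_on S F"
    and F: "\<And>q. q \<in> U \<Longrightarrow> \<phi> q \<in> S \<Longrightarrow> f q = F (\<phi> q)"
  shows "smooth_near M p f"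
proof -
  note ct = smooth_chart_topological[OF c]
  let ?W = "{q \<in> U. \<phi> q \<in> S}"
  have W: "openin (mtop M) ?W" by (rule chart_open_preimage[OF ct S(1)])
  have "smooth_on (\<phi> ` ?W) F" by (rule smooth_on_subset[OF S(3)]) auto
  then have "smooth_on (\<phi> ` ?W) (f \<circ> inv_into U \<phi>)"
    by (rule smooth_on_cong[OF chart_open_image[OF ct W], rotated])
      (auto simp: F inv_into_f_f[OF chart_inj[OF ct]])
  then have "smooth_fun_on M ?W f" by (intro smooth_fun_on_chartI[OF W _ c]) auto
  then show ?thesis using W p S by (intro smooth_nearI[of ?W]) auto
qed

text \<open>A ball is produced because Hadamard's lemma needs a convex domain. The last conclusion
  serves \<open>coord_field\<close>, which is a partial derivative only at points near which
  \<open>f\<close> is smooth.\<close>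

lemma smooth_near_chartE:
  assumes c: "smooth_chart M (U, \<phi>)" and p: "p \<in> U" and f: "smooth_near M p f"
  obtains r where "r > 0" "ball (\<phi> p) r \<subseteq> \<phi> ` U" "smooth_on (ball (\<phi> p) r) (f \<circ> inv_into U \<phi>)"
    "\<forall>q\<in>U. \<phi> q \<in> ball (\<phi> p) r \<longrightarrow> smooth_near M q f"
proof -
  note ct = smooth_chart_topological[OF c]
  obtain V where V: "openin (mtop M) V" "p \<in> V" "smooth_fun_on M V f"
    using f by (auto simp: smooth_near_def)
  have "open (\<phi> ` (U \<inter> V))"
    by (rule chart_open_image[OF ct]) (use V chart_open[OF ct] in auto)
  with p V obtain r where r: "r > 0" "ball (\<phi> p) r \<subseteq> \<phi> ` (U \<inter> V)"
    unfolding open_contains_ball by (metis IntI imageI)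
  show thesis
  proof
    show "smooth_on (ball (\<phi> p) r) (f \<circ> inv_into U \<phi>)"
      by (rule smooth_on_subset[OF smooth_fun_on_chart[OF V(1,3) c] r(2)])
    have "q \<in> V" if "q \<in> U" "\<phi> q \<in> ball (\<phi> p) r" for q
      using that r(2) chart_inj[OF ct] by (auto dest: inj_onD)
    with V show "\<forall>q\<in>U. \<phi> q \<in> ball (\<phi> p) r \<longrightarrow> smooth_near M q f" by (blast intro: smooth_nearI)
  qed (use r in auto)
qed

lemma smooth_near_coordinate:
  assumes c: "smooth_chart M (U, \<phi>)" and p: "p \<in> U"
  shows "smooth_near M p (\<lambda>q. \<phi> q $ i)"
  by (rule smooth_near_chartI[OF c p open_UNIV, where F = "\<lambda>x. x $ i"])
    (auto intro: smooth_on_bounded_linear[OF bounded_linear_vec_nth smooth_on_ident])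

section \<open>Tangent vectors as derivations\<close>

lemma tangent_linear:
  "v \<in> tangent_space M p \<Longrightarrow> smooth_near M p f \<Longrightarrow> smooth_near M p g \<Longrightarrow>
    v (\<lambda>x. a * f x + b * g x) = a * v f + b * v g"
  by (auto simp: tangent_space_def)

lemma tangent_mult:
  "v \<in> tangent_space M p \<Longrightarrow> smooth_near M p f \<Longrightarrow> smooth_near M p g \<Longrightarrow>
    v (\<lambda>x. f x * g x) = f p * v g + g p * v f"
  by (auto simp: tangent_space_def)

lemma tangent_not_smooth: "v \<in> tangent_space M p \<Longrightarrow> \<not> smooth_near M p f \<Longrightarrow> v f = 0"
  by (auto simp: tangent_space_def)

lemma tangent_add:
  "v \<in> tangent_space M p \<Longrightarrow> smooth_near M p f \<Longrightarrow> smooth_near M p g \<Longrightarrow>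
    v (\<lambda>x. f x + g x) = v f + v g"
  using tangent_linear[of v p f g 1 1] by simp

lemma tangent_cmult:
  "v \<in> tangent_space M p \<Longrightarrow> smooth_near M p f \<Longrightarrow> v (\<lambda>x. a * f x) = a * v f"
  using tangent_linear[of v p f f a 0] by simp

lemma tangent_const:
  assumes v: "v \<in> tangent_space M p" and p: "p \<in> points M"
  shows "v (\<lambda>x. c) = 0"
proof -
  \<comment> \<open>Leibniz applied to \<open>1 * 1 = 1\<close> gives
    \<open>v 1 = v 1 + v 1\<close>.\<close>
  have "v (\<lambda>x. 1) = 0"
    using tangent_mult[OF v smooth_near_const[OF p] smooth_near_const[OF p], of 1 1] by simp
  then show ?thesis
    using tangent_cmult[OF v smooth_near_const[OF p], of c 1] by simp
qed

lemma tangent_sum: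
  assumes v: "v \<in> tangent_space M p" and p: "p \<in> points M"
    and "\<And>i. i \<in> I \<Longrightarrow> smooth_near M p (f i)"
  shows "v (\<lambda>x. \<Sum>i\<in>I. f i x) = (\<Sum>i\<in>I. v (f i))"
  using assms(3)
  by (induction I rule: infinite_finite_induct)
    (auto simp: tangent_const[OF v p] tangent_add[OF v] smooth_near_sum[OF p])

text \<open>If \<open>f\<close> and \<open>g\<close> are smooth, the difference
  \<open>d = f - g\<close> satisfies \<open>d = d * h\<close> for the indicator \<open>h\<close> of
  the complement of \<open>W\<close>. Both \<open>d\<close> and \<open>h\<close> vanish at
  \<open>p\<close>, so the Leibniz rule gives \<open>v d = 0\<close>. If they are not smooth, both
  values are 0 by convention.\<close>

lemma tangent_germ:
  assumes v: "v \<in> tangent_space M p" and W: "openin (mtop M) W" "p \<in> W"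
    and eq: "\<And>q. q \<in> W \<Longrightarrow> f q = g q"
  shows "v f = v g"
proof (cases "smooth_near M p f")
  case False
  then show ?thesis
    using smooth_near_cong_iff[OF W, of f g] eq tangent_not_smooth[OF v] by simp
next
  case f: True
  then have g: "smooth_near M p g" using smooth_near_cong_iff[OF W, of f g] eq by simp
  have p: "p \<in> points M" using openin_subset[OF W(1)] W(2) by auto
  define h :: "'p \<Rightarrow> real" where "h = (\<lambda>q. if q \<in> W then 0 else 1)"
  have h: "smooth_near M p h"
    by (rule smooth_near_cong[OF W _ smooth_near_const[OF p, of 0]]) (simp add: h_def)
  have d: "smooth_near M p (\<lambda>q. 1 * f q + (-1) * g q)"
    by (intro smooth_near_add smooth_near_mult smooth_near_const p f g)
  have "(\<lambda>q. (1 * f q + (-1) * g q) * h q) = (\<lambda>q. 1 * f q + (-1) * g q)"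
    using eq by (auto simp: h_def)
  then have "v (\<lambda>q. 1 * f q + (-1) * g q) = 0"
    using tangent_mult[OF v d h] eq[OF W(2)] W(2) by (simp add: h_def)
  then show ?thesis using tangent_linear[OF v f g, of 1 "-1"] by simp
qed

lemma tangent_space_sum:
  assumes "\<And>i. i \<in> I \<Longrightarrow> w i \<in> tangent_space M p"
  shows "(\<lambda>f. \<Sum>i\<in>I. c i * w i f) \<in> tangent_space M p"
  unfolding tangent_space_def
proof (intro CollectI conjI allI impI)
  fix f assume "\<not> smooth_near M p f"
  then show "(\<Sum>i\<in>I. c i * w i f) = 0"
    using tangent_not_smooth[OF assms] by (auto intro!: sum.neutral)
next
  fix f g a b assume fg: "smooth_near M p f" "smooth_near M p g"
  show "(\<Sum>i\<in>I. c i * w i (\<lambda>x. a * f x + b * g x)) = a * (\<Sum>i\<in>I. c i * w i f) + b * (\<Sum>i\<in>I. c i * w i g)"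
    unfolding sum_distrib_left sum.distrib[symmetric]
    by (intro sum.cong refl) (simp add: tangent_linear[OF assms fg] distrib_left mult.left_commute)
next
  fix f g assume fg: "smooth_near M p f" "smooth_near M p g"
  show "(\<Sum>i\<in>I. c i * w i (\<lambda>x. f x * g x)) = f p * (\<Sum>i\<in>I. c i * w i g) + g p * (\<Sum>i\<in>I. c i * w i f)"
    unfolding sum_distrib_left sum.distrib[symmetric]
    by (intro sum.cong refl) (simp add: tangent_mult[OF assms fg] distrib_left mult.left_commute)
qed

text \<open>Hadamard's lemma writes \<open>f\<close> near \<open>p\<close> as \<open>f p\<close>
  plus a sum of terms \<open>(x_i - x_i(p)) * g_i\<close>. A derivation kills the constant and,
  since the first factor vanishes at \<open>p\<close>, leaves \<open>v x_i * g_i(p)\<close>, where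
  \<open>g_i(p)\<close> is the partial derivative.\<close>

lemma tangent_expansion:
  assumes v: "v \<in> tangent_space M p" and c: "smooth_chart M (U, \<phi>)" and p: "p \<in> U"
    and f: "smooth_near M p f"
  shows "v f = (\<Sum>i\<in>UNIV. v (\<lambda>q. \<phi> q $ i) *
     frechet_derivative (f \<circ> inv_into U \<phi>) (at (\<phi> p)) (axis i 1))"
proof -
  note ct = smooth_chart_topological[OF c]
  have pM: "p \<in> points M" using smooth_near_point[OF f] .
  obtain r where r: "r > 0" "ball (\<phi> p) r \<subseteq> \<phi> ` U" "smooth_on (ball (\<phi> p) r) (f \<circ> inv_into U \<phi>)"
    by (rule smooth_near_chartE[OF c p f])
  let ?S = "ball (\<phi> p) r"
  have S: "open ?S" "convex ?S" "\<phi> p \<in> ?S" using r by auto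
  obtain g where g: "\<And>b. smooth_on ?S (g b)"
    "\<And>x. x \<in> ?S \<Longrightarrow> (f \<circ> inv_into U \<phi>) x
        = (f \<circ> inv_into U \<phi>) (\<phi> p) + (\<Sum>b\<in>Basis. ((x - \<phi> p) \<bullet> b) * g b x)"
    "\<And>b. g b (\<phi> p) = frechet_derivative (f \<circ> inv_into U \<phi>) (at (\<phi> p)) b"
    using Hadamard[OF S r(3)] by blast
  have inv: "inv_into U \<phi> (\<phi> q) = q" if "q \<in> U" for q
    using inv_into_f_f[OF chart_inj[OF ct] that] .
  have Basis_sum: "(\<Sum>b\<in>Basis. h b) = (\<Sum>i\<in>UNIV. h (axis i 1))" for h :: "real ^ 'n \<Rightarrow> real"
    by (rule sum.reindex_cong[where l = "\<lambda>i. axis i 1"])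
      (auto simp: Basis_vec_def inj_on_def axis_eq_axis)
  let ?G = "\<lambda>i q. g (axis i 1) (\<phi> q)"
  let ?x = "\<lambda>i q. \<phi> q $ i + (- (\<phi> p $ i))"
  have G: "smooth_near M p (?G i)" for i
    by (rule smooth_near_chartI[OF c p S(1,3) g(1)]) simp
  have x: "smooth_near M p (?x i)" for i
    by (intro smooth_near_add smooth_near_const[OF pM] smooth_near_coordinate[OF c p])
  have vx: "v (?x i) = v (\<lambda>q. \<phi> q $ i)" for i
    by (simp only: tangent_add[OF v smooth_near_coordinate[OF c p] smooth_near_const[OF pM]]
        tangent_const[OF v pM] add_0_right)
  define H where "H i q = ?x i q * ?G i q" for i q
  have H: "smooth_near M p (H i)" for i
    unfolding H_def by (rule smooth_near_mult[OF x G])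
  have vH: "v (H i) = v (\<lambda>q. \<phi> q $ i) * g (axis i 1) (\<phi> p)" for i
    unfolding H_def tangent_mult[OF v x G] vx by simp
  have "v f = v (\<lambda>q. f p + (\<Sum>i\<in>UNIV. H i q))"
  proof (rule tangent_germ[OF v chart_open_preimage[OF ct S(1)]])
    show "p \<in> {q \<in> U. \<phi> q \<in> ?S}" using p S by auto
    fix q assume q: "q \<in> {q \<in> U. \<phi> q \<in> ?S}"
    then show "f q = f p + (\<Sum>i\<in>UNIV. H i q)"
      using g(2)[of "\<phi> q"] p by (simp add: inv Basis_sum inner_axis H_def)
  qed
  also have "\<dots> = v (\<lambda>q. f p) + v (\<lambda>q. \<Sum>i\<in>UNIV. H i q)"
    by (rule tangent_add[OF v smooth_near_const[OF pM] smooth_near_sum[OF pM H]])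
  also have "\<dots> = (\<Sum>i\<in>UNIV. v (H i))"
    unfolding tangent_const[OF v pM] by (simp add: tangent_sum[OF v pM H])
  finally show ?thesis by (simp add: g(3) vH)
qed

end

section \<open>Vector fields and tensor fields\<close>

context manifold
begin

lemma smooth_near_cmult:
  assumes "smooth_near M p f" shows "smooth_near M p (\<lambda>x. a * f x)"
  using smooth_near_mult[OF smooth_near_const[OF smooth_near_point[OF assms]] assms] .

lemma smooth_near_diff:
  assumes "smooth_near M p f" "smooth_near M p g" shows "smooth_near M p (\<lambda>x. f x - g x)"
  using smooth_near_add[OF assms(1) smooth_near_cmult[OF assms(2), of "-1"]] by simp

lemma vfields_onI:
  assumes "openin (mtop M) U" and "\<And>p. p \<in> U \<Longrightarrow> X p \<in> tangent_space M p"
    and "\<And>p f. p \<in> U \<Longrightarrow> smooth_near M p f \<Longrightarrow> smooth_near M p (\<lambda>q. X q f)"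
  shows "X \<in> vfields_on M U"
  using assms by (auto simp: vfields_on_def smooth_fun_on_iff_near)

lemma vfields_on_tangent: "X \<in> vfields_on M U \<Longrightarrow> p \<in> U \<Longrightarrow> X p \<in> tangent_space M p"
  by (simp add: vfields_on_def)

lemma vfields_on_smooth:
  assumes U: "openin (mtop M) U" and X: "X \<in> vfields_on M U" and p: "p \<in> U"
    and f: "smooth_near M p f"
  shows "smooth_near M p (\<lambda>q. X q f)"
proof -
  obtain V where V: "openin (mtop M) V" "p \<in> V" "smooth_fun_on M V f"
    using f by (auto simp: smooth_near_def)
  have "smooth_fun_on M (U \<inter> V) f" using V(3) by (rule smooth_fun_on_subset) auto
  then have "smooth_fun_on M (U \<inter> V) (\<lambda>q. X q f)"
    using X openin_Int[OF U V(1)] by (auto simp: vfields_on_def)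
  then show ?thesis using U V p by (intro smooth_nearI[of "U \<inter> V"]) auto
qed

lemma vfields_on_subset:
  assumes "X \<in> vfields_on M U" "V \<subseteq> U" shows "X \<in> vfields_on M V"
  using assms unfolding vfields_on_def by blast

lemma vfields_on_comb:
  assumes U: "openin (mtop M) U" and X: "X \<in> vfields_on M U" "Y \<in> vfields_on M U"
    and a: "smooth_fun_on M U a" "smooth_fun_on M U b"
  shows "(\<lambda>q h. a q * X q h + b q * Y q h) \<in> vfields_on M U"
proof (rule vfields_onI[OF U])
  fix p assume p: "p \<in> U"
  have ab: "smooth_near M p a" "smooth_near M p b" using a U p by (auto simp: smooth_fun_on_iff_near)
  show "(\<lambda>h. a p * X p h + b p * Y p h) \<in> tangent_space M p"
    \<comment> \<open>The combination of two vectors is a sum indexed by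
      \<open>bool\<close>.\<close>
    using tangent_space_sum[of "UNIV :: bool set" "\<lambda>i. if i then X p else Y p" p "\<lambda>i. if i then a p else b p"]
      X p by (simp add: UNIV_bool vfields_on_tangent add.commute)
  fix f assume f: "smooth_near M p f"
  show "smooth_near M p (\<lambda>q. a q * X q f + b q * Y q f)"
    by (rule smooth_near_add[OF smooth_near_mult[OF ab(1) vfields_on_smooth[OF U X(1) p f]]
          smooth_near_mult[OF ab(2) vfields_on_smooth[OF U X(2) p f]]])
qed

lemma smooth_fun_on_const: "openin (mtop M) U \<Longrightarrow> smooth_fun_on M U (\<lambda>_. c)"
  by (auto simp: smooth_fun_on_iff_near intro!: smooth_near_const dest: openin_subset)

section \<open>Coordinate fields\<close>

lemma coord_field_smooth_near:
  "smooth_near M p f \<Longrightarrow> coord_field M (U, \<phi>) i p f =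
     frechet_derivative (f \<circ> inv_into U \<phi>) (at (\<phi> p)) (axis i 1)"
  by (simp add: coord_field_def)

lemma coord_field_tangent:
  assumes c: "smooth_chart M (U, \<phi>)" and p: "p \<in> U"
  shows "coord_field M (U, \<phi>) i p \<in> tangent_space M p"
proof -
  have inv: "inv_into U \<phi> (\<phi> p) = p"
    using inv_into_f_f[OF chart_inj[OF smooth_chart_topological[OF c]] p] .
  have d: "((f \<circ> inv_into U \<phi>) has_derivative frechet_derivative (f \<circ> inv_into U \<phi>) (at (\<phi> p))) (at (\<phi> p))"
    if f: "smooth_near M p f" for f
  proof -
    obtain r where "r > 0" "smooth_on (ball (\<phi> p) r) (f \<circ> inv_into U \<phi>)"
      by (rule smooth_near_chartE[OF c p f])
    then show ?thesis by (intro smooth_on_has_derivative) auto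
  qed
  show ?thesis
    unfolding tangent_space_def
  proof (intro CollectI conjI allI impI)
    show "\<not> smooth_near M p f \<Longrightarrow> coord_field M (U, \<phi>) i p f = 0" for f
      by (simp add: coord_field_def)
    fix f g assume fg: "smooth_near M p f" "smooth_near M p g"
    note df = d[OF fg(1)] and dg = d[OF fg(2)]
    show "coord_field M (U, \<phi>) i p (\<lambda>x. a * f x + b * g x)
        = a * coord_field M (U, \<phi>) i p f + b * coord_field M (U, \<phi>) i p g" for a b
    proof -
      have "((\<lambda>y. a * (f \<circ> inv_into U \<phi>) y + b * (g \<circ> inv_into U \<phi>) y) has_derivative
          (\<lambda>v. a * frechet_derivative (f \<circ> inv_into U \<phi>) (at (\<phi> p)) v +
               b * frechet_derivative (g \<circ> inv_into U \<phi>) (at (\<phi> p)) v)) (at (\<phi> p))"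
        by (intro has_derivative_add has_derivative_mult_right df dg)
      moreover have "(\<lambda>x. a * f x + b * g x) \<circ> inv_into U \<phi>
          = (\<lambda>y. a * (f \<circ> inv_into U \<phi>) y + b * (g \<circ> inv_into U \<phi>) y)" by auto
      moreover have "smooth_near M p (\<lambda>x. a * f x + b * g x)"
        by (rule smooth_near_add[OF smooth_near_cmult[OF fg(1)] smooth_near_cmult[OF fg(2)]])
      ultimately show ?thesis
        by (simp only: coord_field_smooth_near fg flip: frechet_derivative_at)
    qed
    show "coord_field M (U, \<phi>) i p (\<lambda>x. f x * g x)
        = f p * coord_field M (U, \<phi>) i p g + g p * coord_field M (U, \<phi>) i p f"
    proof -
      have "((\<lambda>y. (f \<circ> inv_into U \<phi>) y * (g \<circ> inv_into U \<phi>) y) has_derivative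
          (\<lambda>v. (f \<circ> inv_into U \<phi>) (\<phi> p) * frechet_derivative (g \<circ> inv_into U \<phi>) (at (\<phi> p)) v +
               frechet_derivative (f \<circ> inv_into U \<phi>) (at (\<phi> p)) v * (g \<circ> inv_into U \<phi>) (\<phi> p))) (at (\<phi> p))"
        by (intro has_derivative_mult df dg)
      moreover have "(\<lambda>x. f x * g x) \<circ> inv_into U \<phi>
          = (\<lambda>y. (f \<circ> inv_into U \<phi>) y * (g \<circ> inv_into U \<phi>) y)" by auto
      ultimately show ?thesis
        by (simp only: coord_field_smooth_near fg smooth_near_mult[OF fg] flip: frechet_derivative_at)
          (simp add: inv)
    qed
  qed
qed

lemma coord_field_vfield:
  assumes c: "smooth_chart M (U, \<phi>)"
  shows "coord_field M (U, \<phi>) i \<in> vfields_on M U"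
proof (rule vfields_onI)
  show "openin (mtop M) U" using chart_open[OF smooth_chart_topological[OF c]] .
  show "coord_field M (U, \<phi>) i p \<in> tangent_space M p" if "p \<in> U" for p
    by (rule coord_field_tangent[OF c that])
  fix p f assume p: "p \<in> U" and f: "smooth_near M p f"
  obtain r where r: "r > 0" "ball (\<phi> p) r \<subseteq> \<phi> ` U"
    "smooth_on (ball (\<phi> p) r) (f \<circ> inv_into U \<phi>)"
    "\<forall>q\<in>U. \<phi> q \<in> ball (\<phi> p) r \<longrightarrow> smooth_near M q f"
    by (rule smooth_near_chartE[OF c p f])
  show "smooth_near M p (\<lambda>q. coord_field M (U, \<phi>) i q f)"
    by (rule smooth_near_chartI[OF c p open_ball _ smooth_on_frechet_derivative[OF open_ball r(3)]])
      (use r in \<open>auto simp: coord_field_smooth_near\<close>)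
qed

lemma vfield_expansion:
  assumes c: "smooth_chart M (U, \<phi>)" and X: "X \<in> vfields_on M U" and p: "p \<in> U"
  shows "X p f = (\<Sum>i\<in>UNIV. X p (\<lambda>q. \<phi> q $ i) * coord_field M (U, \<phi>) i p f)"
proof (cases "smooth_near M p f")
  case True
  then show ?thesis
    using tangent_expansion[OF vfields_on_tangent[OF X p] c p True]
    by (simp add: coord_field_smooth_near)
next
  \<comment> \<open>Both sides take the default value 0 on functions that are not smooth near
    \<open>p\<close>.\<close>
  case False
  then show ?thesis
    using tangent_not_smooth[OF vfields_on_tangent[OF X p]] by (simp add: coord_field_def)
qed

text \<open>A \<open>tensor_field\<close> is an arbitrary function of lists of fields, and the
  values of a field outside \<open>U\<close> are irrelevant. Dependence on the values in
  \<open>U\<close> alone is therefore demanded along with smoothness and linearity over the smooth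
  functions.\<close>

definition tensorial :: "'p set \<Rightarrow> nat \<Rightarrow> 'p tensor_field \<Rightarrow> bool" where
  "tensorial U k T \<longleftrightarrow>
     (\<forall>Xs. length Xs = k \<longrightarrow> set Xs \<subseteq> vfields_on M U \<longrightarrow>
        (\<forall>p\<in>U. smooth_near M p (T Xs)) \<and>
        (\<forall>Ys. length Ys = k \<longrightarrow> set Ys \<subseteq> vfields_on M U \<longrightarrow>
           (\<forall>j<k. \<forall>p\<in>U. (Xs ! j) p = (Ys ! j) p) \<longrightarrow> (\<forall>p\<in>U. T Xs p = T Ys p)) \<and>
        (\<forall>j<k. \<forall>Y\<in>vfields_on M U. \<forall>Z\<in>vfields_on M U. \<forall>a b.
           smooth_fun_on M U a \<longrightarrow> smooth_fun_on M U b \<longrightarrow>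
           (\<forall>p\<in>U. T (Xs[j := \<lambda>q h. a q * Y q h + b q * Z q h]) p
              = a p * T (Xs[j := Y]) p + b p * T (Xs[j := Z]) p)))"

lemma tensorial_smooth:
  "tensorial U k T \<Longrightarrow> length Xs = k \<Longrightarrow> set Xs \<subseteq> vfields_on M U \<Longrightarrow> p \<in> U \<Longrightarrow> smooth_near M p (T Xs)"
  by (simp add: tensorial_def)

lemma tensorial_cong:
  assumes "tensorial U k T" "length Xs = k" "set Xs \<subseteq> vfields_on M U"
    "length Ys = k" "set Ys \<subseteq> vfields_on M U"
    "\<And>j q. j < k \<Longrightarrow> q \<in> U \<Longrightarrow> (Xs ! j) q = (Ys ! j) q" "p \<in> U"
  shows "T Xs p = T Ys p"
  using assms unfolding tensorial_def by blast

lemma tensorial_linear: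
  assumes "tensorial U k T" "length Xs = k" "set Xs \<subseteq> vfields_on M U" "j < k"
    "Y \<in> vfields_on M U" "Z \<in> vfields_on M U" "smooth_fun_on M U a" "smooth_fun_on M U b" "p \<in> U"
  shows "T (Xs[j := \<lambda>q h. a q * Y q h + b q * Z q h]) p
              = a p * T (Xs[j := Y]) p + b p * T (Xs[j := Z]) p"
  using assms unfolding tensorial_def by blast

lemma set_list_update_vfields:
  "set Xs \<subseteq> vfields_on M U \<Longrightarrow> Y \<in> vfields_on M U \<Longrightarrow> set (Xs[j := Y]) \<subseteq> vfields_on M U"
  using set_update_subset_insert[of Xs j Y] by blast

lemma tensorial_update_cong:
  assumes T: "tensorial U k T" "length Xs = k" "set Xs \<subseteq> vfields_on M U"
    and Y: "Y \<in> vfields_on M U" "Z \<in> vfields_on M U" "\<And>q. q \<in> U \<Longrightarrow> Y q = Z q" and p: "p \<in> U"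
  shows "T (Xs[j := Y]) p = T (Xs[j := Z]) p"
proof (rule tensorial_cong[OF T(1) _ _ _ _ _ p])
  fix i q assume "i < k" "q \<in> U"
  then show "(Xs[j := Y] ! i) q = (Xs[j := Z] ! i) q"
    using T(2) Y(3) by (cases "i = j") auto
qed (use T(2) set_list_update_vfields[OF T(3)] Y(1,2) in auto)

lemma tensorial_sum:
  assumes U: "openin (mtop M) U" and T: "tensorial U k T"
    and Xs: "length Xs = k" "set Xs \<subseteq> vfields_on M U" "j < k"
    and I: "finite I" and E: "\<And>i. i \<in> I \<Longrightarrow> E i \<in> vfields_on M U"
    and c: "\<And>i. i \<in> I \<Longrightarrow> smooth_fun_on M U (c i)"
  shows "(\<lambda>q h. \<Sum>i\<in>I. c i q * E i q h) \<in> vfields_on M U \<and>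
     (\<forall>p\<in>U. T (Xs[j := \<lambda>q h. \<Sum>i\<in>I. c i q * E i q h]) p = (\<Sum>i\<in>I. c i p * T (Xs[j := E i]) p))"
  using I E c
proof (induction I)
  case empty
  \<comment> \<open>The empty sum is read as the combination \<open>0 * X + 0 * X\<close> of the
    entry already present; linearity then gives 0.\<close>
  have X: "Xs ! j \<in> vfields_on M U" using Xs by auto
  note 0 = smooth_fun_on_const[OF U, of 0]
  show ?case
    using vfields_on_comb[OF U X X 0 0] tensorial_linear[OF T Xs X X 0 0] by simp
next
  case (insert i I)
  let ?S = "\<lambda>q h. \<Sum>i\<in>I. c i q * E i q h"
  note 1 = smooth_fun_on_const[OF U, of 1]
  have S: "?S \<in> vfields_on M U"
    and IH: "\<And>p. p \<in> U \<Longrightarrow> T (Xs[j := ?S]) p = (\<Sum>i\<in>I. c i p * T (Xs[j := E i]) p)"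
    using insert by auto
  have Ei: "E i \<in> vfields_on M U" "smooth_fun_on M U (c i)" using insert by auto
  show ?case
    using vfields_on_comb[OF U Ei(1) S Ei(2) 1] tensorial_linear[OF T Xs Ei(1) S Ei(2) 1]
      insert(1,2) IH by simp
qed

text \<open>The family generates the module of fields over the smooth functions on \<open>U\<close>.
  Smoothness of the coefficients is part of the notion, because \<open>tensorial\<close> allows only
  smooth factors.\<close>

definition frame_on :: "'p set \<Rightarrow> 'i set \<Rightarrow> ('i \<Rightarrow> 'p vfield) \<Rightarrow> bool" where
  "frame_on U I E \<longleftrightarrow> finite I \<and> (\<forall>i\<in>I. E i \<in> vfields_on M U) \<and>
     (\<forall>X\<in>vfields_on M U. \<exists>c. (\<forall>i\<in>I. smooth_fun_on M U (c i)) \<and>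
        (\<forall>p\<in>U. \<forall>f. X p f = (\<Sum>i\<in>I. c i p * E i p f)))"

text \<open>The slots are expanded in the frame one at a time. The induction is on the number
  \<open>m\<close> of leading slots that may still hold arbitrary fields: \<open>m = 0\<close> is
  the hypothesis on the frame, \<open>m = k\<close> the claim.\<close>

lemma tensorial_frame_zero:
  assumes U: "openin (mtop M) U" and T: "tensorial U k T" and F: "frame_on U I E"
    and 0: "\<And>Xs p. length Xs = k \<Longrightarrow> set Xs \<subseteq> E ` I \<Longrightarrow> p \<in> U \<Longrightarrow> T Xs p = 0"
    and Xs: "length Xs = k" "set Xs \<subseteq> vfields_on M U" and p: "p \<in> U"
  shows "T Xs p = 0"
proof -
  have "T Xs p = 0" if "m \<le> k" "length Xs = k" "set Xs \<subseteq> vfields_on M U"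
      "\<And>j. m \<le> j \<Longrightarrow> j < k \<Longrightarrow> Xs ! j \<in> E ` I" for m Xs
    using that
  proof (induction m arbitrary: Xs)
    case 0
    then have "set Xs \<subseteq> E ` I" by (auto simp: set_conv_nth)
    with 0 show ?case using assms(4) p by simp
  next
    case (Suc m)
    let ?X = "Xs ! m"
    have m: "m < k" using Suc.prems by simp
    have X: "?X \<in> vfields_on M U" using Suc.prems by auto
    then obtain c where c: "\<And>i. i \<in> I \<Longrightarrow> smooth_fun_on M U (c i)"
      "\<And>p f. p \<in> U \<Longrightarrow> ?X p f = (\<Sum>i\<in>I. c i p * E i p f)"
      using F unfolding frame_on_def by metis
    have I: "finite I" and E: "\<And>i. i \<in> I \<Longrightarrow> E i \<in> vfields_on M U"
      using F by (auto simp: frame_on_def)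
    note S = tensorial_sum[OF U T Suc.prems(2,3) m I, of E c, OF E c(1)]
    have "T Xs p = T (Xs[m := ?X]) p" by simp
    also have "\<dots> = T (Xs[m := \<lambda>q h. \<Sum>i\<in>I. c i q * E i q h]) p"
      by (rule tensorial_update_cong[OF T Suc.prems(2,3) X _ _ p])
        (use S c(2) in \<open>auto simp: fun_eq_iff\<close>)
    also have "\<dots> = (\<Sum>i\<in>I. c i p * T (Xs[m := E i]) p)" using S p by simp
    also have "\<dots> = 0"
    proof (intro sum.neutral ballI)
      fix i assume "i \<in> I"
      then have "T (Xs[m := E i]) p = 0"
        using Suc.prems E by (intro Suc.IH set_list_update_vfields) (auto simp: nth_list_update)
      then show "c i p * T (Xs[m := E i]) p = 0" by simp
    qed
    finally show ?case .
  qed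
  from this[of k Xs] Xs show ?thesis by simp
qed

lemma coord_frame:
  assumes c: "smooth_chart M (U, \<phi>)"
  shows "frame_on U UNIV (coord_field M (U, \<phi>))"
  unfolding frame_on_def
proof (intro conjI ballI)
  note U = chart_open[OF smooth_chart_topological[OF c]]
  fix X assume X: "X \<in> vfields_on M U"
  have "smooth_fun_on M U (\<lambda>p. X p (\<lambda>q. \<phi> q $ i))" for i
    using vfields_on_smooth[OF U X _ smooth_near_coordinate[OF c]] U
    by (simp add: smooth_fun_on_iff_near)
  with vfield_expansion[OF c X] show "\<exists>c. (\<forall>i\<in>UNIV. smooth_fun_on M U (c i)) \<and>
        (\<forall>p\<in>U. \<forall>f. X p f = (\<Sum>i\<in>UNIV. c i p * coord_field M (U, \<phi>) i p f))"
    by (intro exI[of _ "\<lambda>i p. X p (\<lambda>q. \<phi> q $ i)"]) auto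
qed (use coord_field_vfield[OF c] in auto)

lemma tensorial_form:
  assumes Om: "two_form M Om" and U: "openin (mtop M) U"
  shows "tensorial U 2 (form_tensor Om)"
proof -
  have UM: "p \<in> points M" if "p \<in> U" for p using openin_subset[OF U] that by auto
  have lin: "Om p (\<lambda>f. a * u f + b * v f) w = a * Om p u w + b * Om p v w"
    and anti: "Om p u w = - Om p w u"
    if "p \<in> U" "u \<in> tangent_space M p" "v \<in> tangent_space M p" "w \<in> tangent_space M p"
    for p u v w a b
    using Om UM that unfolding two_form_def by blast+
  \<comment> \<open>Linearity in the second slot comes from antisymmetry. As antisymmetry is given
    for tangent vectors only, the combination itself must be known to be tangent.\<close>
  have lin2: "Om p w (\<lambda>f. a * u f + b * v f) = a * Om p w u + b * Om p w v"
    if "p \<in> U" "u \<in> tangent_space M p" "v \<in> tangent_space M p" "w \<in> tangent_space M p"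
      "(\<lambda>f. a * u f + b * v f) \<in> tangent_space M p" for p u v w a b
    using lin[OF that(1-4), of a b] anti[of p w _ _] that by (metis (no_types, lifting) minus_add_distrib mult_minus_right)
  show ?thesis
    unfolding tensorial_def
  proof (intro allI impI conjI ballI)
    fix Xs :: "'p vfield list" assume Xs: "length Xs = 2" "set Xs \<subseteq> vfields_on M U"
    then obtain A B where AB: "Xs = [A, B]" "A \<in> vfields_on M U" "B \<in> vfields_on M U"
      by (auto simp: length_Suc_conv numeral_2_eq_2)
    fix p assume p: "p \<in> U"
    have "smooth_fun_on M U (\<lambda>p. Om p (A p) (B p))"
      using Om U AB by (auto simp: two_form_def)
    with U p show "smooth_near M p (form_tensor Om Xs)"
      by (auto simp: form_tensor_def AB intro: smooth_nearI)
    show "form_tensor Om Xs p = form_tensor Om Ys p"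
      if "\<forall>j<2. \<forall>p\<in>U. (Xs ! j) p = (Ys ! j) p" for Ys
      using that p by (simp add: form_tensor_def)
    fix j :: nat and Y Z a b assume "j < 2" and YZ: "Y \<in> vfields_on M U" "Z \<in> vfields_on M U"
      and ab: "smooth_fun_on M U a" "smooth_fun_on M U b"
    then have "j = 0 \<or> j = 1" by auto
    then show "form_tensor Om (Xs[j := \<lambda>q h. a q * Y q h + b q * Z q h]) p
              = a p * form_tensor Om (Xs[j := Y]) p + b p * form_tensor Om (Xs[j := Z]) p"
      using lin[OF p, of "Y p" "Z p" "B p"] lin2[OF p, of "Y p" "Z p" "A p"] p AB YZ
        vfields_on_tangent[OF vfields_on_comb[OF U YZ ab] p]
      by (auto simp: form_tensor_def vfields_on_tangent)
  qed
qed

end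

section \<open>Covariant derivatives of tensor fields\<close>

context manifold
begin

lemma vfields_on_mult:
  assumes U: "openin (mtop M) U" and X: "X \<in> vfields_on M U" and a: "smooth_fun_on M U a"
  shows "(\<lambda>q h. a q * X q h) \<in> vfields_on M U"
  using vfields_on_comb[OF U X X a smooth_fun_on_const[OF U, of 0]] by simp

lemma smooth_fun_on_vfield:
  "openin (mtop M) U \<Longrightarrow> X \<in> vfields_on M U \<Longrightarrow> smooth_fun_on M U a \<Longrightarrow> smooth_fun_on M U (\<lambda>q. X q a)"
  by (simp add: smooth_fun_on_iff_near vfields_on_smooth)

context
  fixes D and U
  assumes D: "linear_connection M D" and U: "openin (mtop M) U"
begin

lemmas connection_axioms = D[unfolded linear_connection_def, THEN spec, THEN mp, OF U]

lemma connection_vfield: "X \<in> vfields_on M U \<Longrightarrow> Y \<in> vfields_on M U \<Longrightarrow> D X Y \<in> vfields_on M U"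
  using connection_axioms[THEN conjunct1] by blast

lemma connection_cong:
  assumes X: "X \<in> vfields_on M U" "X' \<in> vfields_on M U"
    and Y: "Y \<in> vfields_on M U" "Y' \<in> vfields_on M U"
    and eq: "\<And>q. q \<in> U \<Longrightarrow> X q = X' q" "\<And>q. q \<in> U \<Longrightarrow> Y q = Y' q" and p: "p \<in> U"
  shows "D X Y p = D X' Y' p"
  using connection_axioms[THEN conjunct2, THEN conjunct1, rule_format, OF X Y _ p] eq by blast

lemma connection_comb:
  assumes X: "X \<in> vfields_on M U" "X' \<in> vfields_on M U" and Y: "Y \<in> vfields_on M U"
    and a: "smooth_fun_on M U a" "smooth_fun_on M U b" and p: "p \<in> U"
  shows "D (\<lambda>q h. a q * X q h + b q * X' q h) Y p f = a p * D X Y p f + b p * D X' Y p f"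
    and "D Y (\<lambda>q h. a q * X q h + b q * X' q h) p f
      = Y p a * X p f + a p * D Y X p f + (Y p b * X' p f + b p * D Y X' p f)"
proof -
  note C = connection_axioms[THEN conjunct2, THEN conjunct2]
  note add1 = C[THEN conjunct1, rule_format]
    and add2 = C[THEN conjunct2, THEN conjunct1, rule_format]
    and mult = C[THEN conjunct2, THEN conjunct2, rule_format]
  note aX = vfields_on_mult[OF U X(1) a(1)] and bX = vfields_on_mult[OF U X(2) a(2)]
  show "D (\<lambda>q h. a q * X q h + b q * X' q h) Y p f = a p * D X Y p f + b p * D X' Y p f"
    by (simp add: add1[OF aX bX Y p] mult[OF X(1) Y a(1) p] mult[OF X(2) Y a(2) p])
  show "D Y (\<lambda>q h. a q * X q h + b q * X' q h) p f
      = Y p a * X p f + a p * D Y X p f + (Y p b * X' p f + b p * D Y X' p f)"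
    by (simp add: add2[OF Y aX bX p] mult[OF Y X(1) a(1) p] mult[OF Y X(2) a(2) p])
qed

text \<open>The direction slot is linear because \<open>D\<close> is. In any other slot,
  differentiating the product \<open>a * T(Y)\<close> yields the extra term
  \<open>X(a) * T(Y)\<close>, and the Leibniz rule for \<open>D X (a Y)\<close> yields the same term
  inside the subtracted sum; the two cancel.\<close>

lemma tensorial_cov_deriv:
  assumes T: "tensorial U k T"
  shows "tensorial U (Suc k) (cov_deriv D T)"
  unfolding tensorial_def
proof (intro allI impI conjI ballI)
  fix Xs p assume "length Xs = Suc k" and Xs: "set Xs \<subseteq> vfields_on M U" and p: "p \<in> U"
  then obtain X Ys where XY: "Xs = X # Ys" "length Ys = k" "X \<in> vfields_on M U" "set Ys \<subseteq> vfields_on M U"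
    by (auto simp: length_Suc_conv)
  have Ysi: "Ys ! i \<in> vfields_on M U" if "i < k" for i using that XY by auto
  have upd: "set (Ys[i := W]) \<subseteq> vfields_on M U" if "W \<in> vfields_on M U" for i W
    by (rule set_list_update_vfields[OF XY(4) that])
  have pM: "p \<in> points M" using openin_subset[OF U] p by auto
  show "smooth_near M p (cov_deriv D T Xs)"
    unfolding XY(1) cov_deriv.simps
  proof (intro smooth_near_diff smooth_near_sum pM)
    show "smooth_near M p (\<lambda>q. X q (T Ys))"
      by (rule vfields_on_smooth[OF U XY(3) p tensorial_smooth[OF T XY(2,4) p]])
    show "smooth_near M p (T (Ys[i := D X (Ys ! i)]))" if "i \<in> {..<length Ys}" for i
      by (rule tensorial_smooth[OF T _ upd p])
        (use that XY connection_vfield[OF XY(3) Ysi] in auto)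
  qed
  show "cov_deriv D T Xs p = cov_deriv D T Zs p"
    if Zs: "length Zs = Suc k" "set Zs \<subseteq> vfields_on M U" and eq: "\<forall>j<Suc k. \<forall>p\<in>U. (Xs ! j) p = (Zs ! j) p" for Zs
  proof -
    obtain X' Ys' where XY': "Zs = X' # Ys'" "length Ys' = k" "X' \<in> vfields_on M U" "set Ys' \<subseteq> vfields_on M U"
      using Zs by (auto simp: length_Suc_conv)
    have eqX: "X q = X' q" if "q \<in> U" for q
      using eq that by (auto simp: XY XY')
    have eqY: "(Ys ! i) q = (Ys' ! i) q" if "i < k" "q \<in> U" for i q
      using eq that by (auto simp: XY XY')
    have Ysi': "Ys' ! i \<in> vfields_on M U" if "i < k" for i using that XY' by auto
    \<comment> \<open>The two functions under the derivation agree on \<open>U\<close> only, which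
      suffices because a derivation sees only germs.\<close>
    have "X p (T Ys) = X' p (T Ys')"
      unfolding eqX[OF p]
      by (rule tangent_germ[OF vfields_on_tangent[OF XY'(3) p] U p])
        (rule tensorial_cong[OF T XY(2,4) XY'(2,4) eqY])
    moreover have "T (Ys[i := D X (Ys ! i)]) p = T (Ys'[i := D X' (Ys' ! i)]) p" if i: "i < k" for i
    proof (rule tensorial_cong[OF T _ _ _ _ _ p])
      fix j q assume j: "j < k" "q \<in> U"
      show "(Ys[i := D X (Ys ! i)] ! j) q = (Ys'[i := D X' (Ys' ! i)] ! j) q"
        using connection_cong[OF XY(3) XY'(3) Ysi[OF i] Ysi'[OF i] eqX eqY[OF i] j(2)] XY XY' eqY[OF j] i
        by (cases "i = j") auto
    qed (use XY XY' upd connection_vfield[OF XY(3) Ysi[OF i]]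
          set_list_update_vfields[OF XY'(4) connection_vfield[OF XY'(3) Ysi'[OF i]]] in auto)
    ultimately show ?thesis by (simp add: XY XY')
  qed
  fix j Y Z a b
  assume j: "j < Suc k" and YZ: "Y \<in> vfields_on M U" "Z \<in> vfields_on M U"
    and a: "smooth_fun_on M U a" and b: "smooth_fun_on M U b"
  let ?W = "\<lambda>q h. a q * Y q h + b q * Z q h"
  have W: "?W \<in> vfields_on M U" by (rule vfields_on_comb[OF U YZ a b])
  show "cov_deriv D T (Xs[j := ?W]) p = a p * cov_deriv D T (Xs[j := Y]) p + b p * cov_deriv D T (Xs[j := Z]) p"
  proof (cases j)
    case 0
    have "T (Ys[i := D ?W (Ys ! i)]) p = a p * T (Ys[i := D Y (Ys ! i)]) p + b p * T (Ys[i := D Z (Ys ! i)]) p"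
      if i: "i < k" for i
    proof -
      note DY = connection_vfield[OF YZ(1) Ysi[OF i]] and DZ = connection_vfield[OF YZ(2) Ysi[OF i]]
      have "T (Ys[i := D ?W (Ys ! i)]) p
          = T (Ys[i := \<lambda>q h. a q * D Y (Ys ! i) q h + b q * D Z (Ys ! i) q h]) p"
        by (rule tensorial_update_cong[OF T XY(2,4) connection_vfield[OF W Ysi[OF i]]
              vfields_on_comb[OF U DY DZ a b] _ p])
          (simp add: fun_eq_iff connection_comb(1)[OF YZ Ysi[OF i] a b])
      also have "\<dots> = a p * T (Ys[i := D Y (Ys ! i)]) p + b p * T (Ys[i := D Z (Ys ! i)]) p"
        by (rule tensorial_linear[OF T XY(2,4) i DY DZ a b p])
      finally show ?thesis .
    qed
    then show ?thesis
      using 0 XY by (simp add: sum.distrib sum_distrib_left algebra_simps)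
  next
    case (Suc l)
    then have l: "l < k" using j by simp
    have an: "smooth_near M p a" and bn: "smooth_near M p b"
      using a b U p by (auto simp: smooth_fun_on_iff_near)
    note Xt = vfields_on_tangent[OF XY(3) p]
    have TY: "smooth_near M p (T (Ys[l := V]))" if "V \<in> vfields_on M U" for V
      by (rule tensorial_smooth[OF T _ upd[OF that] p]) (use XY in auto)
    have XT: "X p (T (Ys[l := ?W])) = X p a * T (Ys[l := Y]) p + a p * X p (T (Ys[l := Y]))
        + (X p b * T (Ys[l := Z]) p + b p * X p (T (Ys[l := Z])))"
    proof -
      have "X p (T (Ys[l := ?W])) = X p (\<lambda>q. a q * T (Ys[l := Y]) q + b q * T (Ys[l := Z]) q)"
        by (rule tangent_germ[OF Xt U p]) (rule tensorial_linear[OF T XY(2,4) l YZ a b])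
      then show ?thesis
        by (simp add: tangent_add[OF Xt smooth_near_mult[OF an TY[OF YZ(1)]] smooth_near_mult[OF bn TY[OF YZ(2)]]]
            tangent_mult[OF Xt an TY[OF YZ(1)]] tangent_mult[OF Xt bn TY[OF YZ(2)]] mult.commute)
    qed
    let ?S = "\<lambda>V i. T (Ys[l := V, i := D X (Ys[l := V] ! i)]) p"
    \<comment> \<open>Only the summand in which \<open>D X\<close> hits the combined slot,
      \<open>i = l\<close>, produces derivatives of the coefficients. For \<open>i\<close> different
      from \<open>l\<close> the two updates commute and linearity of \<open>T\<close> is
      enough.\<close>
    have S: "?S ?W i = a p * ?S Y i + b p * ?S Z i
        + (if i = l then X p a * T (Ys[l := Y]) p + X p b * T (Ys[l := Z]) p else 0)"
      if i: "i < k" for i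
    proof (cases "i = l")
      case True
      note DY = connection_vfield[OF XY(3) YZ(1)] and DZ = connection_vfield[OF XY(3) YZ(2)]
      have Xab: "smooth_fun_on M U (\<lambda>q. X q a)" "smooth_fun_on M U (\<lambda>q. X q b)"
        using smooth_fun_on_vfield[OF U XY(3)] a b by auto
      note 1 = smooth_fun_on_const[OF U, of 1]
      let ?P = "\<lambda>q h. X q a * Y q h + a q * D X Y q h" and ?Q = "\<lambda>q h. X q b * Z q h + b q * D X Z q h"
      note P = vfields_on_comb[OF U YZ(1) DY Xab(1) a] and Q = vfields_on_comb[OF U YZ(2) DZ Xab(2) b]
      have "T (Ys[l := D X ?W]) p = T (Ys[l := \<lambda>q h. 1 * ?P q h + 1 * ?Q q h]) p"
        by (rule tensorial_update_cong[OF T XY(2,4) connection_vfield[OF XY(3) W]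
              vfields_on_comb[OF U P Q 1 1] _ p])
          (simp add: fun_eq_iff connection_comb(2)[OF YZ XY(3) a b])
      also have "\<dots> = 1 * T (Ys[l := ?P]) p + 1 * T (Ys[l := ?Q]) p"
        by (rule tensorial_linear[OF T XY(2,4) l P Q 1 1 p])
      also have "T (Ys[l := ?P]) p = X p a * T (Ys[l := Y]) p + a p * T (Ys[l := D X Y]) p"
        by (rule tensorial_linear[OF T XY(2,4) l YZ(1) DY Xab(1) a p])
      also have "T (Ys[l := ?Q]) p = X p b * T (Ys[l := Z]) p + b p * T (Ys[l := D X Z]) p"
        by (rule tensorial_linear[OF T XY(2,4) l YZ(2) DZ Xab(2) b p])
      finally show ?thesis using True XY(2) l by simp
    next
      case False
      have "?S V i = T ((Ys[i := D X (Ys ! i)])[l := V]) p" for V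
        using False by (simp add: list_update_swap)
      moreover have "T ((Ys[i := D X (Ys ! i)])[l := ?W]) p
          = a p * T ((Ys[i := D X (Ys ! i)])[l := Y]) p + b p * T ((Ys[i := D X (Ys ! i)])[l := Z]) p"
        by (rule tensorial_linear[OF T _ upd l YZ a b p])
          (use XY connection_vfield[OF XY(3) Ysi[OF i]] in auto)
      ultimately show ?thesis using False by simp
    qed
    have "(\<Sum>i<k. ?S ?W i) = a p * (\<Sum>i<k. ?S Y i) + b p * (\<Sum>i<k. ?S Z i)
        + (X p a * T (Ys[l := Y]) p + X p b * T (Ys[l := Z]) p)"
      using l by (simp add: S sum.distrib sum_distrib_left sum.delta)
    then show ?thesis
      unfolding Suc XY(1) list_update_code cov_deriv.simps length_list_update XY(2) XT
      by (simp add: algebra_simps)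
  qed
qed

end

lemma tensor_vanishes_frame:
  assumes T: "\<And>U. openin (mtop M) U \<Longrightarrow> tensorial U k T"
    and E: "\<And>U. openin (mtop M) U \<Longrightarrow> frame_on U I E"
    and 0: "\<And>Xs p. length Xs = k \<Longrightarrow> set Xs \<subseteq> E ` I \<Longrightarrow> p \<in> points M \<Longrightarrow> T Xs p = 0"
  shows "tensor_vanishes M k T"
  unfolding tensor_vanishes_def
proof (intro allI impI ballI)
  fix U Xs p assume U: "openin (mtop M) U" and Xs: "length Xs = k" "set Xs \<subseteq> vfields_on M U" and p: "p \<in> U"
  show "T Xs p = 0"
    by (rule tensorial_frame_zero[OF U T[OF U] E[OF U] 0 Xs p])
      (use openin_subset[OF U] in auto)
qed

end

section \<open>Left invariant vector fields\<close>

text \<open>These slices turn joint smoothness of the multiplication into smoothness in one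
  factor.\<close>

lemma smooth_on_Pair_const:
  "smooth_on S (\<lambda>t. (c, t))" "smooth_on S (\<lambda>s. (s, c))"
proof -
  have "smooth_on S (\<lambda>t. (c, 0) + (0, t))"
    by (intro smooth_on_add smooth_on_const smooth_on_bounded_linear[where f = "\<lambda>x. x", OF _ smooth_on_ident]
        bounded_linear_Pair bounded_linear_zero bounded_linear_ident)
  then show "smooth_on S (\<lambda>t. (c, t))" by simp
  have "smooth_on S (\<lambda>s. (s, 0) + (0, c))"
    by (intro smooth_on_add smooth_on_const smooth_on_bounded_linear[where f = "\<lambda>x. x", OF _ smooth_on_ident]
        bounded_linear_Pair bounded_linear_zero bounded_linear_ident)
  then show "smooth_on S (\<lambda>s. (s, c))" by simp
qed

locale Lie_grp = group G + manifold M
  for G :: "('p, 'r) monoid_scheme" (structure) and M :: "('p, 'n::finite) smooth_structure" +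
  assumes Lie: "Lie_group G M"
begin

lemma carrier_points: "carrier G = points M"
  using Lie by (simp add: Lie_group_def)

lemma one_point: "\<one> \<in> points M"
  using one_closed by (simp add: carrier_points)

text \<open>Continuity of the multiplication gives a product neighbourhood
  \<open>A \<times> B\<close> whose products stay in one chart domain and in the set where
  \<open>f\<close> is smooth; there the coordinate expression of the multiplication can be composed
  with that of \<open>f\<close>. Smoothness of the multiplication enters the development through
  this lemma.\<close>

lemma mult_smooth_chart:
  assumes p: "p \<in> points M" and q: "q \<in> points M" and f: "smooth_near M (p \<otimes> q) f"
  obtains U \<phi> V \<psi> A B where "(U, \<phi>) \<in> atlas M" "(V, \<psi>) \<in> atlas M"
    "openin (mtop M) A" "p \<in> A" "A \<subseteq> U" "openin (mtop M) B" "q \<in> B" "B \<subseteq> V"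
    "\<forall>x\<in>A. \<forall>y\<in>B. smooth_near M (x \<otimes> y) f"
    "smooth_on (\<phi> ` A \<times> \<psi> ` B) (\<lambda>z. f (inv_into U \<phi> (fst z) \<otimes> inv_into V \<psi> (snd z)))"
proof -
  obtain U \<phi> where c: "(U, \<phi>) \<in> atlas M" "p \<in> U" using p by (rule atlas_cover)
  obtain V \<psi> where d: "(V, \<psi>) \<in> atlas M" "q \<in> V" using q by (rule atlas_cover)
  have "p \<otimes> q \<in> points M" using p q by (simp flip: carrier_points)
  then obtain W \<kappa> where e: "(W, \<kappa>) \<in> atlas M" "p \<otimes> q \<in> W" by (rule atlas_cover)
  note ct = atlas_topological_chart[OF c(1)] and dt = atlas_topological_chart[OF d(1)]
    and et = atlas_topological_chart[OF e(1)]
  obtain N where N: "openin (mtop M) N" "p \<otimes> q \<in> N" "smooth_fun_on M N f"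
    using f by (auto simp: smooth_near_def)
  let ?Z = "{z \<in> topspace (prod_topology (mtop M) (mtop M)). (\<lambda>(x, y). x \<otimes> y) z \<in> W \<inter> N}"
  have Z: "openin (prod_topology (mtop M) (mtop M)) ?Z"
    by (rule openin_continuous_map_preimage[where Y = "mtop M"])
      (use Lie N(1) chart_open[OF et] in \<open>auto simp: Lie_group_def\<close>)
  have "(p, q) \<in> ?Z" using p q e N by auto
  from Z[unfolded openin_prod_topology_alt, rule_format, OF this]
  obtain A0 B0 where AB: "openin (mtop M) A0" "openin (mtop M) B0" "p \<in> A0" "q \<in> B0"
    "A0 \<times> B0 \<subseteq> ?Z"
    by (elim exE conjE)
  have AB_WN: "x \<otimes> y \<in> W" "x \<otimes> y \<in> N" if "x \<in> A0" "y \<in> B0" for x y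
    using that AB(5) by auto
  let ?A = "A0 \<inter> U" and ?B = "B0 \<inter> V"
  have A: "openin (mtop M) ?A" and B: "openin (mtop M) ?B"
    using AB chart_open[OF ct] chart_open[OF dt] by auto
  have inv: "inv_into U \<phi> (\<phi> x) = x" if "x \<in> U" for x
    using inv_into_f_f[OF chart_inj[OF ct] that] .
  have inv': "inv_into V \<psi> (\<psi> y) = y" if "y \<in> V" for y
    using inv_into_f_f[OF chart_inj[OF dt] that] .
  have o: "open (\<phi> ` ?A \<times> \<psi> ` ?B)"
    by (intro open_Times chart_open_image[OF ct A] chart_open_image[OF dt B]) auto
  have "smooth_on {(\<phi> x, \<psi> y) |x y. x \<in> U \<and> y \<in> V \<and> x \<otimes> y \<in> W}
          (\<lambda>(s, t). \<kappa> (inv_into U \<phi> s \<otimes> inv_into V \<psi> t))"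
    using Lie[unfolded Lie_group_def, THEN conjunct2, THEN conjunct2, THEN conjunct2, THEN conjunct2,
        THEN conjunct2, THEN bspec, OF c(1), unfolded prod.case, THEN bspec, OF d(1),
        unfolded prod.case, THEN bspec, OF e(1), unfolded prod.case] .
  then have m: "smooth_on (\<phi> ` ?A \<times> \<psi> ` ?B) (\<lambda>(s, t). \<kappa> (inv_into U \<phi> s \<otimes> inv_into V \<psi> t))"
    by (rule smooth_on_subset) (use AB_WN in auto)
  have F: "smooth_on (\<kappa> ` (W \<inter> N)) (f \<circ> inv_into W \<kappa>)"
    using N(3) e(1) by (auto simp: smooth_fun_on_def)
  have "smooth_on (\<phi> ` ?A \<times> \<psi> ` ?B)
      (\<lambda>z. (f \<circ> inv_into W \<kappa>) ((\<lambda>(s, t). \<kappa> (inv_into U \<phi> s \<otimes> inv_into V \<psi> t)) z))"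
    by (rule smooth_on_compose[OF o m F]) (use AB_WN inv inv' in auto)
  then have "smooth_on (\<phi> ` ?A \<times> \<psi> ` ?B) (\<lambda>z. f (inv_into U \<phi> (fst z) \<otimes> inv_into V \<psi> (snd z)))"
    by (rule smooth_on_cong[OF o])
      (auto simp: inv inv' AB_WN inv_into_f_f[OF chart_inj[OF et]])
  moreover have "\<forall>x\<in>?A. \<forall>y\<in>?B. smooth_near M (x \<otimes> y) f"
    using AB_WN smooth_nearI[OF N(1) _ N(3)] by auto
  ultimately show thesis
    using that[OF c(1) d(1) A _ _ B] c d AB by auto
qed

lemma smooth_near_left_transl:
  assumes a: "a \<in> points M" and q: "q \<in> points M" and f: "smooth_near M (a \<otimes> q) f"
  shows "smooth_near M q (f \<circ> left_transl G a)"
proof -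
  obtain U \<phi> V \<psi> A B where c: "(U, \<phi>) \<in> atlas M" "(V, \<psi>) \<in> atlas M"
    and A: "openin (mtop M) A" "a \<in> A" "A \<subseteq> U" and B: "openin (mtop M) B" "q \<in> B" "B \<subseteq> V"
    and "\<forall>x\<in>A. \<forall>y\<in>B. smooth_near M (x \<otimes> y) f"
    and h: "smooth_on (\<phi> ` A \<times> \<psi> ` B) (\<lambda>z. f (inv_into U \<phi> (fst z) \<otimes> inv_into V \<psi> (snd z)))"
    by (rule mult_smooth_chart[OF a q f])
  note ct = atlas_topological_chart[OF c(1)] and dt = atlas_topological_chart[OF c(2)]
  have o: "open (\<psi> ` B)" by (rule chart_open_image[OF dt B(1,3)])
  have s: "smooth_on (\<psi> ` B) (\<lambda>t. f (inv_into U \<phi> (fst (\<phi> a, t)) \<otimes> inv_into V \<psi> (snd (\<phi> a, t))))"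
    by (rule smooth_on_compose[OF o smooth_on_Pair_const(1) h]) (use A in auto)
  show ?thesis
  proof (rule smooth_near_chartI[OF atlas_smooth_chart[OF c(2)] _ o _ s])
    show "(f \<circ> left_transl G a) y
        = f (inv_into U \<phi> (fst (\<phi> a, \<psi> y)) \<otimes> inv_into V \<psi> (snd (\<phi> a, \<psi> y)))" if "y \<in> V" for y
      using that A by (auto simp: left_transl_def inv_into_f_f[OF chart_inj[OF ct]] inv_into_f_f[OF chart_inj[OF dt]])
  qed (use B in auto)
qed

lemma left_transl_comp:
  assumes "a \<in> points M" "b \<in> points M" "x \<in> points M"
  shows "left_transl G a (left_transl G b x) = left_transl G (a \<otimes> b) x"
  using assms by (simp add: left_transl_def m_assoc flip: carrier_points)

lemma inv_point: "a \<in> points M \<Longrightarrow> inv a \<in> points M"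
  by (simp flip: carrier_points)

lemma mult_point: "a \<in> points M \<Longrightarrow> b \<in> points M \<Longrightarrow> a \<otimes> b \<in> points M"
  by (simp flip: carrier_points)

lemma left_transl_inv:
  assumes "a \<in> points M" "x \<in> points M"
  shows "left_transl G a (left_transl G (inv a) x) = x" "left_transl G (inv a) (left_transl G a x) = x"
  using assms by (simp_all add: left_transl_def m_assoc[symmetric] flip: carrier_points)

text \<open>For the converse one translates back by \<open>inv a\<close>. An equivalence is wanted
  because a tangent vector is 0 by convention on functions that are not smooth, and
  \<open>differential\<close> has to respect this.\<close>

lemma smooth_near_left_transl_iff:
  assumes a: "a \<in> points M" and q: "q \<in> points M"
  shows "smooth_near M q (f \<circ> left_transl G a) \<longleftrightarrow> smooth_near M (a \<otimes> q) f"
proof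
  assume s: "smooth_near M q (f \<circ> left_transl G a)"
  have eq: "inv a \<otimes> (a \<otimes> q) = q"
    using left_transl_inv(2)[OF a q] by (simp add: left_transl_def)
  have "smooth_near M (a \<otimes> q) ((f \<circ> left_transl G a) \<circ> left_transl G (inv a))"
    by (rule smooth_near_left_transl[OF inv_point[OF a] mult_point[OF a q]]) (simp add: eq s)
  then show "smooth_near M (a \<otimes> q) f"
    by (rule smooth_near_cong[OF openin_topspace mult_point[OF a q], rotated])
      (simp add: left_transl_inv(1)[OF a])
qed (rule smooth_near_left_transl[OF a q])

lemma differential_tangent:
  assumes a: "a \<in> points M" and q: "q \<in> points M" and u: "u \<in> tangent_space M q"
  shows "differential (left_transl G a) u \<in> tangent_space M (a \<otimes> q)"
proof -
  note iff = smooth_near_left_transl_iff[OF a q]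
  show ?thesis
    unfolding tangent_space_def differential_def
  proof (intro CollectI conjI allI impI)
    fix f assume "\<not> smooth_near M (a \<otimes> q) f"
    then show "u (f \<circ> left_transl G a) = 0"
      using tangent_not_smooth[OF u] iff by simp
  next
    fix f g x y assume fg: "smooth_near M (a \<otimes> q) f" "smooth_near M (a \<otimes> q) g"
    show "u ((\<lambda>z. x * f z + y * g z) \<circ> left_transl G a)
        = x * u (f \<circ> left_transl G a) + y * u (g \<circ> left_transl G a)"
      using tangent_linear[OF u iff[THEN iffD2, OF fg(1)] iff[THEN iffD2, OF fg(2)], of x y]
      by (simp add: comp_def)
  next
    fix f g assume fg: "smooth_near M (a \<otimes> q) f" "smooth_near M (a \<otimes> q) g"
    show "u ((\<lambda>z. f z * g z) \<circ> left_transl G a)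
        = f (a \<otimes> q) * u (g \<circ> left_transl G a) + g (a \<otimes> q) * u (f \<circ> left_transl G a)"
      using tangent_mult[OF u iff[THEN iffD2, OF fg(1)] iff[THEN iffD2, OF fg(2)]]
      by (simp add: comp_def left_transl_def)
  qed
qed

section \<open>Left invariant fields and their brackets\<close>

lemma left_inv_field_eq: "left_inv_field G u p f = u (f \<circ> left_transl G p)"
  by (simp add: left_inv_field_def differential_def)

lemma left_inv_tangent:
  "u \<in> tangent_space M \<one> \<Longrightarrow> p \<in> points M \<Longrightarrow> left_inv_field G u p \<in> tangent_space M p"
  using differential_tangent[of p \<one> u] by (simp add: left_inv_field_def one_point flip: carrier_points)

text \<open>The value at \<open>x\<close> is \<open>u\<close> applied to the map sending
  \<open>y\<close> to \<open>f(x y)\<close>. Expanding \<open>u\<close> in a chart around the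
  identity writes it as a combination, with constant coefficients, of partial derivatives in
  \<open>y\<close> at \<open>y = \<one>\<close> of a jointly smooth function; these are smooth in
  \<open>x\<close>.\<close>

lemma left_inv_vfield:
  assumes u: "u \<in> tangent_space M \<one>"
  shows "left_inv_field G u \<in> vfields_on M (points M)"
proof (rule vfields_onI[OF openin_topspace])
  show "left_inv_field G u p \<in> tangent_space M p" if "p \<in> points M" for p
    by (rule left_inv_tangent[OF u that])
  fix p f assume p: "p \<in> points M" and f: "smooth_near M p f"
  have "smooth_near M (p \<otimes> \<one>) f" using f p by (simp flip: carrier_points)
  then obtain U \<phi> V \<psi> A B where c: "(U, \<phi>) \<in> atlas M" "(V, \<psi>) \<in> atlas M"
    and A: "openin (mtop M) A" "p \<in> A" "A \<subseteq> U" and B: "openin (mtop M) B" "\<one> \<in> B" "B \<subseteq> V"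
    and near: "\<forall>x\<in>A. \<forall>y\<in>B. smooth_near M (x \<otimes> y) f"
    and h: "smooth_on (\<phi> ` A \<times> \<psi> ` B) (\<lambda>z. f (inv_into U \<phi> (fst z) \<otimes> inv_into V \<psi> (snd z)))"
    by (rule mult_smooth_chart[OF p one_point])
  let ?h = "\<lambda>z. f (inv_into U \<phi> (fst z) \<otimes> inv_into V \<psi> (snd z))"
  note ct = atlas_topological_chart[OF c(1)] and dt = atlas_topological_chart[OF c(2)]
  have oA: "open (\<phi> ` A)" by (rule chart_open_image[OF ct A(1,3)])
  have oB: "open (\<psi> ` B)" by (rule chart_open_image[OF dt B(1,3)])
  let ?F = "\<lambda>s. \<Sum>i\<in>UNIV. u (\<lambda>q. \<psi> q $ i) * frechet_derivative ?h (at (s, \<psi> \<one>)) (0, axis i 1)"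
  have "smooth_on (\<phi> ` A) (\<lambda>s. frechet_derivative ?h (at (s, \<psi> \<one>)) v)" for v
    by (rule smooth_on_compose[OF oA smooth_on_Pair_const(2)
          smooth_on_frechet_derivative[OF open_Times[OF oA oB] h]]) (use B in auto)
  then have F: "smooth_on (\<phi> ` A) ?F"
    by (intro smooth_on_sum smooth_on_mult smooth_on_const)
  show "smooth_near M p (\<lambda>q. left_inv_field G u q f)"
  proof (rule smooth_near_chartI[OF atlas_smooth_chart[OF c(1)] _ oA _ F])
    fix x assume "x \<in> U" "\<phi> x \<in> \<phi> ` A"
    then have x: "x \<in> A" using chart_inj[OF ct] A(3) by (auto dest: inj_onD)
    then have xM: "x \<in> points M" using openin_subset[OF A(1)] by auto
    have eq: "(f \<circ> left_transl G x) \<circ> inv_into V \<psi> = (\<lambda>t. ?h (\<phi> x, t))"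
      using inv_into_f_f[OF chart_inj[OF ct] subsetD[OF A(3) x]] by (simp add: left_transl_def fun_eq_iff)
    have "(?h has_derivative frechet_derivative ?h (at (\<phi> x, \<psi> \<one>))) (at (\<phi> x, \<psi> \<one>))"
      by (rule smooth_on_has_derivative[OF h]) (use x B in auto)
    moreover have "((\<lambda>t. (\<phi> x, t)) has_derivative (\<lambda>v. (0, v))) (at (\<psi> \<one>))"
      by (auto intro!: derivative_eq_intros)
    ultimately have "((\<lambda>t. ?h (\<phi> x, t)) has_derivative
        (\<lambda>v. frechet_derivative ?h (at (\<phi> x, \<psi> \<one>)) (0, v))) (at (\<psi> \<one>))"
      by (rule has_derivative_compose[rotated])
    then have fd: "frechet_derivative (\<lambda>t. ?h (\<phi> x, t)) (at (\<psi> \<one>))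
        = (\<lambda>v. frechet_derivative ?h (at (\<phi> x, \<psi> \<one>)) (0, v))"
      by (rule frechet_derivative_at[symmetric])
    have s: "smooth_near M \<one> (f \<circ> left_transl G x)"
      using near x B by (auto intro: smooth_near_left_transl[OF xM one_point])
    show "left_inv_field G u x f = ?F (\<phi> x)"
      unfolding left_inv_field_eq
      by (subst tangent_expansion[OF u atlas_smooth_chart[OF c(2)] _ s])
        (use B in \<open>auto simp only: eq fd\<close>)
  qed (use A in auto)
qed

lemma left_inv_field_one:
  assumes u: "u \<in> tangent_space M \<one>" shows "left_inv_field G u \<one> = u"
proof
  fix f show "left_inv_field G u \<one> f = u f"
    unfolding left_inv_field_eq
    by (rule tangent_germ[OF u openin_topspace one_point]) (simp add: left_transl_def flip: carrier_points)
qed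

lemma left_inv_field_surj:
  assumes p: "p \<in> points M" and v: "v \<in> tangent_space M p"
  obtains u where "u \<in> tangent_space M \<one>" "left_inv_field G u p = v"
proof
  have "inv p \<otimes> p = \<one>" using p by (simp flip: carrier_points)
  then show "differential (left_transl G (inv p)) v \<in> tangent_space M \<one>"
    using differential_tangent[OF inv_point[OF p] p v] by simp
  show "left_inv_field G (differential (left_transl G (inv p)) v) p = v"
  proof
    fix f show "left_inv_field G (differential (left_transl G (inv p)) v) p f = v f"
      unfolding left_inv_field_eq differential_def
      by (rule tangent_germ[OF v openin_topspace p]) (simp add: left_transl_inv(1)[OF p])
  qed
qed

lemma left_inv_field_transl:
  assumes u: "u \<in> tangent_space M \<one>" and p: "p \<in> points M" and q: "q \<in> points M"
  shows "left_inv_field G u (p \<otimes> q) f = left_inv_field G u q (f \<circ> left_transl G p)"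
  unfolding left_inv_field_eq
  by (rule tangent_germ[OF u openin_topspace one_point]) (simp add: left_transl_comp[OF p q])

text \<open>Each left invariant field is related to itself by left translations, hence so is the
  bracket of two of them. This reduces brackets at \<open>p\<close> to those at the identity, where
  \<open>Lie_algebra_of_group\<close> identifies them with \<open>br\<close>.\<close>

lemma lie_bracket_left_inv:
  assumes u: "u \<in> tangent_space M \<one>" and v: "v \<in> tangent_space M \<one>" and p: "p \<in> points M"
  shows "lie_bracket M (left_inv_field G u) (left_inv_field G v) p
    = left_inv_field G (lie_bracket M (left_inv_field G u) (left_inv_field G v) \<one>) p"
proof
  fix f
  have eq: "left_inv_field G w p (\<lambda>q. left_inv_field G w' q f)
      = left_inv_field G w \<one> (\<lambda>q. left_inv_field G w' q (f \<circ> left_transl G p))"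
    if w: "w \<in> tangent_space M \<one>" and w': "w' \<in> tangent_space M \<one>" for w w'
    unfolding left_inv_field_one[OF w] left_inv_field_eq[of w]
    by (rule tangent_germ[OF w openin_topspace one_point])
      (simp add: left_transl_def[of G p] left_inv_field_transl[OF w' p] left_transl_def[of _ p, abs_def])
  have "p \<otimes> \<one> = p" using p by (simp flip: carrier_points)
  then show "lie_bracket M (left_inv_field G u) (left_inv_field G v) p f
    = left_inv_field G (lie_bracket M (left_inv_field G u) (left_inv_field G v) \<one>) p f"
    unfolding left_inv_field_eq[of "lie_bracket M _ _ _"]
    using smooth_near_left_transl_iff[OF p one_point, of f]
    by (simp add: lie_bracket_def eq[OF u v] eq[OF v u])
qed

end

section \<open>Symplectic Poisson algebras\<close>

text \<open>The map \<open>?F\<close> records the functional \<open>om d\<close> by its values on a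
  basis. Nondegeneracy makes it injective and finite dimension makes it surjective, so every
  functional is represented. This yields both the adjoints and the dual basis for the left invariant
  frame.\<close>

lemma symplectic_representation:
  fixes om :: "'a::real_vector \<Rightarrow> 'a \<Rightarrow> real" and B :: "'a set"
  assumes B: "finite B" "span B = UNIV" and om: "bilinear om" and skew: "\<And>u v. om u v = - om v u"
    and nondeg: "\<And>u. (\<And>v. om u v = 0) \<Longrightarrow> u = 0" and l: "linear l"
  obtains d where "\<And>x. l x = om x d"
proof -
  obtain C :: "'a set" where C: "C \<subseteq> B" "independent C" "B \<subseteq> span C"
    using maximal_independent_subset[of B] by blast
  have fC: "finite C" using C(1) B(1) by (rule finite_subset)
  have sC: "span C = UNIV" using span_mono[OF C(3)] B(2) by (auto simp: span_span)
  \<comment> \<open>The type carries only the structure of a real vector space; finite dimension is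
    made available through the basis \<open>C\<close> extracted from the spanning set.\<close>
  interpret fd: finite_dimensional_vector_space scaleR C
    by unfold_locales (use fC C(2) sC in \<open>auto simp: dependent_raw_def span_raw_def\<close>)
  let ?F = "\<lambda>d. \<Sum>b\<in>C. om d b *\<^sub>R b"
  have lin1: "linear (\<lambda>d. om d b)" and lin2: "linear (om d)" for b d
    using om by (auto simp: bilinear_def)
  have coeff: "f b = g b" if "(\<Sum>b\<in>C. f b *\<^sub>R b) = (\<Sum>b\<in>C. g b *\<^sub>R b)" "b \<in> C" for f g :: "'a \<Rightarrow> real" and b
  proof -
    have "(\<Sum>b\<in>C. (f b - g b) *\<^sub>R b) = 0"
      using that(1) by (simp add: scaleR_diff_left sum_subtractf)
    then show ?thesis
      using independentD[OF C(2) fC order_refl, of "\<lambda>b. f b - g b"] that(2) by simp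
  qed
  have ext: "l1 x = l2 x" if "linear l1" "linear l2" "\<And>b. b \<in> C \<Longrightarrow> l1 b = l2 b" for l1 l2 :: "'a \<Rightarrow> real" and x
    using linear_eq_on_span[OF that(1,2), of C x] that(3) sC by auto
  have linF: "linear ?F"
    by (rule linearI)
      (simp_all add: linear_add[OF lin1] linear_cmul[OF lin1] scaleR_add_left sum.distrib scaleR_sum_right)
  have "inj ?F"
    unfolding linear_injective_0[OF linF]
  proof (intro allI impI nondeg)
    fix d v assume "?F d = 0"
    then have "om d b = 0" if "b \<in> C" for b
      using coeff[of "om d" "\<lambda>_. 0" b] that by simp
    then show "om d v = 0"
      using ext[OF lin2 linear_zero] by simp
  qed
  then have "surj ?F"
    using fd.linear_inj_imp_surj linF by (simp add: linear_def)
  \<comment> \<open>The minus sign anticipates skew symmetry: \<open>om d b = - l b\<close> is the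
    same as \<open>l b = om b d\<close>.\<close>
  then have "\<exists>d. (\<Sum>b\<in>C. (- l b) *\<^sub>R b) = ?F d" by (rule surjD)
  then obtain d where d: "(\<Sum>b\<in>C. (- l b) *\<^sub>R b) = ?F d" by (elim exE)
  have "l b = om b d" if "b \<in> C" for b
    using coeff[OF d that] skew[of b d] by linarith
  then have "l x = om x d" for x
    by (rule ext[OF l lin1])
  then show thesis by (rule that)
qed

locale symplectic_Poisson =
  fixes br :: "'a::real_vector \<Rightarrow> 'a \<Rightarrow> 'a" and om :: "'a \<Rightarrow> 'a \<Rightarrow> real"
  assumes spa: "symplectic_Poisson_algebra br om"
begin

lemma
  shows finite_span: "\<exists>B::'a set. finite B \<and> span B = UNIV"
    and Lie: "Lie_algebra br" and om_bilinear: "bilinear om" and om_skew: "om u v = - om v u"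
    and om_nondeg: "(\<And>v. om u v = 0) \<Longrightarrow> u = 0"
    and om_cocycle: "om (br u v) w + om (br v w) u + om (br w u) v = 0"
    and br_br: "br (br u v) w = 0"
    and br_adjoint: "br u (om_adjoint om (br v) x) = om_adjoint om (br v) (br u x)"
  using spa unfolding symplectic_Poisson_algebra_def symplectic_Lie_algebra_def fun_eq_iff comp_def
  by iprover+

lemma br_linear: "linear (br u)" "linear (\<lambda>u. br u v)"
  using Lie by (auto simp: Lie_algebra_def bilinear_def)

lemma om_linear: "linear (om u)" "linear (\<lambda>u. om u v)"
  using om_bilinear by (auto simp: bilinear_def)

lemma br_skew: "br u v = - br v u"
proof -
  have "br (u + v) (u + v) = 0" "br u u = 0" "br v v = 0" using Lie by (auto simp: Lie_algebra_def)
  then have "br u v + br v u = 0"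
    by (simp add: linear_add[OF br_linear(1)] linear_add[OF br_linear(2)] add.commute)
  then show ?thesis by (simp add: eq_neg_iff_add_eq_0)
qed

lemma br_br': "br u (br v w) = 0"
  using br_skew[of u "br v w"] br_br by simp

lemma om_eqI: "(\<And>w. om u w = om v w) \<Longrightarrow> u = v"
  using om_nondeg[of "u - v"] by (simp add: linear_diff[OF om_linear(2)])

lemma om_representation: "linear l \<Longrightarrow> \<exists>d. \<forall>x. l x = om x d"
  using finite_span symplectic_representation[OF _ _ om_bilinear om_skew om_nondeg] by metis

text \<open>The definite description is meaningful: representation of the functionals
  \<open>om (f x) y\<close> in \<open>x\<close> gives existence, nondegeneracy gives
  uniqueness.\<close>

lemma om_adjoint:
  assumes f: "linear f" shows "om (f x) y = om x (om_adjoint om f y)"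
proof -
  have "\<forall>y. \<exists>d. \<forall>x. om (f x) y = om x d"
    using om_representation[OF linear_compose[OF f om_linear(2)]] by (simp add: comp_def)
  then obtain g where g: "\<And>x y. om (f x) y = om x (g y)" by metis
  have "(THE g. \<forall>x y. om (f x) y = om x (g y)) = g"
  proof (rule the_equality)
    fix h assume "\<forall>x y. om (f x) y = om x (h y)"
    then have "om (h y) x = om (g y) x" for x y
      using g om_skew by metis
    then show "h = g" using om_eqI by blast
  qed (use g in blast)
  then show ?thesis using g by (simp add: om_adjoint_def)
qed

text \<open>This product describes the connection: \<open>\<nabla> u\<^sup>+ v\<^sup>+ = (lsp u v)\<^sup>+\<close>.\<close>

definition lsp :: "'a \<Rightarrow> 'a \<Rightarrow> 'a" where
  "lsp u v = - om_adjoint om (br u) v"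

text \<open>This is the relation defining the connection, read in the Lie algebra. It is what
  identifies \<open>lsp\<close> as the connection in \<open>D_E\<close>.\<close>

lemma om_lsp: "om (lsp u v) w = - om v (br u w)"
proof -
  have "om (lsp u v) w = - om (om_adjoint om (br u) v) w"
    by (simp add: lsp_def linear_neg[OF om_linear(2)])
  also have "\<dots> = om w (om_adjoint om (br u) v)" using om_skew[of w] by simp
  also have "\<dots> = om (br u w) v" using om_adjoint[OF br_linear(1)] by simp
  finally show ?thesis using om_skew[of v] by simp
qed

lemma om_lsp': "om v (lsp u w) = om w (br u v)"
  using om_lsp[of u w v] om_skew[of v "lsp u w"] by simp

text \<open>This is the condition that \<open>ad_u\<close> commutes with the adjoint of
  \<open>ad_v\<close>. The second form follows by skew symmetry of the bracket, which requires
  \<open>lsp v\<close> to respect signs; nondegeneracy supplies that.\<close>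

lemma br_lsp: "br u (lsp v x) = lsp v (br u x)" "br (lsp v x) u = lsp v (br x u)"
proof -
  show 1: "br u (lsp v x) = lsp v (br u x)" for u
    by (simp add: lsp_def linear_neg[OF br_linear(1)] br_adjoint)
  have "lsp v (- y) = - lsp v y" for y
    by (rule om_eqI) (simp add: om_lsp linear_neg[OF om_linear(2)])
  then show "br (lsp v x) u = lsp v (br x u)"
    using 1[of u] br_skew[of "lsp v x" u] br_skew[of x u] by simp
qed

text \<open>Adjunction turns the left side into \<open>om v (br u w) - om w (br u v)\<close>, two of
  the three terms of the cocycle identity; the third is the right side.\<close>

lemma cov1: "- (om (lsp u v) w + om v (lsp u w)) = om u (br v w)"
  using om_cocycle[of u v w] om_skew[of v "br u w"] om_skew[of w "br u v"] om_skew[of u "br v w"]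
    br_skew[of w u] linear_neg[OF om_linear(2), of "br u w" v]
  by (simp add: om_lsp om_lsp')

text \<open>By adjunction the first term is \<open>- om u (br z (br v w))\<close>, which
  2-nilpotency kills. In the other two \<open>lsp z\<close> is pulled out of the bracket, and each
  becomes \<open>om (br v w) (br z u)\<close>; hence the factor \<open>-2\<close>.\<close>

lemma cov2:
  "- (om (lsp z u) (br v w) + om u (br (lsp z v) w) + om u (br v (lsp z w))) = -2 * om (br v w) (br z u)"
  by (simp add: om_lsp om_lsp' br_lsp br_br' linear_0[OF om_linear(1)])

text \<open>In every term \<open>lsp y\<close> comes out of its bracket and is moved to the other
  side of \<open>om\<close>, where it becomes \<open>br y\<close> of a bracket, which is 0.\<close>

lemma cov3:
  "om (br v w) (br (lsp y z) u) + om (br v w) (br z (lsp y u)) +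
   om (br (lsp y v) w) (br z u) + om (br v (lsp y w)) (br z u) = 0"
  by (simp add: om_lsp om_lsp' br_lsp br_br' linear_0[OF om_linear(1)])

end

section \<open>The connection and the form in the left invariant frame\<close>

locale symplectic_Poisson_group = Lie_grp G M + symplectic_Poisson br om
  for G :: "('p, 'r) monoid_scheme" (structure) and M :: "('p, 'n::finite) smooth_structure"
    and br :: "'a::real_vector \<Rightarrow> 'a \<Rightarrow> 'a" and om :: "'a \<Rightarrow> 'a \<Rightarrow> real" +
  fixes \<iota> :: "'a \<Rightarrow> 'p tvec" and Om :: "'p form2" and D :: "'p connection"
  assumes iota: "Lie_algebra_of_group G M br \<iota>"
    and Om: "two_form M Om" and Om_inv: "left_invariant_form G M Om"
    and Om_one: "Om \<one> (\<iota> u) (\<iota> v) = om u v"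
    and D: "linear_connection M D"
    and D_left_inv: "p \<in> carrier G \<Longrightarrow>
        Om p (D (left_inv_field G (\<iota> u)) (left_inv_field G (\<iota> v)) p) (left_inv_field G (\<iota> w) p)
        = - Om p (left_inv_field G (\<iota> v) p)
              (lie_bracket M (left_inv_field G (\<iota> u)) (left_inv_field G (\<iota> w)) p)"
begin

abbreviation E :: "'a \<Rightarrow> 'p vfield" where "E u \<equiv> left_inv_field G (\<iota> u)"

lemma iota_tangent: "\<iota> u \<in> tangent_space M \<one>"
  using iota by (auto simp: Lie_algebra_of_group_def bij_betw_def)

lemma iota_comb: "\<iota> (a *\<^sub>R u + b *\<^sub>R v) = (\<lambda>f. a * \<iota> u f + b * \<iota> v f)"
  using iota by (simp add: Lie_algebra_of_group_def)

lemma iota_sum: "finite I \<Longrightarrow> \<iota> (\<Sum>i\<in>I. c i *\<^sub>R x i) f = (\<Sum>i\<in>I. c i * \<iota> (x i) f)"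
proof (induction I rule: finite_induct)
  case empty
  show ?case using iota_comb[of 0 0 0 0] by simp
next
  case (insert i I)
  then show ?case using iota_comb[of "c i" "x i" 1 "\<Sum>i\<in>I. c i *\<^sub>R x i"] by simp
qed

lemma E_vfield: "U \<subseteq> points M \<Longrightarrow> E u \<in> vfields_on M U"
  by (rule vfields_on_subset[OF left_inv_vfield[OF iota_tangent]])

lemma E_surj:
  assumes p: "p \<in> points M" and v: "v \<in> tangent_space M p"
  obtains x where "v = E x p"
proof -
  obtain u where u: "u \<in> tangent_space M \<one>" "left_inv_field G u p = v"
    by (rule left_inv_field_surj[OF p v])
  have "range \<iota> = tangent_space M \<one>"
    using iota by (simp add: Lie_algebra_of_group_def bij_betw_def)
  with u(1) obtain x where "u = \<iota> x" by (metis imageE)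
  with u(2) have "v = E x p" by simp
  then show thesis by (rule that)
qed

lemma Om_E: 
  assumes "p \<in> points M" shows "Om p (E u p) (E v p) = om u v"
proof -
  have "Om (p \<otimes> \<one>) (differential (left_transl G p) (\<iota> u)) (differential (left_transl G p) (\<iota> v))
      = Om \<one> (\<iota> u) (\<iota> v)"
    using Om_inv assms one_point iota_tangent unfolding left_invariant_form_def carrier_points by blast
  then show ?thesis
    using assms by (simp add: left_inv_field_def Om_one flip: carrier_points)
qed

lemma bracket_E:
  assumes "p \<in> points M" shows "lie_bracket M (E u) (E v) p = E (br u v) p"
  using lie_bracket_left_inv[OF iota_tangent iota_tangent assms] iota
  by (simp add: Lie_algebra_of_group_def)

text \<open>Each tangent vector at \<open>p\<close> is the value of some left invariant field, so
  \<open>D (E u) (E v) p = E x p\<close> for some \<open>x\<close>. Testing against all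
  \<open>E w\<close> gives \<open>om x w = om (lsp u v) w\<close>, and nondegeneracy determines
  \<open>x\<close>.\<close>

lemma D_E:
  assumes p: "p \<in> points M" shows "D (E u) (E v) p = E (lsp u v) p"
proof -
  have "D (E u) (E v) \<in> vfields_on M (points M)"
    by (intro connection_vfield[OF D openin_topspace] E_vfield) auto
  from vfields_on_tangent[OF this p] obtain x where x: "D (E u) (E v) p = E x p"
    by (rule E_surj[OF p])
  have "om x w = om (lsp u v) w" for w
    using D_left_inv[of p u v w] p by (simp add: x Om_E bracket_E om_lsp carrier_points)
  then have "x = lsp u v" by (rule om_eqI)
  with x show ?thesis by simp
qed

text \<open>With \<open>d\<close> the \<open>om\<close>-dual family of a basis \<open>B\<close>, the
  coefficient of \<open>X\<close> along \<open>E b\<close> is \<open>Om\<close> evaluated on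
  \<open>X\<close> and \<open>E (d b)\<close>. Smoothness of the coefficients is thus inherited from
  the form, and one basis serves all open sets.\<close>

lemma E_frame:
  obtains B :: "'a set" where "\<forall>U. openin (mtop M) U \<longrightarrow> frame_on U B E"
proof -
  obtain B0 :: "'a set" where B0: "finite B0" "span B0 = UNIV" using finite_span by blast
  obtain B where B: "B \<subseteq> B0" "independent B" "B0 \<subseteq> span B"
    using maximal_independent_subset[of B0] by blast
  have fB: "finite B" using B(1) B0(1) by (rule finite_subset)
  have sB: "span B = UNIV" using span_mono[OF B(3)] B0(2) by (auto simp: span_span)
  have "\<exists>d. \<forall>x. representation B x b = om x d" for b
    by (rule om_representation)
      (auto intro!: linearI simp: representation_add[OF B(2)] representation_scale[OF B(2)] sB)
  then obtain d where d: "\<And>x b. representation B x b = om x (d b)" by metis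
  have expand: "E x p f = (\<Sum>b\<in>B. om x (d b) * E b p f)" for x p f
  proof -
    have "x = (\<Sum>b\<in>B. om x (d b) *\<^sub>R b)"
      using sum_representation_eq[OF B(2) _ fB order_refl, of x] sB by (simp add: d)
    then have "\<iota> x g = (\<Sum>b\<in>B. om x (d b) * \<iota> b g)" for g
      using iota_sum[OF fB, of "\<lambda>b. om x (d b)" "\<lambda>b. b" g] by simp
    then show ?thesis by (simp add: left_inv_field_eq)
  qed
  have "frame_on U B E" if U: "openin (mtop M) U" for U
    unfolding frame_on_def
  proof (intro conjI ballI)
    have UM: "U \<subseteq> points M" using openin_subset[OF U] .
    show "E b \<in> vfields_on M U" for b by (rule E_vfield[OF UM])
    fix X assume X: "X \<in> vfields_on M U"
    have s: "smooth_fun_on M U (\<lambda>p. Om p (X p) (E (d b) p))" for b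
      using Om U X E_vfield[OF UM] unfolding two_form_def by blast
    have "X p f = (\<Sum>b\<in>B. Om p (X p) (E (d b) p) * E b p f)" if p: "p \<in> U" for p f
    proof -
      have pM: "p \<in> points M" using p UM by auto
      obtain x where "X p = E x p" by (rule E_surj[OF pM vfields_on_tangent[OF X p]])
      then show ?thesis by (simp add: Om_E[OF pM] expand[of x p f])
    qed
    with s show "\<exists>c. (\<forall>i\<in>B. smooth_fun_on M U (c i)) \<and> (\<forall>p\<in>U. \<forall>f. X p f = (\<Sum>i\<in>B. c i p * E i p f))"
      by (intro exI[of _ "\<lambda>b p. Om p (X p) (E (d b) p)"]) auto
  qed (rule fB)
  then show thesis by (blast intro: that)
qed

section \<open>Iterated covariant derivatives on left invariant fields\<close>

abbreviation cov :: "nat \<Rightarrow> 'p tensor_field" where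
  "cov k \<equiv> (cov_deriv D ^^ k) (form_tensor Om)"

text \<open>To the two slots of the form each derivative adds one in front, its direction; hence the
  arity \<open>k + 2\<close>.\<close>

lemma cov_tensorial: "openin (mtop M) U \<Longrightarrow> tensorial U (Suc (Suc k)) (cov k)"
  by (induction k) (use tensorial_form[OF Om] tensorial_cov_deriv[OF D] in \<open>auto simp: numeral_2_eq_2\<close>)

text \<open>Values that are constant on left invariant fields have zero derivative, so only the
  correction terms remain, and there the connection acts as \<open>lsp\<close>. The result is again
  constant, so the iteration becomes pure algebra.\<close>

lemma cov_deriv_E:
  assumes T: "tensorial (points M) k T"
    and t: "\<And>us q. length us = k \<Longrightarrow> q \<in> points M \<Longrightarrow> T (map E us) q = t us"
    and us: "length us = k" and p: "p \<in> points M"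
  shows "cov_deriv D T (map E (u # us)) p = - (\<Sum>i<k. t (us[i := lsp u (us ! i)]))"
proof -
  have E: "E x \<in> vfields_on M (points M)" for x by (rule E_vfield) simp
  have tan: "E u p \<in> tangent_space M p" using left_inv_tangent[OF iota_tangent p] .
  have Es: "length (map E us) = k" "set (map E us) \<subseteq> vfields_on M (points M)" using us E by auto
  have "E u p (T (map E us)) = E u p (\<lambda>q. t us)"
    by (rule tangent_germ[OF tan openin_topspace p]) (rule t[OF us])
  moreover have "T ((map E us)[i := D (E u) (map E us ! i)]) p = t (us[i := lsp u (us ! i)])"
    if i: "i < k" for i
  proof -
    have "T ((map E us)[i := D (E u) (map E us ! i)]) p = T ((map E us)[i := E (lsp u (us ! i))]) p"
      by (rule tensorial_update_cong[OF T Es _ E _ p])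
        (use i us in \<open>auto simp: D_E intro!: connection_vfield[OF D openin_topspace] E\<close>)
    also have "\<dots> = T (map E (us[i := lsp u (us ! i)])) p" by (simp add: map_update)
    also have "\<dots> = t (us[i := lsp u (us ! i)])" by (rule t) (use us p in auto)
    finally show ?thesis .
  qed
  ultimately show ?thesis by (simp add: us tangent_const[OF tan p])
qed

lemma cov0_E: "p \<in> points M \<Longrightarrow> cov 0 (map E [v, w]) p = om v w"
  by (simp add: form_tensor_def Om_E)

lemma cov1_E:
  assumes "p \<in> points M" shows "cov 1 (map E [u, v, w]) p = om u (br v w)"
proof -
  have "cov_deriv D (cov 0) (map E (u # [v, w])) p
      = - (\<Sum>i<2. (\<lambda>us. om (us ! 0) (us ! 1)) ([v, w][i := lsp u ([v, w] ! i)]))"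
  proof (rule cov_deriv_E[OF _ _ _ assms])
    show "tensorial (points M) 2 (cov 0)" using cov_tensorial[of "points M" 0] by (simp add: numeral_eq_Suc)
    fix us q assume us: "length (us :: 'a list) = 2" and q: "q \<in> points M"
    from us obtain a b where "us = [a, b]" by (auto simp: length_Suc_conv numeral_eq_Suc)
    then show "cov 0 (map E us) q = om (us ! 0) (us ! 1)" using cov0_E[OF q, of a b] by simp
  qed simp
  then show ?thesis using cov1[of u v w] by (simp add: numeral_eq_Suc)
qed

lemma cov2_E:
  assumes "p \<in> points M" shows "cov 2 (map E [z, u, v, w]) p = -2 * om (br v w) (br z u)"
proof -
  have "cov_deriv D (cov 1) (map E (z # [u, v, w])) p
      = - (\<Sum>i<3. (\<lambda>us. om (us ! 0) (br (us ! 1) (us ! 2))) ([u, v, w][i := lsp z ([u, v, w] ! i)]))"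
  proof (rule cov_deriv_E[OF _ _ _ assms])
    show "tensorial (points M) 3 (cov 1)" using cov_tensorial[of "points M" 1] by (simp add: numeral_eq_Suc)
    fix us q assume us: "length (us :: 'a list) = 3" and q: "q \<in> points M"
    from us obtain a b c where "us = [a, b, c]" by (auto simp: length_Suc_conv numeral_eq_Suc)
    then show "cov 1 (map E us) q = om (us ! 0) (br (us ! 1) (us ! 2))" using cov1_E[OF q, of a b c] by simp
  qed simp
  then show ?thesis using cov2[of z u v w] by (simp add: numeral_eq_Suc)
qed

lemma cov3_E:
  assumes "p \<in> points M" shows "cov 3 (map E [y, z, u, v, w]) p = 0"
proof -
  have "cov_deriv D (cov 2) (map E (y # [z, u, v, w])) p
      = - (\<Sum>i<4. (\<lambda>us. -2 * om (br (us ! 2) (us ! 3)) (br (us ! 0) (us ! 1)))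
             ([z, u, v, w][i := lsp y ([z, u, v, w] ! i)]))"
  proof (rule cov_deriv_E[OF _ _ _ assms])
    show "tensorial (points M) 4 (cov 2)" using cov_tensorial[of "points M" 2] by (simp add: numeral_eq_Suc)
    fix us q assume us: "length (us :: 'a list) = 4" and q: "q \<in> points M"
    from us obtain a b c d where "us = [a, b, c, d]" by (auto simp: length_Suc_conv numeral_eq_Suc)
    then show "cov 2 (map E us) q = -2 * om (br (us ! 2) (us ! 3)) (br (us ! 0) (us ! 1))"
      using cov2_E[OF q, of a b c d] by (simp add: numeral_eq_Suc)
  qed simp
  then show ?thesis using cov3[of v w y z u] by (simp add: numeral_eq_Suc)
qed

text \<open>The arity 5 counts three directions and the two slots of the form. Tensoriality carries
  the vanishing from the left invariant frame to all fields.\<close>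

lemma cov3_vanishes: "tensor_vanishes M 5 (cov 3)"
proof -
  obtain B :: "'a set" where B: "\<forall>U. openin (mtop M) U \<longrightarrow> frame_on U B E" by (rule E_frame)
  show ?thesis
  proof (rule tensor_vanishes_frame[OF _ B[rule_format]])
    show "tensorial U 5 (cov 3)" if "openin (mtop M) U" for U
      using cov_tensorial[OF that, of 3] by (simp add: numeral_eq_Suc)
    fix Xs p assume "length Xs = 5" "set Xs \<subseteq> E ` B" and p: "p \<in> points M"
    then obtain y z u v w where "Xs = map E [y, z, u, v, w]"
      by (auto simp: length_Suc_conv numeral_eq_Suc)
    then show "cov 3 Xs p = 0" using cov3_E[OF p] by simp
  qed
qed

end

section \<open>Polynomials of degree at most two\<close>

lemma finite_multi_degree: "finite {\<alpha> :: 'n::finite \<Rightarrow> nat. multi_degree \<alpha> \<le> k}"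
proof (rule finite_subset)
  show "finite (PiE (UNIV :: 'n set) (\<lambda>_. {..k}))" by (intro finite_PiE) auto
  show "{\<alpha> :: 'n \<Rightarrow> nat. multi_degree \<alpha> \<le> k} \<subseteq> PiE UNIV (\<lambda>_. {..k})"
  proof (intro subsetI PiE_I)
    fix \<alpha> :: "'n \<Rightarrow> nat" and i assume "\<alpha> \<in> {\<alpha>. multi_degree \<alpha> \<le> k}"
    moreover have "\<alpha> i \<le> multi_degree \<alpha>" unfolding multi_degree_def by (rule member_le_sum) auto
    ultimately show "\<alpha> i \<in> {..k}" by simp
  qed simp
qed

lemma multi_degree_le_1_cases:
  fixes \<alpha> :: "'n::finite \<Rightarrow> nat"
  assumes "multi_degree \<alpha> \<le> 1"
  obtains "\<alpha> = (\<lambda>_. 0)" | l where "\<alpha> = (\<lambda>i. if i = l then 1 else 0)"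
proof (cases "\<exists>l. \<alpha> l \<noteq> 0")
  case True
  then obtain l where l: "\<alpha> l \<noteq> 0" by blast
  have "multi_degree \<alpha> = \<alpha> l + (\<Sum>i\<in>UNIV - {l}. \<alpha> i)"
    unfolding multi_degree_def by (rule sum.remove) auto
  with assms l have "\<alpha> l = 1" "(\<Sum>i\<in>UNIV - {l}. \<alpha> i) = 0" by linarith+
  then have "\<alpha> l = 1" "\<And>i. i \<noteq> l \<Longrightarrow> \<alpha> i = 0" by simp_all
  then have "\<alpha> = (\<lambda>i. if i = l then 1 else 0)" by auto
  then show thesis by (rule that(2))
next
  case False
  then have "\<alpha> = (\<lambda>_. 0)" by auto
  then show thesis by (rule that(1))
qed

lemma prod_coordinate_power: "(\<Prod>i\<in>UNIV. (x $ i :: real) ^ (if i = l then 1 else 0)) = x $ l"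
proof -
  have "(\<Prod>i\<in>UNIV. (x $ i :: real) ^ (if i = l then 1 else 0)) = (\<Prod>i\<in>UNIV. if i = l then x $ i else 1)"
    by (rule prod.cong) auto
  then show ?thesis by simp
qed

lemma multi_degree_unit: "multi_degree (\<lambda>i. if i = l then k else 0) = k"
  by (simp add: multi_degree_def)

lemma poly_value_eq_lower:
  assumes "j \<le> k" "\<And>\<alpha>. multi_degree \<alpha> \<le> k \<Longrightarrow> P \<alpha> \<noteq> 0 \<Longrightarrow> multi_degree \<alpha> \<le> j"
  shows "poly_value k P x = poly_value j P x"
  unfolding poly_value_def
  by (rule sum.mono_neutral_right[OF finite_multi_degree]) (use assms in auto)

lemma poly_value_0: "poly_value 0 P x = P (\<lambda>_. 0)"
proof -
  have "{\<alpha> :: 'a \<Rightarrow> nat. multi_degree \<alpha> \<le> 0} = {\<lambda>_. 0}"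
    by (auto simp: multi_degree_def fun_eq_iff)
  then show ?thesis by (simp add: poly_value_def)
qed

text \<open>Monomials of degree at most 1 are constants or single coordinates, so the derivative
  \<open>L\<close> does not depend on the point. This is the form in which a degree below 2 is
  exploited later.\<close>

lemma poly_value_1_has_derivative:
  fixes P :: "('n::finite \<Rightarrow> nat) \<Rightarrow> real"
  obtains L where "\<forall>x. (poly_value 1 P has_derivative L) (at x)"
proof -
  have "\<exists>L. \<forall>x :: real ^ 'n. ((\<lambda>x. P \<alpha> * (\<Prod>i\<in>UNIV. (x $ i) ^ \<alpha> i)) has_derivative L) (at x)"
    if "multi_degree \<alpha> \<le> 1" for \<alpha>
    using that
  proof (cases rule: multi_degree_le_1_cases)
    case 1
    then show ?thesis by (intro exI[of _ "\<lambda>_. 0"]) auto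
  next
    case (2 l)
    then show ?thesis
      unfolding 2 prod_coordinate_power
      by (intro exI[of _ "\<lambda>v. P (\<lambda>i. if i = l then 1 else 0) * v $ l"] allI has_derivative_mult_right
          bounded_linear_imp_has_derivative bounded_linear_vec_nth)
  qed
  then have "\<forall>\<alpha>\<in>{\<alpha>. multi_degree \<alpha> \<le> 1}.
      \<exists>L. \<forall>x :: real ^ 'n. ((\<lambda>x. P \<alpha> * (\<Prod>i\<in>UNIV. (x $ i) ^ \<alpha> i)) has_derivative L) (at x)"
    by blast
  from bchoice[OF this] obtain L where "\<forall>\<alpha>\<in>{\<alpha>. multi_degree \<alpha> \<le> 1}.
      \<forall>x :: real ^ 'n. ((\<lambda>x. P \<alpha> * (\<Prod>i\<in>UNIV. (x $ i) ^ \<alpha> i)) has_derivative L \<alpha>) (at x)"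
    by (elim exE)
  then have "(poly_value 1 P has_derivative (\<lambda>v. \<Sum>\<alpha> | multi_degree \<alpha> \<le> 1. L \<alpha> v)) (at x)" for x
    unfolding poly_value_def[abs_def] by (intro has_derivative_sum) auto
  then show thesis using that by blast
qed

lemma poly_value_add: "poly_value k P x + poly_value k Q x = poly_value k (\<lambda>\<alpha>. P \<alpha> + Q \<alpha>) x"
  by (simp add: poly_value_def sum.distrib distrib_right)

lemma poly_value_sum:
  "finite I \<Longrightarrow> (\<Sum>i\<in>I. poly_value k (P i) x) = poly_value k (\<lambda>\<alpha>. \<Sum>i\<in>I. P i \<alpha>) x"
proof (induction I rule: finite_induct)
  case empty
  show ?case by (simp add: poly_value_def)
next
  case (insert i I)
  then show ?case by (simp add: poly_value_add)
qed

lemma poly_value_monomial: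
  fixes \<beta> :: "'n::finite \<Rightarrow> nat"
  assumes "multi_degree \<beta> \<le> k"
  shows "c * (\<Prod>i\<in>UNIV. (x $ i) ^ \<beta> i) = poly_value k (\<lambda>\<alpha>. if \<alpha> = \<beta> then c else 0) x"
proof -
  have "poly_value k (\<lambda>\<alpha>. if \<alpha> = \<beta> then c else 0) x
      = (\<Sum>\<alpha> | multi_degree \<alpha> \<le> k. if \<alpha> = \<beta> then c * (\<Prod>i\<in>UNIV. (x $ i) ^ \<beta> i) else 0)"
    unfolding poly_value_def by (rule sum.cong) auto
  also have "\<dots> = c * (\<Prod>i\<in>UNIV. (x $ i) ^ \<beta> i)"
    using assms finite_multi_degree[of k, where 'n = 'n] by simp
  finally show ?thesis by simp
qed

lemma quadratic_poly_value:
  fixes b :: "'n::finite \<Rightarrow> real"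
  shows "\<exists>P. \<forall>x. a + (\<Sum>i\<in>UNIV. b i * x $ i) + (\<Sum>i\<in>UNIV. \<Sum>j\<in>UNIV. c i j * (x $ i * x $ j)) = poly_value 2 P x"
proof -
  have "\<exists>P. \<forall>x. a = poly_value 2 P (x :: real ^ 'n)"
    using poly_value_monomial[of "\<lambda>_::'n. 0" 2 a] by (auto simp: multi_degree_def)
  then obtain A where A: "\<forall>x. a = poly_value 2 A (x :: real ^ 'n)" by (elim exE)
  have "\<exists>P. \<forall>x. b i * x $ i = poly_value 2 P x" for i
    using poly_value_monomial[of "\<lambda>j. if j = i then 1 else 0" 2 "b i"]
    by (auto simp: prod_coordinate_power multi_degree_unit simp del: power_0)
  then have "\<forall>i. \<exists>P. \<forall>x. b i * x $ i = poly_value 2 P x" by blast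
  from choice[OF this] obtain B where B: "\<forall>i x. b i * x $ i = poly_value 2 (B i) x" by (elim exE)
  have "\<exists>P. \<forall>x. c i j * (x $ i * x $ j) = poly_value 2 P x" for i j
  proof -
    \<comment> \<open>The sum of two unit multi-indices also covers \<open>i = j\<close>, where the
      exponent is 2.\<close>
    let ?\<beta> = "\<lambda>k. (if k = i then 1 else 0) + (if k = j then 1 else 0 :: nat)"
    have "multi_degree ?\<beta> = 2"
      unfolding multi_degree_def sum.distrib by simp
    moreover have "(\<Prod>k\<in>UNIV. (x $ k) ^ ?\<beta> k) = x $ i * x $ j" for x :: "real ^ 'n"
      unfolding power_add prod.distrib prod_coordinate_power ..
    ultimately show ?thesis using poly_value_monomial[of ?\<beta> 2 "c i j"] by auto
  qed
  then have "\<forall>z. \<exists>P. \<forall>x. c (fst z) (snd z) * (x $ fst z * x $ snd z) = poly_value 2 P x" by blast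
  from choice[OF this]
  obtain C where C: "\<forall>z x. c (fst z) (snd z) * (x $ fst z * x $ snd z) = poly_value 2 (C z) x" by (elim exE)
  have C': "c i j * (x $ i * x $ j) = poly_value 2 (C (i, j)) x" for i j x
    using C[rule_format, of "(i, j)" x] by simp
  have "a + (\<Sum>i\<in>UNIV. b i * x $ i) + (\<Sum>i\<in>UNIV. \<Sum>j\<in>UNIV. c i j * (x $ i * x $ j))
      = poly_value 2 (\<lambda>\<alpha>. A \<alpha> + (\<Sum>i\<in>UNIV. B i \<alpha>) + (\<Sum>i\<in>UNIV. \<Sum>j\<in>UNIV. C (i, j) \<alpha>)) x" for x
    unfolding B[rule_format] C' poly_value_add[symmetric] poly_value_sum[OF finite, symmetric] A[rule_format, of x, symmetric]
    ..
  then show ?thesis by blast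
qed

text \<open>Integration in two steps, each by the fact that a function with zero derivative on a
  connected open set is constant. It applies to \<open>g i\<close> minus its linear part and then to
  \<open>f\<close> minus \<open>?Q\<close>. The factor \<open>1/2\<close> in \<open>?Q\<close>
  compensates the doubling when a symmetric quadratic form is differentiated.\<close>

lemma quadratic_if_second_derivative_const:
  fixes f :: "real ^ 'n::finite \<Rightarrow> real"
  assumes S: "open S" "connected S"
    and f: "\<And>x. x \<in> S \<Longrightarrow> (f has_derivative (\<lambda>v. \<Sum>i\<in>UNIV. v $ i * g i x)) (at x)"
    and g: "\<And>i x. x \<in> S \<Longrightarrow> (g i has_derivative (\<lambda>v. \<Sum>j\<in>UNIV. v $ j * c j i)) (at x)"
    and sym: "\<And>i j. c i j = c j i"
  obtains P where "\<And>x. x \<in> S \<Longrightarrow> f x = poly_value 2 P x"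
proof (cases "S = {}")
  case True
  then show thesis using that[of "\<lambda>_. 0"] by simp
next
  case False
  then obtain x0 where x0: "x0 \<in> S" by blast
  have nth: "((\<lambda>x :: real ^ 'n. x $ i) has_derivative (\<lambda>v. v $ i)) (at x)" for i x
    by (intro bounded_linear_imp_has_derivative bounded_linear_vec_nth)
  \<comment> \<open>The constant term of the affine function \<open>g i\<close>, computed from its
    value at \<open>x0\<close>.\<close>
  let ?b = "\<lambda>i. g i x0 - (\<Sum>j\<in>UNIV. x0 $ j * c j i)"
  have gb: "g i x - (\<Sum>j\<in>UNIV. x $ j * c j i) = ?b i" if x: "x \<in> S" for i x
  proof (rule has_derivative_zero_unique_connected[OF S _ x x0])
    fix y assume y: "y \<in> S"
    have "((\<lambda>x. g i x - (\<Sum>j\<in>UNIV. x $ j * c j i)) has_derivative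
        (\<lambda>v. (\<Sum>j\<in>UNIV. v $ j * c j i) - (\<Sum>j\<in>UNIV. v $ j * c j i))) (at y)"
      by (intro has_derivative_diff has_derivative_sum has_derivative_mult_left nth g[OF y])
    then show "((\<lambda>x. g i x - (\<Sum>j\<in>UNIV. x $ j * c j i)) has_derivative (\<lambda>v. 0)) (at y)" by simp
  qed
  have g_eq: "g i x = ?b i + (\<Sum>j\<in>UNIV. x $ j * c j i)" if "x \<in> S" for i x
    using gb[OF that, of i] by linarith
  let ?Q = "\<lambda>x. (\<Sum>i\<in>UNIV. ?b i * x $ i) + (\<Sum>i\<in>UNIV. \<Sum>j\<in>UNIV. (1/2 * c i j) * (x $ i * x $ j))"
  have fQ: "f x - ?Q x = f x0 - ?Q x0" if x: "x \<in> S" for x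
  proof (rule has_derivative_zero_unique_connected[OF S _ x x0])
    fix y assume y: "y \<in> S"
    let ?D = "\<lambda>v. (\<Sum>i\<in>UNIV. v $ i * g i y) - ((\<Sum>i\<in>UNIV. ?b i * v $ i)
        + (\<Sum>i\<in>UNIV. \<Sum>j\<in>UNIV. (1/2 * c i j) * (y $ i * v $ j + v $ i * y $ j)))"
    have "((\<lambda>x. f x - ?Q x) has_derivative ?D) (at y)"
      by (intro has_derivative_diff has_derivative_add has_derivative_sum has_derivative_mult_right
          has_derivative_mult nth f[OF y])
    moreover have "?D v = 0" for v
    proof -
      \<comment> \<open>Symmetry of \<open>c\<close> enters here: exchanging the summation indices
        makes the two halves of the derivative equal.\<close>
      have "(\<Sum>i\<in>UNIV. \<Sum>j\<in>UNIV. (1/2 * c i j) * (y $ i * v $ j)) = (\<Sum>i\<in>UNIV. \<Sum>j\<in>UNIV. (1/2 * c i j) * (v $ i * y $ j))"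
        by (subst sum.swap) (simp add: sym mult.commute)
      then have "(\<Sum>i\<in>UNIV. \<Sum>j\<in>UNIV. (1/2 * c i j) * (y $ i * v $ j + v $ i * y $ j))
          = (\<Sum>i\<in>UNIV. \<Sum>j\<in>UNIV. c i j * (v $ i * y $ j))"
        by (simp add: distrib_left sum.distrib flip: sum_divide_distrib)
      moreover have "(\<Sum>i\<in>UNIV. v $ i * g i y)
          = (\<Sum>i\<in>UNIV. ?b i * v $ i) + (\<Sum>i\<in>UNIV. \<Sum>j\<in>UNIV. c i j * (v $ i * y $ j))"
      proof -
        have "v $ i * g i y = ?b i * v $ i + (\<Sum>j\<in>UNIV. c i j * (v $ i * y $ j))" for i
          unfolding g_eq[OF y] by (simp add: distrib_left sum_distrib_left sym[of _ i] mult_ac)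
        then show ?thesis by (simp only: sum.distrib)
      qed
      ultimately show ?thesis by simp
    qed
    ultimately show "((\<lambda>x. f x - ?Q x) has_derivative (\<lambda>v. 0)) (at y)" by simp
  qed
  have "\<exists>P. \<forall>x. (f x0 - ?Q x0) + (\<Sum>i\<in>UNIV. ?b i * x $ i)
      + (\<Sum>i\<in>UNIV. \<Sum>j\<in>UNIV. (1/2 * c i j) * (x $ i * x $ j)) = poly_value 2 P x"
    by (rule quadratic_poly_value)
  then obtain P where P: "\<And>x. (f x0 - ?Q x0) + (\<Sum>i\<in>UNIV. ?b i * x $ i)
      + (\<Sum>i\<in>UNIV. \<Sum>j\<in>UNIV. (1/2 * c i j) * (x $ i * x $ j)) = poly_value 2 P x"
    by blast
  have "f x = poly_value 2 P x" if "x \<in> S" for x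
    using fQ[OF that] P[of x] by linarith
  then show thesis by (rule that)
qed

section \<open>Affine charts\<close>

context symplectic_Poisson_group
begin

context
  fixes U \<phi> assumes aff: "affine_chart M D (U, \<phi>)"
begin

abbreviation e :: "'n \<Rightarrow> 'p vfield" where "e \<equiv> coord_field M (U, \<phi>)"

lemma chart: "smooth_chart M (U, \<phi>)"
  using aff by (simp add: affine_chart_def)

lemmas top_chart = smooth_chart_topological[OF chart]
lemmas open_dom = chart_open[OF top_chart]

lemma D_coord: "p \<in> U \<Longrightarrow> D (e i) (e j) p = (\<lambda>f. 0)"
  using aff by (simp add: affine_chart_def)

lemma open_image: "open (\<phi> ` U)"
  by (rule chart_open_image[OF top_chart open_dom order_refl])

text \<open>Zero derivative forces constancy only on connected sets, so connectedness of the domain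
  has to be carried to its image in coordinates.\<close>

lemma connected_image: "connected (\<phi> ` U)"
proof -
  have "continuous_map (subtopology (mtop M) U) (top_of_set (\<phi> ` U)) \<phi>"
    using top_chart by (auto simp: topological_chart_def homeomorphic_imp_continuous_map)
  then have "continuous_map (subtopology (mtop M) U) euclidean \<phi>"
    by (simp add: continuous_map_in_subtopology)
  moreover have "connectedin (subtopology (mtop M) U) U"
    using aff by (simp add: affine_chart_def connectedin_subtopology)
  ultimately show ?thesis
    using connectedin_continuous_map_image connectedin_iff_connected by metis
qed

lemma inv_chart: "p \<in> U \<Longrightarrow> inv_into U \<phi> (\<phi> p) = p"
  using inv_into_f_f[OF chart_inj[OF top_chart]] .

lemma e_vfields: "set (map e is) \<subseteq> vfields_on M U"
  using coord_field_vfield[OF chart] by auto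

text \<open>Every correction term contains \<open>D (e i) (e j)\<close>, which is zero on
  \<open>U\<close>. In an affine chart covariant differentiation is therefore partial
  differentiation of components.\<close>

lemma cov_coord:
  assumes "length is = Suc (Suc k)" and p: "p \<in> U"
  shows "cov (Suc k) (map e (i # is)) p = e i p (cov k (map e is))"
proof -
  note T = cov_tensorial[OF open_dom, of k]
  have "cov k ((map e is)[j := D (e i) (map e is ! j)]) p = 0" if j: "j < length is" for j
  proof -
    note ej = coord_field_vfield[OF chart, of i] and em = coord_field_vfield[OF chart, of "is ! j"]
    note Z = smooth_fun_on_const[OF open_dom, of 0]
    \<comment> \<open>The zero field is written as \<open>0 * e i + 0 * e i\<close>, so that
      linearity of the tensor evaluates the slot to 0.\<close>
    have "cov k ((map e is)[j := D (e i) (map e is ! j)]) p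
        = cov k ((map e is)[j := \<lambda>q h. 0 * e i q h + 0 * e i q h]) p"
      by (rule tensorial_update_cong[OF T _ e_vfields _ vfields_on_comb[OF open_dom ej ej Z Z] _ p])
        (use assms j connection_vfield[OF D open_dom ej em] in \<open>auto simp: D_coord\<close>)
    also have "\<dots> = 0 * cov k ((map e is)[j := e i]) p + 0 * cov k ((map e is)[j := e i]) p"
      by (rule tensorial_linear[OF T _ e_vfields _ ej ej Z Z p]) (use assms j in auto)
    finally show ?thesis by simp
  qed
  then show ?thesis by simp
qed

text \<open>The partial derivatives are given by \<open>cov_coord\<close>; tensoriality supplies the
  smoothness from which total differentiability follows.\<close>

lemma cov_has_derivative:
  assumes l: "length is = Suc (Suc k)" and x: "x \<in> \<phi> ` U"
  shows "((\<lambda>x. cov k (map e is) (inv_into U \<phi> x)) has_derivative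
     (\<lambda>v. \<Sum>i\<in>UNIV. v $ i * cov (Suc k) (map e (i # is)) (inv_into U \<phi> x))) (at x)"
proof -
  let ?F = "cov k (map e is) \<circ> inv_into U \<phi>"
  let ?F' = "frechet_derivative ?F (at x)"
  from x obtain p where p: "p \<in> U" "x = \<phi> p" by auto
  have near: "smooth_near M q (cov k (map e is))" if "q \<in> U" for q
    by (rule tensorial_smooth[OF cov_tensorial[OF open_dom] _ e_vfields that]) (simp add: l)
  then have "smooth_fun_on M U (cov k (map e is))"
    by (simp add: smooth_fun_on_iff_near[OF open_dom])
  from smooth_fun_on_chart[OF open_dom this chart]
  have F: "smooth_on (\<phi> ` U) ?F" by simp
  note F' = smooth_on_has_derivative[OF F x]
  interpret bounded_linear ?F' using F' by (rule has_derivative_bounded_linear)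
  have "?F' v = (\<Sum>i\<in>UNIV. v $ i * cov (Suc k) (map e (i # is)) (inv_into U \<phi> x))" for v
  proof -
    have "?F' v = ?F' (\<Sum>i\<in>UNIV. v $ i *\<^sub>R axis i 1)"
      by (subst basis_expansion[symmetric, of v]) (simp add: scalar_mult_eq_scaleR)
    also have "\<dots> = (\<Sum>i\<in>UNIV. v $ i * ?F' (axis i 1))"
      by (simp only: sum scaleR real_scaleR_def)
    also have "\<dots> = (\<Sum>i\<in>UNIV. v $ i * cov (Suc k) (map e (i # is)) (inv_into U \<phi> x))"
      unfolding p(2) inv_chart[OF p(1)] cov_coord[OF l p(1)] coord_field_smooth_near[OF near[OF p(1)]] ..
    finally show ?thesis .
  qed
  then have "?F' = (\<lambda>v. \<Sum>i\<in>UNIV. v $ i * cov (Suc k) (map e (i # is)) (inv_into U \<phi> x))"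
    by (rule ext)
  with F' show ?thesis by (simp only: comp_def)
qed

text \<open>Torsion freeness replaces Schwarz's theorem: it says that the coordinate fields commute.\<close>

lemma cov2_sym:
  assumes tf: "torsion_free M D" and p: "p \<in> U"
  shows "cov 2 (map e [l, m, i, j]) p = cov 2 (map e [m, l, i, j]) p"
proof -
  let ?f = "cov 0 (map e [i, j])"
  have near: "smooth_near M p ?f"
    by (rule tensorial_smooth[OF cov_tensorial[OF open_dom] _ e_vfields p]) simp
  have eq: "cov 2 (map e [l, m, i, j]) p = e l p (\<lambda>q. e m q ?f)" for l m
  proof -
    have "cov 2 (map e [l, m, i, j]) p = e l p (cov 1 (map e [m, i, j]))"
      using cov_coord[of "[m, i, j]" 1 p l] p by (simp add: numeral_2_eq_2)
    also have "\<dots> = e l p (\<lambda>q. e m q ?f)"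
      by (rule tangent_germ[OF coord_field_tangent[OF chart p] open_dom p])
        (use cov_coord[of "[i, j]" 0 _ m] in simp)
    finally show ?thesis .
  qed
  have "D (e l) (e m) p ?f - D (e m) (e l) p ?f = lie_bracket M (e l) (e m) p ?f"
    using tf open_dom p coord_field_vfield[OF chart] unfolding torsion_free_def by blast
  then show ?thesis
    using near unfolding eq by (simp add: D_coord[OF p] lie_bracket_def)
qed

text \<open>The third partial derivatives are components of \<open>cov 3\<close>, hence zero. The
  second ones are then constant on the connected image and, by \<open>cov2_sym\<close>,
  symmetric.\<close>

lemma components_quadratic:
  assumes tf: "torsion_free M D"
  shows "\<exists>P. \<forall>p\<in>U. Om p (e i p) (e j p) = poly_value 2 P (\<phi> p)"
proof (cases "U = {}")
  \<comment> \<open>An empty domain is a legitimate chart, for which the claim is vacuous; otherwise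
    \<open>p0\<close> is the base point at which the second derivatives are read off.\<close>
  case False
  then obtain p0 where p0: "p0 \<in> U" by blast
  let ?H = "\<lambda>k is x. cov k (map e is) (inv_into U \<phi> x)"
  have 3: "cov (Suc 2) (map e [n, l, m, i, j]) p = 0" if "p \<in> U" for n l m p
  proof -
    have "Suc 2 = (3::nat)" by simp
    then show ?thesis
      by (simp only:) (rule cov3_vanishes[unfolded tensor_vanishes_def, rule_format,
          OF open_dom _ e_vfields that], simp)
  qed
  have c: "?H 2 [l, m, i, j] x = ?H 2 [l, m, i, j] (\<phi> p0)" if x: "x \<in> \<phi> ` U" for l m x
  proof (rule has_derivative_zero_unique_connected[OF open_image connected_image _ x imageI[OF p0]])
    fix y assume y: "y \<in> \<phi> ` U"
    have "(?H 2 [l, m, i, j] has_derivative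
        (\<lambda>v. \<Sum>n\<in>UNIV. v $ n * ?H (Suc 2) [n, l, m, i, j] y)) (at y)"
      by (rule cov_has_derivative[OF _ y]) simp
    moreover have "?H (Suc 2) [n, l, m, i, j] y = 0" for n
      using y by (intro 3) (auto simp: inv_chart)
    ultimately show "(?H 2 [l, m, i, j] has_derivative (\<lambda>v. 0)) (at y)" by (simp only: mult_zero_right sum.neutral_const)
  qed
  obtain P where P: "\<And>x. x \<in> \<phi> ` U \<Longrightarrow> ?H 0 [i, j] x = poly_value 2 P x"
  proof (rule quadratic_if_second_derivative_const[OF open_image connected_image])
    show "(?H 0 [i, j] has_derivative (\<lambda>v. \<Sum>m\<in>UNIV. v $ m * ?H 1 [m, i, j] x)) (at x)"
      if "x \<in> \<phi> ` U" for x
      using cov_has_derivative[of "[i, j]" 0, OF _ that] by simp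
    show "(?H 1 [m, i, j] has_derivative (\<lambda>v. \<Sum>l\<in>UNIV. v $ l * ?H 2 [l, m, i, j] (\<phi> p0))) (at x)"
      if x: "x \<in> \<phi> ` U" for m x
      using cov_has_derivative[of "[m, i, j]" 1, OF _ x] c[OF x] by (simp add: numeral_2_eq_2)
    show "?H 2 [l, m, i, j] (\<phi> p0) = ?H 2 [m, l, i, j] (\<phi> p0)" for l m
      unfolding inv_chart[OF p0] by (rule cov2_sym[OF tf p0])
  qed blast
  have "Om p (e i p) (e j p) = poly_value 2 P (\<phi> p)" if "p \<in> U" for p
    using P[OF imageI[OF that]] by (simp add: inv_chart[OF that] form_tensor_def)
  then show ?thesis by blast
qed simp

section \<open>Consequences of a low degree for the Lie algebra\<close>

lemma cov1_zero_if_const: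
  assumes c: "\<And>i j p. p \<in> U \<Longrightarrow> Om p (e i p) (e j p) = C i j" and p: "p \<in> U"
  shows "cov 1 (map e [l, i, j]) p = 0"
proof -
  have "cov 1 (map e [l, i, j]) p = e l p (cov 0 (map e [i, j]))"
    using cov_coord[of "[i, j]" 0 p l] p by simp
  also have "\<dots> = e l p (\<lambda>q. C i j)"
    by (rule tangent_germ[OF coord_field_tangent[OF chart p] open_dom p])
      (simp add: form_tensor_def c)
  also have "\<dots> = 0"
    using tangent_const[OF coord_field_tangent[OF chart p]] openin_subset[OF open_dom] p by auto
  finally show ?thesis .
qed

text \<open>The derivative \<open>L\<close> of the component is the same at all points, so
  uniqueness of derivatives makes the components of \<open>cov 1\<close> the constants
  \<open>L (axis l 1)\<close>. Their derivatives are the components of \<open>cov 2\<close>.\<close>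

lemma cov2_zero_if_affine:
  assumes c: "\<And>i j. \<exists>F L. (\<forall>p\<in>U. Om p (e i p) (e j p) = F (\<phi> p)) \<and> (\<forall>x. (F has_derivative L) (at x))"
    and p: "p \<in> U"
  shows "cov 2 (map e [m, l, i, j]) p = 0"
proof -
  obtain F L where F: "\<And>p. p \<in> U \<Longrightarrow> Om p (e i p) (e j p) = F (\<phi> p)"
    and L: "\<And>x. (F has_derivative L) (at x)"
    using c[of i j] by blast
  have 1: "cov 1 (map e [l, i, j]) q = L (axis l 1)" if q: "q \<in> U" for q
  proof -
    have "((\<lambda>x. cov 0 (map e [i, j]) (inv_into U \<phi> x)) has_derivative L) (at (\<phi> q))"
      by (rule has_derivative_transform_within_open[OF L open_image imageI[OF q]])
        (auto simp: inv_chart form_tensor_def F)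
    from has_derivative_unique[OF this cov_has_derivative[OF _ imageI[OF q]]]
    have "L = (\<lambda>v. \<Sum>n\<in>UNIV. v $ n * cov (Suc 0) (map e [n, i, j]) q)"
      by (simp add: inv_chart[OF q])
    then have "L (axis l 1) = (\<Sum>n\<in>UNIV. (axis l 1 :: real ^ 'n) $ n * cov (Suc 0) (map e [n, i, j]) q)"
      by (rule fun_cong)
    also have "\<dots> = (\<Sum>n\<in>UNIV. if n = l then cov (Suc 0) (map e [l, i, j]) q else 0)"
      by (rule sum.cong) (auto simp: axis_def)
    finally show ?thesis by simp
  qed
  have "cov 2 (map e [m, l, i, j]) p = e m p (cov 1 (map e [l, i, j]))"
    using cov_coord[of "[l, i, j]" 1 p m] p by (simp add: numeral_2_eq_2)
  also have "\<dots> = e m p (\<lambda>q. L (axis l 1))"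
    by (rule tangent_germ[OF coord_field_tangent[OF chart p] open_dom p]) (rule 1)
  also have "\<dots> = 0"
    using tangent_const[OF coord_field_tangent[OF chart p]] openin_subset[OF open_dom] p by auto
  finally show ?thesis .
qed

text \<open>Vanishing of \<open>cov 1\<close> on the coordinate frame is transferred to left
  invariant fields, where its value is \<open>om u (br v w)\<close>. As \<open>u\<close> is
  arbitrary, nondegeneracy leaves \<open>br v w = 0\<close>.\<close>

lemma br_zero_if_const:
  assumes c: "\<And>i j p. p \<in> U \<Longrightarrow> Om p (e i p) (e j p) = C i j" and p: "p \<in> U"
  shows "br v w = 0"
proof -
  have pM: "p \<in> points M" using openin_subset[OF open_dom] p by auto
  have "om u (br v w) = 0" for u
  proof -
    have "cov 1 (map E [u, v, w]) p = 0"
    proof (rule tensorial_frame_zero[OF open_dom _ coord_frame[OF chart] _ _ _ p])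
      show "tensorial U 3 (cov 1)" using cov_tensorial[OF open_dom, of 1] by (simp add: numeral_eq_Suc)
      show "set (map E [u, v, w]) \<subseteq> vfields_on M U" using E_vfield[OF openin_subset[OF open_dom]] by auto
      fix Xs q assume "length Xs = 3" "set Xs \<subseteq> range e" and q: "q \<in> U"
      then obtain l i j where "Xs = map e [l, i, j]" by (auto simp: length_Suc_conv numeral_eq_Suc)
      then show "cov 1 Xs q = 0" using cov1_zero_if_const[OF c q] by simp
    qed simp
    then show ?thesis by (simp only: cov1_E[OF pM])
  qed
  then show ?thesis using om_skew[of "br v w"] by (intro om_nondeg) simp
qed

text \<open>The same change of frame for \<open>cov 2\<close>, whose value on left invariant fields
  is \<open>-2 * om (br v w) (br z u)\<close>.\<close>

lemma om_br_zero_if_affine: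
  assumes c: "\<And>i j. \<exists>F L. (\<forall>p\<in>U. Om p (e i p) (e j p) = F (\<phi> p)) \<and> (\<forall>x. (F has_derivative L) (at x))"
    and p: "p \<in> U"
  shows "om (br v w) (br z u) = 0"
proof -
  have pM: "p \<in> points M" using openin_subset[OF open_dom] p by auto
  have "cov 2 (map E [z, u, v, w]) p = 0"
  proof (rule tensorial_frame_zero[OF open_dom _ coord_frame[OF chart] _ _ _ p])
    show "tensorial U 4 (cov 2)" using cov_tensorial[OF open_dom, of 2] by (simp add: numeral_eq_Suc)
    show "set (map E [z, u, v, w]) \<subseteq> vfields_on M U" using E_vfield[OF openin_subset[OF open_dom]] by auto
    fix Xs q assume "length Xs = 4" "set Xs \<subseteq> range e" and q: "q \<in> U"
    then obtain m l i j where "Xs = map e [m, l, i, j]" by (auto simp: length_Suc_conv numeral_eq_Suc)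
    then show "cov 2 Xs q = 0" using cov2_zero_if_affine[OF c q] by simp
  qed simp
  then show ?thesis using cov2_E[OF pM, of z u v w] by linarith
qed

end

text \<open>The derived algebra is the span of the brackets, while the geometry yields a statement
  about single brackets; bilinearity closes the gap.\<close>

lemma om_span_br_zero:
  assumes 0: "\<And>v w z u. om (br v w) (br z u) = 0"
    and x: "x \<in> span {br u v |u v. True}" and y: "y \<in> span {br u v |u v. True}"
  shows "om x y = 0"
proof (rule linear_eq_0_on_span[OF om_linear(2) _ x])
  fix a assume "a \<in> {br u v |u v. True}"
  then obtain v w where a: "a = br v w" by blast
  show "om a y = 0"
    by (rule linear_eq_0_on_span[OF om_linear(1) _ y]) (auto simp: a 0)
qed

text \<open>One family \<open>P\<close> of coefficients is fixed for all components. Absence of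
  quadratic coefficients in it makes every component affine, and absence of linear ones as well
  makes every component constant; the preceding lemmas turn these into contradictions with the
  assumptions on \<open>br\<close> and \<open>om\<close>.\<close>

lemma polynomial_degree:
  assumes tf: "torsion_free M D" and nonab: "\<exists>u v. br u v \<noteq> 0" and aff: "affine_chart M D c"
  shows "\<exists>k\<in>{1, 2}. polynomial_of_degree M Om c k"
    and "\<exists>x\<in>span {br u v |u v. True}. \<exists>y\<in>span {br u v |u v. True}. om x y \<noteq> 0 \<Longrightarrow>
      polynomial_of_degree M Om c 2"
proof -
  obtain U \<phi> where c: "c = (U, \<phi>)" by (cases c)
  note aff = aff[unfolded c]
  let ?e = "coord_field M (U, \<phi>)"
  have "\<forall>z. \<exists>P. \<forall>p\<in>U. Om p (?e (fst z) p) (?e (snd z) p) = poly_value 2 P (\<phi> p)"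
    using components_quadratic[OF aff tf] by blast
  from choice[OF this] obtain P
    where "\<forall>z. \<forall>p\<in>U. Om p (?e (fst z) p) (?e (snd z) p) = poly_value 2 (P z) (\<phi> p)" by (elim exE)
  then have P: "Om p (?e i p) (?e j p) = poly_value 2 (P (i, j)) (\<phi> p)" if "p \<in> U" for i j p
    using that by (metis fst_conv snd_conv)
  \<comment> \<open>Over an empty domain the coefficients are unconstrained, so all of them are set
    to 1; \<open>multi_degree_unit\<close> exhibits a multi-index of degree
    \<open>k\<close>.\<close>
  have empty: "polynomial_of_degree M Om c k" if "U = {}" for k
    unfolding polynomial_of_degree_def c
    using that multi_degree_unit[of undefined k] by (intro exI[of _ "\<lambda>_ _ _. 1"]) auto
  have 2: "polynomial_of_degree M Om c 2" if "multi_degree \<alpha> = 2" "P (i, j) \<alpha> \<noteq> 0" for i j \<alpha>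
    unfolding polynomial_of_degree_def c
    using that P by (intro exI[of _ "\<lambda>i j. P (i, j)"]) auto
  have 1: "Om p (?e i p) (?e j p) = poly_value 1 (P (i, j)) (\<phi> p)"
    if no2: "\<forall>i j \<alpha>. multi_degree \<alpha> = 2 \<longrightarrow> P (i, j) \<alpha> = 0" and p: "p \<in> U" for i j p
  proof -
    have "multi_degree \<alpha> \<le> 1" if "multi_degree \<alpha> \<le> 2" "P (i, j) \<alpha> \<noteq> 0" for \<alpha>
      using no2 that by (metis One_nat_def Suc_1 le_SucE)
    then show ?thesis
      using P[OF p, of i j] poly_value_eq_lower[of 1 2 "P (i, j)" "\<phi> p"] by simp
  qed
  show "\<exists>k\<in>{1, 2}. polynomial_of_degree M Om c k"
  proof (rule ccontr)
    assume neg: "\<not> ?thesis"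
    then have no2: "\<forall>i j \<alpha>. multi_degree \<alpha> = 2 \<longrightarrow> P (i, j) \<alpha> = 0" and "U \<noteq> {}"
      using 2 empty by auto
    then obtain p where p: "p \<in> U" by blast
    \<comment> \<open>Once the quadratic coefficients are gone, a nonzero linear one would make the
      same \<open>P\<close> a witness for degree 1.\<close>
    have no1: "P (i, j) \<alpha> = 0" if "multi_degree \<alpha> = 1" for i j \<alpha>
    proof (rule ccontr)
      assume "P (i, j) \<alpha> \<noteq> 0"
      then have "polynomial_of_degree M Om c 1"
        unfolding polynomial_of_degree_def c
        using that 1[OF no2] by (intro exI[of _ "\<lambda>i j. P (i, j)"]) auto
      with neg show False by simp
    qed
    have "Om q (?e i q) (?e j q) = P (i, j) (\<lambda>_. 0)" if q: "q \<in> U" for i j q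
    proof -
      have "multi_degree \<alpha> \<le> 0" if "multi_degree \<alpha> \<le> 1" "P (i, j) \<alpha> \<noteq> 0" for \<alpha>
        using no1 that by (metis One_nat_def le_SucE)
      then show ?thesis
        using 1[OF no2 q, of i j] poly_value_eq_lower[of 0 1 "P (i, j)" "\<phi> q"]
        by (simp add: poly_value_0)
    qed
    from br_zero_if_const[OF aff this p] nonab show False by blast
  qed
  assume ex: "\<exists>x\<in>span {br u v |u v. True}. \<exists>y\<in>span {br u v |u v. True}. om x y \<noteq> 0"
  show "polynomial_of_degree M Om c 2"
  proof (rule ccontr)
    assume neg: "\<not> ?thesis"
    then have no2: "\<forall>i j \<alpha>. multi_degree \<alpha> = 2 \<longrightarrow> P (i, j) \<alpha> = 0" and "U \<noteq> {}"
      using 2 empty by auto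
    then obtain p where p: "p \<in> U" by blast
    have "\<exists>F L. (\<forall>p\<in>U. Om p (?e i p) (?e j p) = F (\<phi> p)) \<and> (\<forall>x. (F has_derivative L) (at x))" for i j
    proof -
      obtain L where "\<forall>x. (poly_value 1 (P (i, j)) has_derivative L) (at x)"
        by (rule poly_value_1_has_derivative)
      with 1[OF no2, of _ i j] show ?thesis by blast
    qed
    from om_br_zero_if_affine[OF aff this p] om_span_br_zero ex show False by blast
  qed
qed

end

theorem theorem5p2:
  fixes br :: "'a::real_vector \<Rightarrow> 'a \<Rightarrow> 'a"
    and \<omega> :: "'a \<Rightarrow> 'a \<Rightarrow> real"
    and G :: "('p, 'r) monoid_scheme"
    and M :: "('p, 'n::finite) smooth_structure"
    and \<iota> :: "'a \<Rightarrow> 'p tvec"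
    and \<Omega> :: "'p form2"
    and D :: "'p connection"
  assumes "symplectic_Poisson_algebra br \<omega>"
    and "\<exists>u v. br u v \<noteq> 0"
    and "Lie_group G M" and "connected_space (mtop M)"
    and "Lie_algebra_of_group G M br \<iota>"
    and "symplectic_form M \<Omega>" and "left_invariant_form G M \<Omega>"
    and "\<forall>u v. \<Omega> \<one>\<^bsub>G\<^esub> (\<iota> u) (\<iota> v) = \<omega> u v"
    and "linear_connection M D" and "left_invariant_connection G M D"
    and "flat M D" and "torsion_free M D"
    and "\<forall>u v w. \<forall>p\<in>carrier G.
           \<Omega> p (D (left_inv_field G (\<iota> u)) (left_inv_field G (\<iota> v)) p) (left_inv_field G (\<iota> w) p)
             = - \<Omega> p (left_inv_field G (\<iota> v) p) (lie_bracket M (left_inv_field G (\<iota> u)) (left_inv_field G (\<iota> w)) p)"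
  shows "tensor_vanishes M 5 ((cov_deriv D ^^ 3) (form_tensor \<Omega>)) \<and>
         (\<forall>c. affine_chart M D c \<longrightarrow> (\<exists>k\<in>{1, 2}. polynomial_of_degree M \<Omega> c k)) \<and>
         ((\<exists>x\<in>span {br u v |u v. True}. \<exists>y\<in>span {br u v |u v. True}. \<omega> x y \<noteq> 0) \<longrightarrow>
            (\<forall>c. affine_chart M D c \<longrightarrow> polynomial_of_degree M \<Omega> c 2))"
proof -
  have grp: "group G" and mfd: "smooth_manifold M" using assms(3) by (simp_all add: Lie_group_def)
  interpret symplectic_Poisson_group G M br \<omega> \<iota> \<Omega> D
  proof (intro symplectic_Poisson_group.intro Lie_grp.intro Lie_grp_axioms.intro manifold.intro
      symplectic_Poisson.intro symplectic_Poisson_group_axioms.intro grp mfd)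
    show "two_form M \<Omega>" using assms(6) by (simp add: symplectic_form_def)
  qed (use assms in blast)+
  show ?thesis
    using cov3_vanishes polynomial_degree[OF assms(12) assms(2)] by blast
qed

end
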